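(* Fix $q\in\{1,\dots,p\}$ and let $m_{ODRF_q,B,n}$ be the random forest estimator with $B\ge1$ random ODT$_q$'s (exactly $q$ randomly chosen features at every split), each grown on a subsample of size $a_n$ and having $t_n$ leaves, as defined in the context. Assume $\mathbf E(e^{cY^2})<\infty$ for some $c>0$, and that $$m(x)=\sum_{\tau=1}^V m_\tau(x_{\mathcal C_\tau}),\qquad x\in[0,1]^p,$$ where $\mathcal C_1,\dots,\mathcal C_V\subseteq\{1,\dots,p\}$ are fixed index sets with $\mathrm{Card}(\mathcal C_\tau)=q$ and each $m_\tau$ is a continuous function of the $q$ variables $x_{\mathcal C_\tau}$. If $a_n\to\infty$, $t_n\to\infty$ and $t_n=o\left(\frac{a_n}{\ln^4a_n}\right)$, then $$\mathbf E\left(\int|m_{ODRF_q,B,n}(x)-m(x)|^2\,d\mu(x)\right)\to0\quad\text{as }n\to\infty,$$ where the expectation is over the data $\mathcal D_n$ and all the random seeds used to build the trees.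
   Context: **Setting.** $p\ge1$ is fixed, $X$ is a random vector in $[0,1]^p$ with distribution $\mu$, $Y$ is a real random variable, $m(x)=\mathbf E(Y\mid X=x)$, and $\mathcal D_n=\{(X_i,Y_i)\}_{i=1}^n$ are i.i.d. copies of $(X,Y)$. $\Theta^q=\{\theta\in\mathbb R^q:\|\theta\|_2=1\}$. For $\mathcal S\subseteq\{1,\dots,p\}$, $x_{\mathcal S}$ is the subvector of $x$ with coordinates in $\mathcal S$. **Random ODT$_q$.** Let $\mathfrak G$ be a uniformly random subset of $\{1,\dots,n\}$ of size $a_n\le n$ (subsampling without replacement); only the data $(X_i,Y_i)$, $i\in\mathfrak G$, are used. For $A\subseteq[0,1]^p$ let $N(A)=\#\{i\in\mathfrak G:X_i\in A\}$ and let $\bar Y_A$ be the mean of $Y_i$ over $i\in\mathfrak G$ with $X_i\in A$ ($0$ if there are none). Let $\mathcal S_1,\dots,\mathcal S_{t_n-1}$ be i.i.d. and uniformly distributed over the subsets of $\{1,\dots,p\}$ of size $q$, independent of the data. For such $\mathcal S$, $\theta\in\Theta^q$, $s\in\mathbb R$, let $A^+=\{x\in A:\theta^Tx_{\mathcal S}\le s\}$, $A^-=\{x\in A:\theta^Tx_{\mathcal S}>s\}$ and $$\Delta_{A,q}(\theta,s)=\frac1{N(A)}\Big[\sum_{X_i\in A}(Y_i-\bar Y_A)^2-\sum_{X_i\in A^+}(Y_i-\bar Y_{A^+})^2-\sum_{X_i\in A^-}(Y_i-\bar Y_{A^-})^2\Big]$$ (sums over $i\in\mathfrak G$). Starting from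 layer $0$ consisting of the node $[0,1]^p$, the nodes of the current layer are processed one after another: a node with at most one data point is passed unchanged to the next layer; a node $A$ with at least two data points is split, and if this is the $\tau$-th split it is split into $A^+,A^-$ using $\mathcal S=\mathcal S_\tau$ and a maximizer $(\hat\theta_A,\hat s_A)$ of $\Delta_{A,q}$ over $\Theta^q\times\mathbb R$; the daughters are put in the next layer. When a layer is exhausted one moves to the next; one stops as soon as there are $t_n$ leaves ($t_n\le a_n$). The tree estimator at $x$ equals $\bar Y_A$ where $A$ is the leaf containing $x$. **Forest.** $m_{ODRF_q,B,n}$ is the average of $B$ such tree estimators built from the same $\mathcal D_n$ with independent copies of the random seeds (subsample and feature subsets). *)

theory Defs
  imports "HOL-Probability.Probability" "HOL-Library.Landau_Symbols"
begin

definition unit_cube :: "(real, 'n::finite) vec set" where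
  "unit_cube = {x. \<forall>i. 0 \<le> x $ i \<and> x $ i \<le> 1}"

text \<open>
  The subvector \<open>x\<^sub>S\<close>, for an index set \<open>S\<close> with \<open>card S = CARD('q)\<close>: the coordinates in \<open>S\<close>
  are listed in increasing order, and \<open>card {k. k < j}\<close> is the position of the index \<open>j\<close>
  in the linear order of \<open>'q\<close>.
\<close>
definition subvec :: "'p::{finite,linorder} set \<Rightarrow> (real, 'p) vec \<Rightarrow> (real, 'q::{finite,linorder}) vec" where
  "subvec S x = (\<chi> j. x $ (sorted_list_of_set S ! card {k. k < j}))"

text \<open>
  The conditional mean \<open>E(Y | X = x)\<close> is a Borel function \<open>m\<close> such that \<open>m \<circ> X\<close> is a version of
  \<open>E(Y | X)\<close>; \<open>vimage_algebra (space M) X borel\<close> is the \<open>\<sigma>\<close>-algebra generated by \<open>X\<close>.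
\<close>
definition regression_function ::
    "'w measure \<Rightarrow> ('w \<Rightarrow> (real, 'p::finite) vec) \<Rightarrow> ('w \<Rightarrow> real) \<Rightarrow> ((real, 'p) vec \<Rightarrow> real) \<Rightarrow> bool" where
  "regression_function M X Y m \<longleftrightarrow>
     m \<in> borel_measurable borel \<and>
     (AE \<omega> in M. real_cond_exp M (vimage_algebra (space M) X borel) Y \<omega> = m (X \<omega>))"

text \<open>
  A data set is a map \<open>D\<close> sending the index \<open>i\<close> to \<open>(X\<^sub>i, Y\<^sub>i)\<close>; \<open>G\<close> is the set of subsampled
  indices and \<open>A\<close> a node.
\<close>
type_synonym 'p data = "nat \<Rightarrow> (real, 'p) vec \<times> real"

definition node_points :: "'p data \<Rightarrow> nat set \<Rightarrow> (real, 'p) vec set \<Rightarrow> nat set" where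
  "node_points D G A = {i \<in> G. fst (D i) \<in> A}"

definition node_count :: "'p data \<Rightarrow> nat set \<Rightarrow> (real, 'p) vec set \<Rightarrow> nat" where
  "node_count D G A = card (node_points D G A)"

text \<open>The value on a node without data is \<open>0 / 0 = 0\<close>.\<close>
definition node_mean :: "'p data \<Rightarrow> nat set \<Rightarrow> (real, 'p) vec set \<Rightarrow> real" where
  "node_mean D G A = (\<Sum>i\<in>node_points D G A. snd (D i)) / real (node_count D G A)"

definition node_sse :: "'p data \<Rightarrow> nat set \<Rightarrow> (real, 'p) vec set \<Rightarrow> real" where
  "node_sse D G A = (\<Sum>i\<in>node_points D G A. (snd (D i) - node_mean D G A)\<^sup>2)"

definition node_pos ::
    "'p::{finite,linorder} set \<Rightarrow> (real, 'q::{finite,linorder}) vec \<times> real \<Rightarrow> (real, 'p) vec set \<Rightarrow> (real, 'p) vec set" where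
  "node_pos S = (\<lambda>(\<theta>, s) A. {x \<in> A. \<theta> \<bullet> subvec S x \<le> s})"

definition node_neg ::
    "'p::{finite,linorder} set \<Rightarrow> (real, 'q::{finite,linorder}) vec \<times> real \<Rightarrow> (real, 'p) vec set \<Rightarrow> (real, 'p) vec set" where
  "node_neg S = (\<lambda>(\<theta>, s) A. {x \<in> A. \<theta> \<bullet> subvec S x > s})"

definition impurity_gain ::
    "'p::{finite,linorder} data \<Rightarrow> nat set \<Rightarrow> 'p set \<Rightarrow> (real, 'p) vec set
      \<Rightarrow> (real, 'q::{finite,linorder}) vec \<times> real \<Rightarrow> real" where
  "impurity_gain D G S A c =
     (node_sse D G A - node_sse D G (node_pos S c A) - node_sse D G (node_neg S c A))
       / real (node_count D G A)"

text \<open>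
  The maximizer of the impurity gain is not unique. A split rule is an arbitrary choice
  of a maximizer \<open>(\<theta>, s)\<close>, given the (subsampled) data, the features and the node.
\<close>
type_synonym ('p, 'q) split_rule =
  "'p data \<Rightarrow> nat set \<Rightarrow> 'p set \<Rightarrow> (real, 'p) vec set \<Rightarrow> (real, 'q) vec \<times> real"

definition maximizing_rule :: "('p::{finite,linorder}, 'q::{finite,linorder}) split_rule \<Rightarrow> bool" where
  "maximizing_rule sel \<longleftrightarrow>
     (\<forall>D G S A. finite G \<longrightarrow> card S = CARD('q) \<longrightarrow> 2 \<le> node_count D G A \<longrightarrow>
        is_arg_max (impurity_gain D G S A) (\<lambda>c. c \<in> sphere 0 1 \<times> UNIV) (sel D G S A))"

lemma maximizing_rule_exists:
  "\<exists>sel :: ('p::{finite,linorder}, 'q::{finite,linorder}) split_rule. maximizing_rule sel"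
proof -
  have "\<exists>c :: (real, 'q) vec \<times> real.
        is_arg_max (impurity_gain D G S A) (\<lambda>c. c \<in> sphere 0 1 \<times> UNIV) c"
    if "finite G" for D G and S :: "'p set" and A
  proof -
    define P where "P = (sphere 0 1 \<times> UNIV :: ((real, 'q) vec \<times> real) set)"
    define h where "h = (\<lambda>(I, J). (node_sse D G A
        - (\<Sum>i\<in>I. (snd (D i) - (\<Sum>i\<in>I. snd (D i)) / real (card I))\<^sup>2)
        - (\<Sum>i\<in>J. (snd (D i) - (\<Sum>i\<in>J. snd (D i)) / real (card J))\<^sup>2)) / real (node_count D G A))"
    have "impurity_gain D G S A ` P \<subseteq> h ` (Pow G \<times> Pow G)"
    proof
      fix y assume "y \<in> impurity_gain D G S A ` P"
      then obtain c :: "(real, 'q) vec \<times> real" where "y = impurity_gain D G S A c" by blast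
      then have "y = h (node_points D G (node_pos S c A), node_points D G (node_neg S c A))"
        by (simp add: h_def impurity_gain_def node_sse_def[of D G "node_pos S c A"]
            node_sse_def[of D G "node_neg S c A"] node_mean_def node_count_def)
      moreover have "node_points D G B \<subseteq> G" for B by (auto simp: node_points_def)
      ultimately show "y \<in> h ` (Pow G \<times> Pow G)" by blast
    qed
    then have fin: "finite (impurity_gain D G S A ` P)"
      using that by (meson finite_Pow_iff finite_SigmaI finite_imageI finite_subset)
    obtain v :: "(real, 'q) vec" where "norm v = 1" using vector_choose_size[of 1] by auto
    then have "impurity_gain D G S A ` P \<noteq> {}" by (auto simp: P_def)
    from Max_in[OF fin this] obtain c where c: "c \<in> P"
      "impurity_gain D G S A c = Max (impurity_gain D G S A ` P)" by auto
    then have "is_arg_max (impurity_gain D G S A) (\<lambda>c. c \<in> P) c"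
      unfolding is_arg_max_def using Max_ge[OF fin] by (auto simp: not_less)
    then show ?thesis unfolding P_def by blast
  qed
  then have "maximizing_rule (\<lambda>D G (S :: 'p set) A.
      SOME c :: (real, 'q) vec \<times> real. is_arg_max (impurity_gain D G S A) (\<lambda>c. c \<in> sphere 0 1 \<times> UNIV) c)"
    unfolding maximizing_rule_def by (auto intro: someI_ex)
  then show ?thesis by blast
qed

text \<open>
  One layer, processed from left to right. The arguments are the number \<open>k\<close> of splits
  made so far and the nodes still to be processed. After \<open>k\<close> splits the tree has \<open>k + 1\<close> leaves,
  so that once \<open>k + 1 = t\<close> no further split is made.
\<close>
fun odt_layer ::
    "('p::{finite,linorder}, 'q::{finite,linorder}) split_rule \<Rightarrow> nat \<Rightarrow> nat set \<Rightarrow> (nat \<Rightarrow> 'p set)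
      \<Rightarrow> 'p data \<Rightarrow> nat \<Rightarrow> (real, 'p) vec set list \<Rightarrow> nat \<times> (real, 'p) vec set list" where
  "odt_layer sel t G Ss D k [] = (k, [])"
| "odt_layer sel t G Ss D k (A # As) =
     (if k + 1 < t \<and> 2 \<le> node_count D G A then
        let S = Ss (k + 1);
            c = sel D G S A;
            (k', Bs) = odt_layer sel t G Ss D (k + 1) As
        in (k', node_pos S c A # node_neg S c A # Bs)
      else
        let (k', Bs) = odt_layer sel t G Ss D k As
        in (k', A # Bs))"

text \<open>
  As long as there are fewer than \<open>t \<le> card G\<close> leaves, some node has at least two data points, so
  every layer makes at least one split until there are \<open>t\<close> leaves. Hence \<open>t\<close> layers always suffice.
\<close>
definition odt_leaves ::
    "('p::{finite,linorder}, 'q::{finite,linorder}) split_rule \<Rightarrow> nat \<Rightarrow> nat set \<Rightarrow> (nat \<Rightarrow> 'p set)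
      \<Rightarrow> 'p data \<Rightarrow> (real, 'p) vec set list" where
  "odt_leaves sel t G Ss D =
     snd (((\<lambda>(k, As). odt_layer sel t G Ss D k As) ^^ t) (0, [unit_cube]))"

text \<open>The leaves partition the cube, and there are exactly \<open>t\<close> of them.\<close>

lemma odt_layer_partition:
  "length (filter (\<lambda>A. x \<in> A) (snd (odt_layer sel t G Ss D k As))) = length (filter (\<lambda>A. x \<in> A) As)"
  by (induction As arbitrary: k)
     (auto simp: Let_def node_pos_def node_neg_def case_prod_unfold not_less)

lemma odt_layer_length:
  "length (snd (odt_layer sel t G Ss D k As)) + k = fst (odt_layer sel t G Ss D k As) + length As"
proof (induction As arbitrary: k)
  case (Cons A As)
  show ?case
    using Cons.IH[of k] Cons.IH[of "k + 1"] by (simp add: Let_def case_prod_unfold)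
qed simp

lemma odt_layer_mono: "k \<le> fst (odt_layer sel t G Ss D k As)"
  by (induction As arbitrary: k) (simp_all add: Let_def case_prod_unfold Suc_leD)

lemma odt_layer_le: "k + 1 \<le> t \<Longrightarrow> fst (odt_layer sel t G Ss D k As) + 1 \<le> t"
proof (induction As arbitrary: k)
  case (Cons A As)
  show ?case
    using Cons.IH[of k] Cons.IH[of "k + 1"] Cons.prems
    by (simp add: Let_def case_prod_unfold)
qed simp

lemma odt_layer_less:
  "k + 1 < t \<Longrightarrow> A \<in> set As \<Longrightarrow> 2 \<le> node_count D G A \<Longrightarrow> k < fst (odt_layer sel t G Ss D k As)"
proof (induction As arbitrary: k)
  case (Cons A' As)
  show ?case
    using Cons.IH[of k] odt_layer_mono[of "k + 1" sel t G Ss D As] Cons.prems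
    by (auto simp add: Let_def case_prod_unfold)
qed simp

lemma sum_list_node_count:
  assumes "finite G"
  shows "sum_list (map (node_count D G) As) = (\<Sum>i\<in>G. length (filter (\<lambda>A. fst (D i) \<in> A) As))"
proof (induction As)
  case (Cons A As)
  have "node_count D G A = (\<Sum>i\<in>G. if fst (D i) \<in> A then 1 else 0)"
    using assms unfolding node_count_def node_points_def by (simp add: sum.If_cases Int_def)
  moreover have "(\<Sum>i\<in>G. length (filter (\<lambda>A. fst (D i) \<in> A) (A # As)))
      = (\<Sum>i\<in>G. (if fst (D i) \<in> A then 1 else 0) + length (filter (\<lambda>A. fst (D i) \<in> A) As))"
    by (rule sum.cong) auto
  ultimately show ?case using Cons by (simp add: sum.distrib)
qed simp

lemma odt_layers_invariant:
  fixes sel t G Ss D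
  defines "L \<equiv> \<lambda>j. ((\<lambda>(k, As). odt_layer sel t G Ss D k As) ^^ j) (0, [unit_cube])"
  assumes "1 \<le> t"
  shows "length (snd (L j)) = fst (L j) + 1" "fst (L j) + 1 \<le> t"
    "x \<in> unit_cube \<Longrightarrow> length (filter (\<lambda>A. x \<in> A) (snd (L j))) = 1"
    "t \<le> card G \<Longrightarrow> finite G \<Longrightarrow> (\<And>i. i \<in> G \<Longrightarrow> fst (D i) \<in> unit_cube) \<Longrightarrow> min j (t - 1) \<le> fst (L j)"
proof -
  have *: "length (snd (L j)) = fst (L j) + 1 \<and> fst (L j) + 1 \<le> t
    \<and> (\<forall>x\<in>unit_cube. length (filter (\<lambda>A. x \<in> A) (snd (L j))) = 1)
    \<and> (t \<le> card G \<longrightarrow> finite G \<longrightarrow> (\<forall>i\<in>G. fst (D i) \<in> unit_cube) \<longrightarrow> min j (t - 1) \<le> fst (L j))"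
  proof (induction j)
    case 0
    then show ?case using \<open>1 \<le> t\<close> by (simp add: L_def)
  next
    case (Suc j)
    obtain k As where kAs: "L j = (k, As)" by (cases "L j")
    have LS: "L (Suc j) = odt_layer sel t G Ss D k As"
      using kAs by (simp add: L_def)
    have IH: "length As = k + 1" "k + 1 \<le> t" "\<forall>x\<in>unit_cube. length (filter (\<lambda>A. x \<in> A) As) = 1"
      "t \<le> card G \<longrightarrow> finite G \<longrightarrow> (\<forall>i\<in>G. fst (D i) \<in> unit_cube) \<longrightarrow> min j (t - 1) \<le> k"
      using Suc kAs by auto
    have "min (Suc j) (t - 1) \<le> fst (odt_layer sel t G Ss D k As)"
      if G: "t \<le> card G" "finite G" "\<forall>i\<in>G. fst (D i) \<in> unit_cube"
    proof (cases "k + 1 < t")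
      case True
      have "\<exists>A\<in>set As. 2 \<le> node_count D G A"
      proof (rule ccontr)
        assume "\<not> ?thesis"
        then have "sum_list (map (node_count D G) As) \<le> sum_list (map (\<lambda>_. 1) As)"
          by (intro sum_list_mono) (auto simp: not_le)
        also have "\<dots> < t" using True IH by (simp add: sum_list_triv)
        also have "sum_list (map (node_count D G) As) = card G"
          using IH(3) G by (simp add: sum_list_node_count)
        finally show False using G by simp
      qed
      then have "k < fst (odt_layer sel t G Ss D k As)"
        using odt_layer_less[OF True] by blast
      then show ?thesis using IH G by auto
    next
      case False
      then show ?thesis using odt_layer_mono[of k sel t G Ss D As] by linarith
    qed
    then show ?case
      using IH LS odt_layer_length[of sel t G Ss D k As] odt_layer_le[of k t sel G Ss D As]
      by (auto simp: odt_layer_partition)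
  qed
  show "length (snd (L j)) = fst (L j) + 1" "fst (L j) + 1 \<le> t" using * by auto
  show "x \<in> unit_cube \<Longrightarrow> length (filter (\<lambda>A. x \<in> A) (snd (L j))) = 1" using * by auto
  show "t \<le> card G \<Longrightarrow> finite G \<Longrightarrow> (\<And>i. i \<in> G \<Longrightarrow> fst (D i) \<in> unit_cube) \<Longrightarrow> min j (t - 1) \<le> fst (L j)"
    using * by auto
qed

lemma odt_leaves_partition:
  "1 \<le> t \<Longrightarrow> x \<in> unit_cube \<Longrightarrow> length (filter (\<lambda>A. x \<in> A) (odt_leaves sel t G Ss D)) = 1"
  unfolding odt_leaves_def by (rule odt_layers_invariant(3))

lemma length_odt_leaves:
  assumes "1 \<le> t" "t \<le> card G" "finite G" "\<And>i. i \<in> G \<Longrightarrow> fst (D i) \<in> unit_cube"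
  shows "length (odt_leaves sel t G Ss D) = t"
  unfolding odt_leaves_def
  using odt_layers_invariant(1,2)[OF assms(1), where sel=sel and G=G and Ss=Ss and D=D and j=t]
    odt_layers_invariant(4)[OF assms(1), of G D t sel Ss, OF assms(2-4)] assms(1)
  by auto

text \<open>
  The tree only sees the data with index in \<open>G\<close>. The leaves partition the unit cube; the
  value outside the cube is irrelevant.
\<close>
definition odt_estimator ::
    "('p::{finite,linorder}, 'q::{finite,linorder}) split_rule \<Rightarrow> nat \<Rightarrow> nat set \<Rightarrow> (nat \<Rightarrow> 'p set)
      \<Rightarrow> 'p data \<Rightarrow> (real, 'p) vec \<Rightarrow> real" where
  "odt_estimator sel t G Ss D x =
     (case find (\<lambda>A. x \<in> A) (odt_leaves sel t G Ss (restrict D G)) of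
        Some A \<Rightarrow> node_mean D G A
      | None \<Rightarrow> 0)"

text \<open>The random seed of one tree: the subsample and the feature sets of the \<open>t - 1\<close> splits.\<close>
type_synonym 'p seed = "nat set \<times> (nat \<Rightarrow> 'p set)"

definition odt_seed :: "nat \<Rightarrow> nat \<Rightarrow> nat \<Rightarrow> nat \<Rightarrow> 'p::finite seed pmf" where
  "odt_seed n a t q =
     pair_pmf (pmf_of_set {G. G \<subseteq> {1..n} \<and> card G = a})
              (Pi_pmf {1..<t} {} (\<lambda>_. pmf_of_set {S. card S = q}))"

definition odrf_seed :: "nat \<Rightarrow> nat \<Rightarrow> nat \<Rightarrow> nat \<Rightarrow> nat \<Rightarrow> (nat \<Rightarrow> 'p::finite seed) pmf" where
  "odrf_seed B n a t q = Pi_pmf {1..B} undefined (\<lambda>_. odt_seed n a t q)"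

definition odrf_estimator ::
    "('p::{finite,linorder}, 'q::{finite,linorder}) split_rule \<Rightarrow> nat \<Rightarrow> nat
      \<Rightarrow> (nat \<Rightarrow> 'p seed) \<Rightarrow> 'p data \<Rightarrow> (real, 'p) vec \<Rightarrow> real" where
  "odrf_estimator sel t B \<xi> D x =
     (\<Sum>b=1..B. odt_estimator sel t (fst (\<xi> b)) (snd (\<xi> b)) D x) / real B"

definition sample_measure ::
    "'w measure \<Rightarrow> ('w \<Rightarrow> (real, 'p::finite) vec) \<Rightarrow> ('w \<Rightarrow> real) \<Rightarrow> nat \<Rightarrow> 'p data measure" where
  "sample_measure M X Y n = (\<Pi>\<^sub>M i\<in>{1..n}. distr M borel (\<lambda>\<omega>. (X \<omega>, Y \<omega>)))"

text \<open>
  If ties are broken measurably, then the tree estimator is jointly measurable in the data and in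
  the point \<open>x\<close>, for every value of the seed.
\<close>
definition measurable_trees ::
    "('p::{finite,linorder}, 'q::{finite,linorder}) split_rule \<Rightarrow> nat \<Rightarrow> nat \<Rightarrow> nat \<Rightarrow> bool" where
  "measurable_trees sel n a t \<longleftrightarrow>
     (\<forall>G Ss. G \<subseteq> {1..n} \<longrightarrow> card G = a \<longrightarrow> (\<forall>\<tau>\<in>{1..<t}. card (Ss \<tau>) = CARD('q)) \<longrightarrow>
        (\<lambda>(D, x). odt_estimator sel t G Ss D x)
          \<in> borel_measurable ((\<Pi>\<^sub>M i\<in>{1..n}. borel) \<Otimes>\<^sub>M borel))"

end

theory Submission
  imports Defs
begin

text \<open>
  Approximate $m$ uniformly on the cube by a combination $h$ of half-space indicators, each of
  which uses $q$ coordinates (Stone--Weierstrass for exponentials, then staircases). On a node with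
  $n_A$ points, the excess $r_A$ of its squared error over that of $h$ satisfies
  $r_A \le 2 \Vert h \Vert_1 \max_k |u_k|$, where $u_k$ is the sum of the centred responses over the
  $k$-th half-space, while splitting at that half-space gains at least $4 u_k^2 / n_A$. Hence a split
  with random features gains on average at least $\kappa \max(r_A, 0)^2 / n_A \ge
  \kappa (2 \lambda r_A - \lambda^2 n_A)$, so that the sum of $r_A - \lambda n_A / 2$ over the nodes
  contracts by the factor $1 - 2 \kappa \lambda$ in each full layer. This bound is linear in $r_A$
  and holds for every data set.

  The training error is compared with the risk by a ghost sample. Only the estimator itself is
  symmetrized, never a supremum, so measurability of the trees suffices; for fixed points, a tree with
  $t$ leaves realizes one of at most $(t h)^t$ partitions, where the number $h$ of half-space
  dichotomies is polynomial (Sauer--Shelah and Radon). Truncating the responses at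
  $b_n^2 = (4 / c) \ln a_n$ makes the estimation error of order
  $b_n^2 \sqrt{t_n \ln a_n / a_n} \to 0$ and the truncation error of order $1 / a_n$.
\<close>

text \<open>The comparison function is fixed before n grows, so its weights may be as large as the
  accuracy demands; \<open>\<kappa>\<close> is then a constant, 1 over W^2 times the number of
  feature sets, where W bounds the sum of the absolute weights. It reflects that the feature set of
  the best half-space is drawn with probability 1 over the number of feature sets, while every other
  split at least does not increase the squared error. Linearity in the excess matters because the
  nodes of later layers are random: a linear bound passes unchanged through sums over nodes and
  averages over features. A layer at most doubles the number of nodes, so j full layers fit once t_n
  \<ge> 2^j, and the remaining rounds cannot raise the excess. Exponentials suit the approximation
  because they are closed under products and each depends on one linear form only, which makes it a
  ridge function. The constant 4 / c makes the tail moment of a response of order a_n^(-2); one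
  factor a_n is lost because the tail of a leaf mean is charged to all responses of the
  subsample.\<close>

section \<open>Half-space dichotomies\<close>

text \<open>Pajor's form of the Sauer-Shelah lemma, by induction on the ground set. For a split-off
  point \<open>x\<close>, \<open>F0\<close> collects the traces on the rest and \<open>F1\<close>
  those that extend to \<open>F\<close> both with and without \<open>x\<close>. A set shattered by
  \<open>F1\<close> stays shattered by \<open>F\<close> once \<open>x\<close> is added, so
  \<open>F1\<close> accounts for shattered sets containing \<open>x\<close> and \<open>F0\<close>
  for the others.\<close>

lemma card_le_card_shattered:
  fixes F :: "'a set set"
  assumes "finite P" "F \<subseteq> Pow P"
  shows "card F \<le> card {A. A \<subseteq> P \<and> Pow A \<subseteq> (\<lambda>U. U \<inter> A) ` F}"
  using assms
proof (induction P arbitrary: F rule: finite_induct)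
  case empty
  then have "F = {} \<or> F = {{}}" by auto
  then show ?case
  proof
    assume F: "F = {{}}"
    have "{A :: 'a set. A \<subseteq> {} \<and> Pow A \<subseteq> (\<lambda>U. U \<inter> A) ` F} = {{}}" using F by auto
    then show ?case using F by simp
  qed simp
next
  case (insert x P)
  let ?sh = "\<lambda>P F. {A. A \<subseteq> P \<and> Pow A \<subseteq> (\<lambda>U. U \<inter> A) ` F}"
  define F0 where "F0 = (\<lambda>U. U - {x}) ` F"
  define F1 where "F1 = {U \<in> Pow P. U \<in> F \<and> insert x U \<in> F}"
  have fin: "finite F" using insert.prems insert.hyps by (meson finite_Pow_iff finite_insert finite_subset)
  have finI: "finite F0" "finite F1"
    using fin insert.hyps unfolding F0_def F1_def by auto
  have sub: "F0 \<subseteq> Pow P" "F1 \<subseteq> Pow P" using insert.prems by (auto simp: F0_def F1_def)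
  \<comment> \<open>Traces in \<open>F0\<close> outside \<open>F\<close> come only from sets
    containing \<open>x\<close>. Moving them from the first part to the second leaves the total
    \<open>card F0 + card F1\<close>.\<close>
  have "F \<subseteq> (F0 - {U\<in>F0. U \<notin> F}) \<union> insert x ` (F1 \<union> {U\<in>F0. U \<notin> F})"
  proof
    fix U assume U: "U \<in> F"
    show "U \<in> (F0 - {U\<in>F0. U \<notin> F}) \<union> insert x ` (F1 \<union> {U\<in>F0. U \<notin> F})"
    proof (cases "x \<in> U")
      case True
      then have e: "U = insert x (U - {x})" by auto
      have "U - {x} \<in> F1 \<union> {U\<in>F0. U \<notin> F}"
        using U e insert.prems unfolding F1_def F0_def by auto
      then show ?thesis using e by blast
    next
      case False
      then have "U - {x} = U" by auto
      then have "U \<in> F0" using U unfolding F0_def by (metis imageI)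
      then show ?thesis using U by auto
    qed
  qed
  then have "card F \<le> card ((F0 - {U\<in>F0. U \<notin> F}) \<union> insert x ` (F1 \<union> {U\<in>F0. U \<notin> F}))"
    using finI by (intro card_mono) auto
  also have "\<dots> \<le> card (F0 - {U\<in>F0. U \<notin> F}) + card (insert x ` (F1 \<union> {U\<in>F0. U \<notin> F}))"
    by (rule card_Un_le)
  also have "\<dots> \<le> card (F0 - {U\<in>F0. U \<notin> F}) + (card F1 + card {U\<in>F0. U \<notin> F})"
    using finI by (intro add_left_mono order_trans[OF card_image_le] card_Un_le) auto
  also have "\<dots> = card F0 + card F1"
    using finI card_Diff_subset[of "{U\<in>F0. U \<notin> F}" F0] card_mono[of F0 "{U\<in>F0. U \<notin> F}"] by auto
  also have "\<dots> \<le> card (?sh P F0) + card (?sh P F1)"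
    using insert.IH[OF sub(1)] insert.IH[OF sub(2)] by linarith
  also have "card (?sh P F1) = card (insert x ` ?sh P F1)"
    using insert.hyps by (intro card_image[symmetric] inj_onI) (metis (no_types, lifting) insert_ident mem_Collect_eq subsetD)
  also have "card (?sh P F0) + card (insert x ` ?sh P F1) = card (?sh P F0 \<union> insert x ` ?sh P F1)"
    using insert.hyps by (intro card_Un_disjoint[symmetric]) auto
  also have "\<dots> \<le> card (?sh (insert x P) F)"
  proof (intro card_mono)
    show "finite (?sh (insert x P) F)" using insert.hyps by auto
    show "?sh P F0 \<union> insert x ` ?sh P F1 \<subseteq> ?sh (insert x P) F"
    proof
      fix A assume "A \<in> ?sh P F0 \<union> insert x ` ?sh P F1"
      then show "A \<in> ?sh (insert x P) F"
      proof
        assume A: "A \<in> ?sh P F0"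
        then have "x \<notin> A" using insert.hyps by auto
        then have "(U - {x}) \<inter> A = U \<inter> A" for U by auto
        then have "(\<lambda>U. U \<inter> A) ` F0 = (\<lambda>U. U \<inter> A) ` F" unfolding F0_def image_image by simp
        then show ?thesis using A by auto
      next
        assume "A \<in> insert x ` ?sh P F1"
        then obtain A' where A': "A = insert x A'" "A' \<subseteq> P" "Pow A' \<subseteq> (\<lambda>U. U \<inter> A') ` F1" by auto
        have "T \<in> (\<lambda>U. U \<inter> A) ` F" if T: "T \<subseteq> A" for T
        proof -
          \<comment> \<open>Membership in \<open>F1\<close> offers both \<open>U\<close> and
            \<open>insert x U\<close> as members of \<open>F\<close>; the choice depends on whether
            \<open>T\<close> contains \<open>x\<close>.\<close>
          have "T - {x} \<in> Pow A'" using T A' by auto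
          then obtain U where U: "U \<in> F1" "T - {x} = U \<inter> A'" using A'(3) by blast
          have xn: "x \<notin> U" "x \<notin> A'" using U sub insert.hyps A' by auto
          show ?thesis
          proof (cases "x \<in> T")
            case True
            have "T = insert x U \<inter> A" using True U xn A' by blast
            then show ?thesis using U unfolding F1_def by blast
          next
            case False
            have "T = U \<inter> A" using False U xn A' by blast
            then show ?thesis using U unfolding F1_def by blast
          qed
        qed
        then show ?thesis using A' by auto
      qed
    qed
  qed
  finally show ?case .
qed

text \<open>A set with at most \<open>d\<close> elements is built in \<open>d\<close> rounds, each
  adding one element of \<open>P\<close> or nothing; \<open>option\<close> encodes the idle
  round.\<close>

lemma card_subsets_card_le:
  assumes "finite P"
  shows "finite {A. A \<subseteq> P \<and> card A \<le> d}" "card {A. A \<subseteq> P \<and> card A \<le> d} \<le> (card P + 1) ^ d"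
proof -
  show fin: "finite {A. A \<subseteq> P \<and> card A \<le> d}" for d using assms by auto
  show "card {A. A \<subseteq> P \<and> card A \<le> d} \<le> (card P + 1) ^ d"
  proof (induction d)
    case 0
    have "{A. A \<subseteq> P \<and> card A \<le> 0} = {{}}" using assms finite_subset by fastforce
    then show ?case by simp
  next
    case (Suc d)
    let ?S = "{A. A \<subseteq> P \<and> card A \<le> d}"
    let ?f = "\<lambda>(u, A). case u of None \<Rightarrow> A | Some x \<Rightarrow> insert x A"
    have "{A. A \<subseteq> P \<and> card A \<le> Suc d} \<subseteq> ?f ` (insert None (Some ` P) \<times> ?S)"
    proof
      fix A assume A: "A \<in> {A. A \<subseteq> P \<and> card A \<le> Suc d}"
      show "A \<in> ?f ` (insert None (Some ` P) \<times> ?S)"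
      proof (cases "A = {}")
        case True
        then show ?thesis by (intro image_eqI[where x = "(None, {})"]) auto
      next
        case False
        then obtain x where x: "x \<in> A" by auto
        have "card (A - {x}) \<le> d" using A x finite_subset[OF _ assms, of A] by auto
        then show ?thesis using A x by (intro image_eqI[where x = "(Some x, A - {x})"]) auto
      qed
    qed
    then have "card {A. A \<subseteq> P \<and> card A \<le> Suc d} \<le> card (insert None (Some ` P) \<times> ?S)"
      using assms fin by (intro surj_card_le) auto
    also have "\<dots> = (card P + 1) * card ?S"
      using assms by (simp add: card_cartesian_product card_image)
    also have "\<dots> \<le> (card P + 1) * (card P + 1) ^ d" by (intro mult_le_mono2 Suc)
    finally show ?case by simp
  qed
qed

text \<open>The normal \<open>w\<close> is neither normalized nor restricted to \<open>q\<close>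
  coordinates, so one family covers the cuts for all feature sets.\<close>

definition halfspaces :: "'a::euclidean_space set set" where
  "halfspaces = {H. \<exists>w s. H = {x. w \<bullet> x \<le> s}}"

text \<open>A shattered set has at most DIM + 1 points: DIM + 2 points are affinely dependent, and
  by Radon's theorem they contain two disjoint parts with intersecting convex hulls, which no
  half-space can separate.\<close>

lemma card_halfspace_traces_le:
  fixes P :: "'a::euclidean_space set"
  assumes "finite P"
  shows "finite ((\<lambda>H. H \<inter> P) ` halfspaces)"
    "card ((\<lambda>H. H \<inter> P) ` halfspaces) \<le> (card P + 1) ^ (DIM('a) + 1)"
proof -
  let ?F = "(\<lambda>H. H \<inter> P) ` halfspaces"
  show "finite ?F" using assms by (rule_tac finite_subset[of _ "Pow P"]) auto
  have "card ?F \<le> card {A. A \<subseteq> P \<and> Pow A \<subseteq> (\<lambda>U. U \<inter> A) ` ?F}"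
    using assms by (intro card_le_card_shattered) auto
  also have "\<dots> \<le> card {A. A \<subseteq> P \<and> card A \<le> DIM('a) + 1}"
  proof (intro card_mono card_subsets_card_le(1) assms subsetI CollectI)
    fix A assume A: "A \<in> {A. A \<subseteq> P \<and> Pow A \<subseteq> (\<lambda>U. U \<inter> A) ` ?F}"
    have "card A \<le> DIM('a) + 1"
    proof (rule ccontr)
      assume "\<not> ?thesis"
      then have "affine_dependent A"
        using A assms by (intro affine_dependent_biggerset) (auto dest: finite_subset)
      then obtain S T where ST: "S \<subseteq> A" "T \<subseteq> A" "S \<inter> T = {}" "convex hull S \<inter> convex hull T \<noteq> {}"
        by (rule Radon)
      from ST(1) A obtain U where "U \<in> ?F" "S = U \<inter> A" by blast
      then obtain w s where ws: "S = {x. w \<bullet> x \<le> s} \<inter> P \<inter> A" unfolding halfspaces_def by blast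
      have "convex hull S \<subseteq> {x. w \<bullet> x \<le> s}"
        using ws by (intro hull_minimal convex_halfspace_le) auto
      moreover have "convex hull T \<subseteq> {x. w \<bullet> x > s}"
        using ws ST(2,3) A by (intro hull_minimal convex_halfspace_gt) (auto simp: not_le[symmetric])
      ultimately show False using ST(4) by fastforce
    qed
    then show "A \<subseteq> P \<and> card A \<le> DIM('a) + 1" using A by auto
  qed
  also have "\<dots> \<le> (card P + 1) ^ (DIM('a) + 1)" by (intro card_subsets_card_le assms)
  finally show "card ?F \<le> (card P + 1) ^ (DIM('a) + 1)" .
qed

section \<open>Rademacher sums\<close>

text \<open>The scalar inequality behind Hoeffding's lemma with probability 1/2 and width 2 x: its
  left side is then ln (cosh x) and its right side x^2 / 2. Evenness handles negative x.\<close>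

lemma cosh_real_le_exp: "cosh (x::real) \<le> exp (x\<^sup>2 / 2)"
proof -
  have *: "cosh x \<le> exp (x\<^sup>2 / 2)" if "x \<ge> 0" for x :: real
  proof -
    have e: "1 + (1/2) * (exp (2 * x) - 1) = exp x * cosh x"
      by (simp add: cosh_def field_simps exp_minus exp_add[symmetric])
    have "- (2 * x) * (1/2) + ln (1 + (1/2) * (exp (2 * x) - 1)) \<le> (2 * x)\<^sup>2 / 8"
      using Hoeffdings_lemma_aux[of "2 * x" "1/2"] that by simp
    then have "ln (cosh x) \<le> x\<^sup>2 / 2"
      unfolding e by (subst (asm) ln_mult) (auto simp: power2_eq_square)
    then show ?thesis by (metis cosh_real_pos exp_le_cancel_iff exp_ln)
  qed
  show ?thesis using *[of x] *[of "- x"] by (cases "x \<ge> 0") auto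
qed

text \<open>Rademacher signs are indexed by the set \<open>s\<close> of negative entries, so
  averages over signs become finite sums over \<open>Pow G\<close>. In the symmetrization
  \<open>s\<close> is the set of exchanged points.\<close>

definition swap_sign :: "'i set \<Rightarrow> 'i \<Rightarrow> real" where
  "swap_sign s i = (if i \<in> s then - 1 else 1)"

text \<open>The exponential of a signed sum is a product over \<open>G\<close>, so summing over all
  sign sets factorizes into terms \<open>2 * cosh (u * v i)\<close>.\<close>

lemma sum_exp_sign_sum_le:
  assumes "finite G" "(\<Sum>i\<in>G. (v i)\<^sup>2) \<le> R"
  shows "(\<Sum>s\<in>Pow G. exp (u * (\<Sum>i\<in>G. swap_sign s i * v i))) \<le> 2 ^ card G * exp (u\<^sup>2 * R / 2)"
proof -
  have "(\<Sum>s\<in>Pow G. exp (u * (\<Sum>i\<in>G. swap_sign s i * v i)))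
      = (\<Sum>s\<in>Pow G. (\<Prod>i\<in>s. exp (- (u * v i))) * (\<Prod>i\<in>G - s. exp (u * v i)))"
  proof (rule sum.cong[OF refl])
    fix s assume s: "s \<in> Pow G"
    have "exp (u * (\<Sum>i\<in>G. swap_sign s i * v i)) = (\<Prod>i\<in>G. exp (u * (swap_sign s i * v i)))"
      by (simp add: sum_distrib_left exp_sum assms)
    also have "\<dots> = (\<Prod>i\<in>G - s. exp (u * (swap_sign s i * v i))) * (\<Prod>i\<in>s. exp (u * (swap_sign s i * v i)))"
      using s assms by (intro prod.subset_diff) auto
    also have "(\<Prod>i\<in>G - s. exp (u * (swap_sign s i * v i))) = (\<Prod>i\<in>G - s. exp (u * v i))"
      by (intro prod.cong) (auto simp: swap_sign_def)
    also have "(\<Prod>i\<in>s. exp (u * (swap_sign s i * v i))) = (\<Prod>i\<in>s. exp (- (u * v i)))"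
      by (intro prod.cong) (auto simp: swap_sign_def)
    finally show "exp (u * (\<Sum>i\<in>G. swap_sign s i * v i))
      = (\<Prod>i\<in>s. exp (- (u * v i))) * (\<Prod>i\<in>G - s. exp (u * v i))" by (simp add: mult.commute)
  qed
  also have "\<dots> = (\<Prod>i\<in>G. exp (- (u * v i)) + exp (u * v i))"
    using assms by (simp add: prod_add)
  also have "\<dots> \<le> (\<Prod>i\<in>G. 2 * exp ((u * v i)\<^sup>2 / 2))"
  proof (intro prod_mono conjI)
    fix i
    show "exp (- (u * v i)) + exp (u * v i) \<le> 2 * exp ((u * v i)\<^sup>2 / 2)"
      using cosh_real_le_exp[of "u * v i"] by (simp add: cosh_def)
  qed (simp add: add_nonneg_nonneg)
  also have "\<dots> = 2 ^ card G * exp (u\<^sup>2 * (\<Sum>i\<in>G. (v i)\<^sup>2) / 2)"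
    using assms by (simp add: prod.distrib exp_sum[symmetric] power_mult_distrib
        sum_distrib_left sum_divide_distrib)
  also have "\<dots> \<le> 2 ^ card G * exp (u\<^sup>2 * R / 2)"
    using assms by (intro mult_left_mono) (auto intro!: divide_right_mono mult_left_mono)
  finally show ?thesis .
qed

text \<open>Massart's finite class lemma, with the difference that the vector \<open>v s\<close> is
  picked knowing the signs. This lets the tree grown on the data be inserted directly, with no
  supremum over a class.\<close>

lemma sum_selected_sign_sums_le:
  fixes v :: "'i set \<Rightarrow> 'i \<Rightarrow> real"
  assumes "finite G" "finite V" "real (card V) \<le> Q" "R > 0"
    and R: "\<And>v. v \<in> V \<Longrightarrow> (\<Sum>i\<in>G. (v i)\<^sup>2) \<le> R"
    and v: "\<And>s. s \<subseteq> G \<Longrightarrow> v s \<in> V"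
  shows "(\<Sum>s\<in>Pow G. \<Sum>i\<in>G. swap_sign s i * v s i) \<le> 2 ^ card G * sqrt (2 * R * (ln Q + 1))"
proof -
  have "card V \<noteq> 0" using v[of "{}"] assms(2) by auto
  then have Q: "Q \<ge> 1" using assms(3) by linarith
  define L where "L = ln Q + 1"
  have L: "L > 0" using Q by (simp add: L_def add_nonneg_pos)
  \<comment> \<open>The minimizer of \<open>L / u + u * R / 2\<close>, the bound reached at the end;
    both terms are equal there.\<close>
  define u where "u = sqrt (2 * L / R)"
  have u: "u > 0" "u\<^sup>2 = 2 * L / R" using L \<open>R > 0\<close> by (auto simp: u_def)
  define b where "b = (ln Q + u\<^sup>2 * R / 2) / u"
  \<comment> \<open>From $z \le e^z$; choosing the shift $b$ balances the union bound.\<close>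
  have "(\<Sum>s\<in>Pow G. \<Sum>i\<in>G. swap_sign s i * v s i)
      \<le> (\<Sum>s\<in>Pow G. b + exp (- (u * b)) / u * (\<Sum>w\<in>V. exp (u * (\<Sum>i\<in>G. swap_sign s i * w i))))"
  proof (rule sum_mono)
    fix s assume s: "s \<in> Pow G"
    define x where "x = (\<Sum>i\<in>G. swap_sign s i * v s i)"
    have "u * (x - b) \<le> exp (u * (x - b))" using exp_ge_add_one_self[of "u * (x - b)"] by linarith
    then have "x \<le> b + exp (- (u * b)) / u * exp (u * x)"
      using u(1) by (simp add: field_simps exp_add[symmetric] algebra_simps exp_diff)
    also have "b + exp (- (u * b)) / u * exp (u * x) \<le> b + exp (- (u * b)) / u * (\<Sum>w\<in>V. exp (u * (\<Sum>i\<in>G. swap_sign s i * w i)))"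
      unfolding x_def using v[of s] s assms(2)
u(1)
      by (intro add_left_mono mult_left_mono
          member_le_sum[where f = "\<lambda>w. exp (u * (\<Sum>i\<in>G. swap_sign s i * w i))"]) auto
    finally show "x \<le> b + exp (- (u * b)) / u * (\<Sum>w\<in>V. exp (u * (\<Sum>i\<in>G. swap_sign s i * w i)))" .
  qed
  also have "\<dots> = 2 ^ card G * b + exp (- (u * b)) / u *
      (\<Sum>w\<in>V. \<Sum>s\<in>Pow G. exp (u * (\<Sum>i\<in>G. swap_sign s i * w i)))"
    using assms(1) by (simp add: sum.distrib card_Pow sum_distrib_left[symmetric]
        sum_divide_distrib[symmetric] sum.swap[of _ V])
  also have "\<dots> \<le> 2 ^ card G * b + exp (- (u * b)) / u * (\<Sum>w\<in>V. 2 ^ card G * exp (u\<^sup>2 * R / 2))"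
    using u(1) R assms(1)
    by (intro add_left_mono mult_left_mono sum_mono sum_exp_sign_sum_le) auto
  also have "\<dots> \<le> 2 ^ card G * b + exp (- (u * b)) / u * (Q * (2 ^ card G * exp (u\<^sup>2 * R / 2)))"
    using u(1) assms(3) by (simp add: mult_left_mono mult_right_mono divide_right_mono)
  also have "exp (- (u * b)) = 1 / (Q * exp (u\<^sup>2 * R / 2))"
  proof -
    have "u * b = ln Q + u\<^sup>2 * R / 2" using u(1) by (simp add: b_def)
    then show ?thesis unfolding exp_minus using Q by (simp only: exp_add) (simp add: field_simps)
  qed
  also have "2 ^ card G * b + 1 / (Q * exp (u\<^sup>2 * R / 2)) / u * (Q * (2 ^ card G * exp (u\<^sup>2 * R / 2)))
      = 2 ^ card G * (b + 1 / u)"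
    using Q by (simp add: field_simps)
  also have "b + 1 / u = L / u + u * R / 2"
    using u(1) by (simp add: b_def L_def field_simps power2_eq_square)
  also have "u * R / 2 = L / u" using u \<open>R > 0\<close> by (simp add: field_simps power2_eq_square)
  also have "L / u + L / u = 2 * L / u" by simp
  also have "\<dots> = sqrt (2 * R * L)"
  proof (rule real_sqrt_unique[symmetric])
    show "(2 * L / u)\<^sup>2 = 2 * R * L"
      using L \<open>R > 0\<close> unfolding power_divide u(2) by (simp add: power2_eq_square field_simps)
  qed (use u(1) L in auto)
  finally show ?thesis unfolding L_def .
qed

section \<open>Partitions produced by oblique trees\<close>

text \<open>The lists of cells reachable from \<open>Q\<close> by \<open>k\<close> cuts, each made
  in place at an index up to \<open>k\<close>, since \<open>k\<close> cuts leave
  \<open>k + 1\<close> cells. The data behind the cuts are forgotten, so these lists bound the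
  number of tree partitions of a finite set.\<close>

fun split_lists :: "'a set set \<Rightarrow> 'a set \<Rightarrow> nat \<Rightarrow> 'a set list set" where
  "split_lists hs Q 0 = {[Q]}"
| "split_lists hs Q (Suc k) =
     (\<lambda>(L, i, h). take i L @ [L ! i \<inter> h, L ! i - h] @ drop (Suc i) L)
       ` (split_lists hs Q k \<times> {..k} \<times> hs)"

lemma length_split_lists: "L \<in> split_lists hs Q k \<Longrightarrow> length L = k + 1"
  by (induction k arbitrary: L) auto

lemma card_split_lists:
  assumes "finite hs" "k \<le> t"
  shows "finite (split_lists hs Q k) \<and> card (split_lists hs Q k) \<le> (t * card hs) ^ k"
  using assms(2)
proof (induction k)
  case (Suc k)
  then have IH: "finite (split_lists hs Q k)" "card (split_lists hs Q k) \<le> (t * card hs) ^ k" by auto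
  have "card (split_lists hs Q (Suc k)) \<le> card (split_lists hs Q k \<times> {..k} \<times> hs)"
    unfolding split_lists.simps using IH assms by (intro card_image_le) auto
  also have "\<dots> = card (split_lists hs Q k) * (Suc k * card hs)"
    by (simp add: card_cartesian_product)
  also have "\<dots> \<le> (t * card hs) ^ k * (t * card hs)"
    using IH Suc.prems by (intro mult_le_mono) auto
  finally show ?case using IH assms by (simp add: mult.commute)
qed simp

lemma split_lists_append:
  assumes "pre @ A # As \<in> split_lists hs Q k" "h \<in> hs"
  shows "pre @ A \<inter> h # (A - h) # As \<in> split_lists hs Q (Suc k)"
proof -
  have "length pre \<le> k" using length_split_lists[OF assms(1)] by simp
  then show ?thesis using assms
    by (auto intro!: image_eqI[where x = "(pre @ A # As, length pre, h)"])
qed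

section \<open>Traces of tree nodes on a finite point set\<close>

lemma linear_subvec: "linear (subvec S :: (real, 'p::{finite,linorder}) vec \<Rightarrow> (real, 'q::{finite,linorder}) vec)"
  by (rule linearI) (simp_all add: subvec_def vec_eq_iff)

lemma inner_subvec_eq:
  fixes \<theta> :: "(real, 'q::{finite,linorder}) vec" and S :: "'p::{finite,linorder} set"
  obtains w where "\<And>x. \<theta> \<bullet> subvec S x = w \<bullet> x"
  by (metis adjoint_works inner_commute linear_subvec)

text \<open>By the adjoint of the coordinate selection, a cut in the selected features is a
  half-space of the full space. On \<open>P\<close> the features and the rule thus enter only
  through one half-space trace.\<close>

lemma node_trace:
  obtains h where "h \<in> (\<lambda>H. H \<inter> P) ` halfspaces"
    "node_pos S c A \<inter> P = (A \<inter> P) \<inter> h" "node_neg S c A \<inter> P = (A \<inter> P) - h"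
proof -
  obtain \<theta> s where c: "c = (\<theta>, s)" by (cases c)
  obtain w where w: "\<And>x. \<theta> \<bullet> subvec S x = w \<bullet> x" using inner_subvec_eq[of \<theta> S] by metis
  have "{x. w \<bullet> x \<le> s} \<in> halfspaces" unfolding halfspaces_def by blast
  then show thesis
    by (intro that[of "{x. w \<bullet> x \<le> s} \<inter> P"]) (auto simp: c node_pos_def node_neg_def w)
qed

text \<open>With the nodes \<open>pre\<close> already produced for the next layer kept in front, a
  split in the middle of a layer is one cut of a single list.\<close>

lemma odt_layer_trace:
  fixes As :: "(real, 'p::{finite,linorder}) vec set list" and sel :: "('p, 'q::{finite,linorder}) split_rule"
  assumes "map (\<lambda>A. A \<inter> P) (pre @ As) \<in> split_lists ((\<lambda>H. H \<inter> P) ` halfspaces) Q k"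
  shows "map (\<lambda>A. A \<inter> P) (pre @ snd (odt_layer sel t G Ss D k As))
    \<in> split_lists ((\<lambda>H. H \<inter> P) ` halfspaces) Q (fst (odt_layer sel t G Ss D k As))"
  using assms
proof (induction As arbitrary: k pre)
  case (Cons A As)
  show ?case
  proof (cases "k + 1 < t \<and> 2 \<le> node_count D G A")
    case True
    obtain h where h: "h \<in> (\<lambda>H. H \<inter> P) ` halfspaces"
      "node_pos (Ss (k+1)) (sel D G (Ss (k+1)) A) A \<inter> P = (A \<inter> P) \<inter> h"
      "node_neg (Ss (k+1)) (sel D G (Ss (k+1)) A) A \<inter> P = (A \<inter> P) - h" by (rule node_trace)
    let ?pre = "pre @ [node_pos (Ss (k+1)) (sel D G (Ss (k+1)) A) A, node_neg (Ss (k+1)) (sel D G (Ss (k+1)) A) A]"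
    have "map (\<lambda>A. A \<inter> P) (?pre @ As) \<in> split_lists ((\<lambda>H. H \<inter> P) ` halfspaces) Q (Suc k)"
      using split_lists_append[OF _ h(1), of "map (\<lambda>A. A \<inter> P) pre" "A \<inter> P"] Cons.prems h by simp
    from Cons.IH[OF this] show ?thesis using True by (simp add: Let_def case_prod_unfold)
  next
    case False
    have "map (\<lambda>A. A \<inter> P) ((pre @ [A]) @ As) \<in> split_lists ((\<lambda>H. H \<inter> P) ` halfspaces) Q k"
      using Cons.prems by simp
    moreover have "odt_layer sel t G Ss D k (A # As)
        = (fst (odt_layer sel t G Ss D k As), A # snd (odt_layer sel t G Ss D k As))"
      using False by (auto simp: case_prod_unfold Let_def)
    ultimately show ?thesis using Cons.IH[of "pre @ [A]" k] by simp
  qed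
qed simp

lemma odt_leaves_trace:
  fixes sel :: "('p::{finite,linorder}, 'q::{finite,linorder}) split_rule"
  assumes "1 \<le> t"
  shows "\<exists>k<t. map (\<lambda>A. A \<inter> P) (odt_leaves sel t G Ss D)
    \<in> split_lists ((\<lambda>H. H \<inter> P) ` halfspaces) (unit_cube \<inter> P) k"
proof -
  define L where "L j = ((\<lambda>(k, As). odt_layer sel t G Ss D k As) ^^ j) (0, [unit_cube])" for j
  have "map (\<lambda>A. A \<inter> P) (snd (L j))
      \<in> split_lists ((\<lambda>H. H \<inter> P) ` halfspaces) (unit_cube \<inter> P) (fst (L j))" for j
  proof (induction j)
    case (Suc j)
    obtain k As where kAs: "L j = (k, As)" by (cases "L j")
    then have "L (Suc j) = odt_layer sel t G Ss D k As" by (simp add: L_def)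
    then show ?case using Suc kAs odt_layer_trace[of P "[]" As _ k sel t G Ss D] by simp
  qed (simp add: L_def)
  then show ?thesis
    using odt_layers_invariant(2)[OF assms, of t sel G Ss D] unfolding odt_leaves_def L_def
    by (intro exI[of _ "fst (L t)"]) (auto simp: L_def)
qed

section \<open>Piecewise constant functions on the leaves under random signs\<close>

lemma odt_leaves_disjoint:
  assumes "1 \<le> t"
  shows "length (filter (\<lambda>A. x \<in> A) (odt_leaves sel t G Ss D)) \<le> 1"
proof -
  have "length (filter (\<lambda>A. x \<in> A) (snd (((\<lambda>(k, As). odt_layer sel t G Ss D k As) ^^ j) (0, [unit_cube])))) \<le> 1" for j
  proof (induction j)
    case (Suc j)
    then show ?case by (simp add: case_prod_unfold odt_layer_partition)
  qed simp
  then show ?thesis unfolding odt_leaves_def .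
qed

text \<open>As at most one cell contains \<open>x\<close>, the lookup by \<open>find\<close> is
  linear in the cell values, the form that sign sums can handle.\<close>

lemma sum_leaf_eq_find:
  fixes g :: "'a set \<Rightarrow> real"
  assumes "length (filter (\<lambda>A. x \<in> A) L) \<le> 1"
  shows "(\<Sum>j<length L. g (L ! j) * indicator (L ! j) x)
    = (case find (\<lambda>A. x \<in> A) L of Some A \<Rightarrow> g A | None \<Rightarrow> 0)"
  using assms
proof (induction L)
  case (Cons A L)
  show ?case
  proof (cases "x \<in> A")
    case True
    then have "filter (\<lambda>A. x \<in> A) L = []" using Cons.prems by simp
    then have "\<forall>B\<in>set L. x \<notin> B" by (simp add: filter_empty_conv)
    then have "(\<Sum>j<length L. g (L ! j) * indicator (L ! j) x) = 0" by (intro sum.neutral) auto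
    then show ?thesis using True by (simp add: sum.lessThan_Suc_shift del: sum.lessThan_Suc)
  next
    case False
    then show ?thesis using Cons by (simp add: sum.lessThan_Suc_shift del: sum.lessThan_Suc)
  qed
qed simp

lemma sum_indicator_leaf_le:
  assumes "length (filter (\<lambda>A. x \<in> A) L) \<le> 1"
  shows "(\<Sum>j<length L. indicator (L ! j) x) \<le> (1::real)"
  using sum_leaf_eq_find[OF assms, of "\<lambda>_. 1"] by (simp split: option.split)

text \<open>The absolute leaf sums add up to one signed sum, for the function carrying the right
  sign on each leaf. Disjointness keeps this function within [-1, 1], and each partition admits at
  most \<open>2 ^ t\<close> sign patterns, so the finite class bound applies.\<close>

lemma sum_abs_leaf_sums_le:
  fixes y1 y2 :: "'i \<Rightarrow> real" and x1 x2 :: "'i \<Rightarrow> 'a"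
  assumes "finite G" "G \<noteq> {}" "finite LL" "real (card LL) * 2 ^ t \<le> Q" "b > 0"
    and len: "\<And>L. L \<in> LL \<Longrightarrow> length L \<le> t"
    and L: "\<And>s. s \<subseteq> G \<Longrightarrow> L s \<in> LL"
    and disj: "\<And>s x. s \<subseteq> G \<Longrightarrow> length (filter (\<lambda>A. x \<in> A) (L s)) \<le> 1"
    and b: "\<And>i. i \<in> G \<Longrightarrow> \<bar>y1 i\<bar> \<le> b" "\<And>i. i \<in> G \<Longrightarrow> \<bar>y2 i\<bar> \<le> b"
  shows "(\<Sum>s\<in>Pow G. \<Sum>j<length (L s). \<bar>\<Sum>i\<in>G. swap_sign s i *
      (y2 i * indicator (L s ! j) (x2 i) - y1 i * indicator (L s ! j) (x1 i))\<bar>)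
    \<le> 2 ^ card G * (2 * b * sqrt (2 * card G * (ln Q + 1)))"
proof -
  define lab where "lab L e x = (\<Sum>j<length L. (if j \<in> e then -1 else 1) * indicator (L ! j) x :: real)"
    for L :: "'a set list" and e x
  \<comment> \<open>Only lists of disjoint cells are kept, because the norm bound must hold for
    every vector of the class and not just for the selected ones.\<close>
  define LL' where "LL' = {L \<in> LL. \<forall>x. length (filter (\<lambda>A. x \<in> A) L) \<le> 1}"
  define vec where "vec L e i = y2 i * lab L e (x2 i) - y1 i * lab L e (x1 i)" for L e i
  define V where "V = case_prod vec ` (LL' \<times> Pow {..<t})"
  define S where "S s j = (\<Sum>i\<in>G. swap_sign s i *
      (y2 i * indicator (L s ! j) (x2 i) - y1 i * indicator (L s ! j) (x1 i)))" for s j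
  \<comment> \<open>The leaves with a negative sum. This pattern depends on \<open>s\<close>, which
    the selection bound permits.\<close>
  define e where "e s = {j. j < length (L s) \<and> S s j < 0}" for s
  have lab: "\<bar>lab L e x\<bar> \<le> 1" if "L \<in> LL'" for L e x
  proof -
    have "\<bar>lab L e x\<bar> \<le> (\<Sum>j<length L. \<bar>(if j \<in> e then -1 else 1) * indicator (L ! j) x\<bar>)"
      unfolding lab_def by (rule sum_abs)
    also have "\<dots> = (\<Sum>j<length L. indicator (L ! j) x)"
      by (intro sum.cong) (auto simp: indicator_def)
    also have "\<dots> \<le> 1" using that by (intro sum_indicator_leaf_le) (auto simp: LL'_def)
    finally show ?thesis .
  qed
  have fin: "finite LL'" "card LL' \<le> card LL" using assms(3) by (auto simp: LL'_def intro!: card_mono)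
  have "(\<Sum>s\<in>Pow G. \<Sum>i\<in>G. swap_sign s i * vec (L s) (e s) i)
      \<le> 2 ^ card G * sqrt (2 * (card G * (2 * b)\<^sup>2) * (ln Q + 1))"
  proof (rule sum_selected_sign_sums_le)
    show "finite V" unfolding V_def using fin by auto
    have "card V \<le> card LL' * 2 ^ t"
      unfolding V_def using fin by (intro order_trans[OF card_image_le]) (auto simp: card_cartesian_product card_Pow)
    also have "\<dots> \<le> card LL * 2 ^ t" using fin by simp
    finally have "real (card V) \<le> real (card LL * 2 ^ t)" by (rule of_nat_mono)
    then show "real (card V) \<le> Q" using assms(4) by simp
    show "card G * (2 * b)\<^sup>2 > 0" using assms by (simp add: card_gt_0_iff)
    show "vec (L s) (e s) \<in> V" if "s \<subseteq> G" for s
    proof -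
      have "e s \<subseteq> {..<t}" using len[OF L[OF that]] by (auto simp: e_def)
      then show ?thesis unfolding V_def LL'_def using L[OF that] disj[OF that] by force
    qed
    show "(\<Sum>i\<in>G. (v i)\<^sup>2) \<le> card G * (2 * b)\<^sup>2" if v: "v \<in> V" for v
    proof -
      obtain L e where v: "v = vec L e" "L \<in> LL'" using v unfolding V_def by auto
      have "(v i)\<^sup>2 \<le> (2 * b)\<^sup>2" if i: "i \<in> G" for i
      proof -
        have "\<bar>v i\<bar> \<le> \<bar>y2 i\<bar> * \<bar>lab L e (x2 i)\<bar> + \<bar>y1 i\<bar> * \<bar>lab L e (x1 i)\<bar>"
          unfolding v vec_def abs_mult[symmetric] by linarith
        also have "\<dots> \<le> b * 1 + b * 1"
          using lab[OF v(2)] b i assms(5) by (intro add_mono mult_mono) auto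
        finally have "\<bar>v i\<bar> ^ 2 \<le> (2 * b) ^ 2" by (intro power_mono) auto
        then show ?thesis by simp
      qed
      then show ?thesis using sum_bounded_above[of G "\<lambda>i. (v i)\<^sup>2"] by simp
    qed
  qed (use assms in auto)
  also have "sqrt (2 * (card G * (2 * b)\<^sup>2) * (ln Q + 1)) = sqrt ((2 * b)\<^sup>2 * (2 * card G * (ln Q + 1)))"
    by (simp add: algebra_simps)
  also have "\<dots> = 2 * b * sqrt (2 * card G * (ln Q + 1))"
  proof -
    have "sqrt ((2 * b)\<^sup>2) = 2 * b" using assms(5) by (intro real_sqrt_unique) auto
    then show ?thesis by (simp only: real_sqrt_mult[of "(2 * b)\<^sup>2"])
  qed
  also have "(\<Sum>s\<in>Pow G. \<Sum>i\<in>G. swap_sign s i * vec (L s) (e s) i) = (\<Sum>s\<in>Pow G. \<Sum>j<length (L s). \<bar>S s j\<bar>)"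
  proof (rule sum.cong[OF refl])
    fix s
    have "(\<Sum>i\<in>G. swap_sign s i * vec (L s) (e s) i)
      = (\<Sum>i\<in>G. \<Sum>j<length (L s). (if j \<in> e s then -1 else 1) * (swap_sign s i *
      (y2 i * indicator (L s ! j) (x2 i) - y1 i * indicator (L s ! j) (x1 i))))"
      unfolding vec_def lab_def sum_distrib_left sum_subtractf[symmetric]
      by (intro sum.cong) (auto simp: algebra_simps)
    also have "\<dots> = (\<Sum>j<length (L s). (if j \<in> e s then -1 else 1) * S s j)"
      unfolding S_def sum_distrib_left by (rule sum.swap)
    also have "\<dots> = (\<Sum>j<length (L s). \<bar>S s j\<bar>)"
      by (intro sum.cong) (auto simp: e_def)
    finally show "(\<Sum>i\<in>G. swap_sign s i * vec (L s) (e s) i) = (\<Sum>j<length (L s). \<bar>S s j\<bar>)" .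
  qed
  finally show ?thesis unfolding S_def .
qed

text \<open>Expanding the squares leaves sign sums of squared responses, of response times
  prediction, and of squared predictions. In the last two, leaf values multiply leaf sums; the
  values depend on \<open>s\<close> in an uncontrolled way but are bounded by \<open>b\<close>, so
  absolute leaf sums suffice.\<close>

lemma sum_sign_square_loss_le:
  fixes y1 y2 :: "'i \<Rightarrow> real" and x1 x2 :: "'i \<Rightarrow> 'a" and f :: "'i set \<Rightarrow> 'a \<Rightarrow> real"
  assumes G: "finite G" "G \<noteq> {}" and LL: "finite LL" "real (card LL) * 2 ^ t \<le> Q" and "b > 0"
    and len: "\<And>L. L \<in> LL \<Longrightarrow> length L \<le> t"
    and L: "\<And>s. s \<subseteq> G \<Longrightarrow> L s \<in> LL"
    and disj: "\<And>s x. s \<subseteq> G \<Longrightarrow> length (filter (\<lambda>A. x \<in> A) (L s)) \<le> 1"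
    and b: "\<And>i. i \<in> G \<Longrightarrow> \<bar>y1 i\<bar> \<le> b" "\<And>i. i \<in> G \<Longrightarrow> \<bar>y2 i\<bar> \<le> b"
    and c: "\<And>s j. \<bar>c s j\<bar> \<le> b"
    and f: "\<And>s x. s \<subseteq> G \<Longrightarrow> x \<in> x1 ` G \<union> x2 ` G \<Longrightarrow> f s x = (\<Sum>j<length (L s). c s j * indicator (L s ! j) x)"
    and f2: "\<And>s x. s \<subseteq> G \<Longrightarrow> x \<in> x1 ` G \<union> x2 ` G \<Longrightarrow> (f s x)\<^sup>2 = (\<Sum>j<length (L s). (c s j)\<^sup>2 * indicator (L s ! j) x)"
  shows "(\<Sum>s\<in>Pow G. \<Sum>i\<in>G. swap_sign s i * ((y2 i - f s (x2 i))\<^sup>2 - (y1 i - f s (x1 i))\<^sup>2))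
    \<le> 2 ^ card G * (7 * b\<^sup>2 * sqrt (2 * card G * (ln Q + 1)))"
proof -
  define l where "l = sqrt (2 * card G * (ln Q + 1))"
  define S where "S s j = (\<Sum>i\<in>G. swap_sign s i *
      (y2 i * indicator (L s ! j) (x2 i) - y1 i * indicator (L s ! j) (x1 i)))" for s j
  define S' where "S' s j = (\<Sum>i\<in>G. swap_sign s i *
      (1 * indicator (L s ! j) (x2 i) - 1 * indicator (L s ! j) (x1 i)))" for s j
  define T where "T s = (\<Sum>i\<in>G. swap_sign s i * ((y2 i)\<^sup>2 - (y1 i)\<^sup>2))" for s
  have "card LL \<noteq> 0" using L[of "{}"] LL(1) by auto
  then have "1 * 1 \<le> real (card LL) * 2 ^ t" by (intro mult_mono) auto
  then have Q: "Q \<ge> 1" using LL(2) by linarith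
  have B1: "(\<Sum>s\<in>Pow G. \<Sum>j<length (L s). \<bar>S s j\<bar>) \<le> 2 ^ card G * (2 * b * l)"
    unfolding S_def l_def by (rule sum_abs_leaf_sums_le) (use assms in auto)
  have B2: "(\<Sum>s\<in>Pow G. \<Sum>j<length (L s). \<bar>S' s j\<bar>) \<le> 2 ^ card G * (2 * 1 * l)"
    unfolding S'_def l_def by (rule sum_abs_leaf_sums_le) (use assms in auto)
  have B3: "(\<Sum>s\<in>Pow G. T s) \<le> 2 ^ card G * (b\<^sup>2 * l)"
  proof -
    have "(\<Sum>s\<in>Pow G. T s) \<le> 2 ^ card G * sqrt (2 * (card G * (b\<^sup>2)\<^sup>2) * (ln Q + 1))"
      unfolding T_def
    proof (rule sum_selected_sign_sums_le[where V = "{\<lambda>i. (y2 i)\<^sup>2 - (y1 i)\<^sup>2}"])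
      show "(\<Sum>i\<in>G. (v i)\<^sup>2) \<le> card G * (b\<^sup>2)\<^sup>2" if v: "v \<in> {\<lambda>i. (y2 i)\<^sup>2 - (y1 i)\<^sup>2}" for v
      proof -
        have "(v i)\<^sup>2 \<le> (b\<^sup>2)\<^sup>2" if i: "i \<in> G" for i
        proof -
          have "0 \<le> (y1 i)\<^sup>2" "(y1 i)\<^sup>2 \<le> b\<^sup>2" "0 \<le> (y2 i)\<^sup>2" "(y2 i)\<^sup>2 \<le> b\<^sup>2"
            using b[OF i] \<open>b > 0\<close> by (auto simp: abs_le_square_iff[symmetric])
          then have "\<bar>(y2 i)\<^sup>2 - (y1 i)\<^sup>2\<bar> \<le> b\<^sup>2" by linarith
          then have "\<bar>(y2 i)\<^sup>2 - (y1 i)\<^sup>2\<bar> ^ 2 \<le> (b\<^sup>2) ^ 2" by (intro power_mono) auto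
          then show ?thesis using v by simp
        qed
        then show ?thesis using sum_bounded_above[of G "\<lambda>i. (v i)\<^sup>2"] by simp
      qed
    qed (use G Q \<open>b > 0\<close> in \<open>auto simp: card_gt_0_iff\<close>)
    also have "2 * (card G * (b\<^sup>2)\<^sup>2) * (ln Q + 1) = (b\<^sup>2)\<^sup>2 * (2 * card G * (ln Q + 1))"
      by (simp add: algebra_simps)
    finally show ?thesis unfolding real_sqrt_mult[of "(b\<^sup>2)\<^sup>2"] real_sqrt_abs l_def by simp
  qed
  have B4: "(\<Sum>i\<in>G. swap_sign s i * ((y2 i - f s (x2 i))\<^sup>2 - (y1 i - f s (x1 i))\<^sup>2))
      \<le> T s + 2 * b * (\<Sum>j<length (L s). \<bar>S s j\<bar>) + b\<^sup>2 * (\<Sum>j<length (L s). \<bar>S' s j\<bar>)"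
    if s: "s \<in> Pow G" for s
  proof -
    have "(\<Sum>i\<in>G. swap_sign s i * ((y2 i - f s (x2 i))\<^sup>2 - (y1 i - f s (x1 i))\<^sup>2))
      = T s - 2 * (\<Sum>i\<in>G. swap_sign s i * (y2 i * f s (x2 i) - y1 i * f s (x1 i)))
        + (\<Sum>i\<in>G. swap_sign s i * ((f s (x2 i))\<^sup>2 - (f s (x1 i))\<^sup>2))"
      unfolding T_def sum_distrib_left sum_subtractf[symmetric] sum.distrib[symmetric]
      by (intro sum.cong) (auto simp: power2_eq_square algebra_simps)
    also have "(\<Sum>i\<in>G. swap_sign s i * (y2 i * f s (x2 i) - y1 i * f s (x1 i))) = (\<Sum>j<length (L s). c s j * S s j)"
    proof -
      have "(\<Sum>i\<in>G. swap_sign s i * (y2 i * f s (x2 i) - y1 i * f s (x1 i)))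
        = (\<Sum>i\<in>G. \<Sum>j<length (L s). c s j * (swap_sign s i *
      (y2 i * indicator (L s ! j) (x2 i) - y1 i * indicator (L s ! j) (x1 i))))"
        using s by (intro sum.cong refl, subst (1 2) f)
          (auto simp only: sum_distrib_left right_diff_distrib sum_subtractf mult_ac mult_1_left Un_iff image_eqI Pow_iff)
      also have "\<dots> = (\<Sum>j<length (L s). c s j * S s j)"
        unfolding S_def sum_distrib_left by (rule sum.swap)
      finally show ?thesis .
    qed
    also have "(\<Sum>i\<in>G. swap_sign s i * ((f s (x2 i))\<^sup>2 - (f s (x1 i))\<^sup>2)) = (\<Sum>j<length (L s). (c s j)\<^sup>2 * S' s j)"
    proof -
      have "(\<Sum>i\<in>G. swap_sign s i * ((f s (x2 i))\<^sup>2 - (f s (x1 i))\<^sup>2))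
        = (\<Sum>i\<in>G. \<Sum>j<length (L s). (c s j)\<^sup>2 * (swap_sign s i *
      (1 * indicator (L s ! j) (x2 i) - 1 * indicator (L s ! j) (x1 i))))"
        using s by (intro sum.cong refl, subst (1 2) f2)
          (auto simp only: sum_distrib_left right_diff_distrib sum_subtractf mult_ac mult_1_left Un_iff image_eqI Pow_iff)
      also have "\<dots> = (\<Sum>j<length (L s). (c s j)\<^sup>2 * S' s j)"
        unfolding S'_def sum_distrib_left by (rule sum.swap)
      finally show ?thesis .
    qed
    also have "T s - 2 * (\<Sum>j<length (L s). c s j * S s j) + (\<Sum>j<length (L s). (c s j)\<^sup>2 * S' s j)
      \<le> T s + 2 * (\<Sum>j<length (L s). b * \<bar>S s j\<bar>) + (\<Sum>j<length (L s). b\<^sup>2 * \<bar>S' s j\<bar>)"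
    proof -
      have "- (\<Sum>j<length (L s). c s j * S s j) \<le> (\<Sum>j<length (L s). b * \<bar>S s j\<bar>)"
        unfolding sum_negf[symmetric]
      proof (rule sum_mono)
        fix j
        have "- (c s j * S s j) \<le> \<bar>c s j\<bar> * \<bar>S s j\<bar>" unfolding abs_mult[symmetric] by linarith
        also have "\<dots> \<le> b * \<bar>S s j\<bar>" using c by (intro mult_right_mono) auto
        finally show "- (c s j * S s j) \<le> b * \<bar>S s j\<bar>" .
      qed
      moreover have "(\<Sum>j<length (L s). (c s j)\<^sup>2 * S' s j) \<le> (\<Sum>j<length (L s). b\<^sup>2 * \<bar>S' s j\<bar>)"
      proof (rule sum_mono)
        fix j
        have "(c s j)\<^sup>2 * S' s j \<le> (c s j)\<^sup>2 * \<bar>S' s j\<bar>" by (intro mult_left_mono) auto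
        also have "\<dots> \<le> b\<^sup>2 * \<bar>S' s j\<bar>"
          using power_mono[OF c[of s j], of 2] by (intro mult_right_mono) auto
        finally show "(c s j)\<^sup>2 * S' s j \<le> b\<^sup>2 * \<bar>S' s j\<bar>" .
      qed
      ultimately show ?thesis by linarith
    qed
    finally show ?thesis by (simp add: sum_distrib_left mult.assoc)
  qed
  have "(\<Sum>s\<in>Pow G. \<Sum>i\<in>G. swap_sign s i * ((y2 i - f s (x2 i))\<^sup>2 - (y1 i - f s (x1 i))\<^sup>2))
    \<le> (\<Sum>s\<in>Pow G. T s + 2 * b * (\<Sum>j<length (L s). \<bar>S s j\<bar>) + b\<^sup>2 * (\<Sum>j<length (L s). \<bar>S' s j\<bar>))"
    by (intro sum_mono B4)
  also have "\<dots> = (\<Sum>s\<in>Pow G. T s) + 2 * b * (\<Sum>s\<in>Pow G. \<Sum>j<length (L s). \<bar>S s j\<bar>)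
      + b\<^sup>2 * (\<Sum>s\<in>Pow G. \<Sum>j<length (L s). \<bar>S' s j\<bar>)"
    by (simp add: sum.distrib sum_distrib_left)
  \<comment> \<open>In units of \<open>b\<^sup>2 * l\<close> the three terms contribute 1, 4 and 2,
    hence the constant 7.\<close>
  also have "\<dots> \<le> 2 ^ card G * (b\<^sup>2 * l) + 2 * b * (2 ^ card G * (2 * b * l)) + b\<^sup>2 * (2 ^ card G * (2 * 1 * l))"
    using B1 B2 B3 \<open>b > 0\<close> by (intro add_mono mult_left_mono) auto
  also have "\<dots> = 2 ^ card G * (7 * b\<^sup>2 * l)" by (simp add: power2_eq_square algebra_simps)
  finally show ?thesis unfolding l_def .
qed

section \<open>Symmetrization\<close>

lemma measurable_Pi_restrict_reindex:
  "f \<in> I \<rightarrow> K \<Longrightarrow> (\<lambda>w. \<lambda>j\<in>I. w (f j)) \<in> (\<Pi>\<^sub>M k\<in>K. P) \<rightarrow>\<^sub>M (\<Pi>\<^sub>M i\<in>I. P)"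
  by (intro measurable_restrict measurable_component_singleton) auto

lemma integral_PiM_reindex:
  fixes F :: "('i \<Rightarrow> 'z) \<Rightarrow> real"
  assumes "prob_space P" "inj_on f I" "f \<in> I \<rightarrow> K" "F \<in> borel_measurable (\<Pi>\<^sub>M i\<in>I. P)"
  shows "(\<integral>w. F (\<lambda>j\<in>I. w (f j)) \<partial>(\<Pi>\<^sub>M k\<in>K. P)) = (\<integral>D. F D \<partial>(\<Pi>\<^sub>M i\<in>I. P))"
proof -
  have "distr (\<Pi>\<^sub>M k\<in>K. P) (\<Pi>\<^sub>M i\<in>I. P) (\<lambda>w. \<lambda>j\<in>I. w (f j)) = (\<Pi>\<^sub>M i\<in>I. P)"
    using assms by (intro distr_PiM_reindex)
  moreover have "(\<lambda>w. \<lambda>j\<in>I. w (f j)) \<in> (\<Pi>\<^sub>M k\<in>K. P) \<rightarrow>\<^sub>M (\<Pi>\<^sub>M i\<in>I. P)"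
    using assms(3) by (rule measurable_Pi_restrict_reindex)
  ultimately show ?thesis using integral_distr[of _ "\<Pi>\<^sub>M k\<in>K. P" "\<Pi>\<^sub>M i\<in>I. P" F] assms(4) by metis
qed

text \<open>Independence of a coordinate \<open>k\<close> that the reindexed sample does not read.
  Sample and coordinate together become a product over \<open>option\<close> with
  \<open>None\<close> as the fresh index, which Fubini splits off.\<close>

lemma integral_fresh_component:
  fixes \<Phi> :: "('i \<Rightarrow> 'z) \<Rightarrow> 'z \<Rightarrow> real"
  assumes "prob_space P" "finite I" and f: "inj_on f I" "f \<in> I \<rightarrow> K" "k \<in> K" "k \<notin> f ` I"
    and meas: "case_prod \<Phi> \<in> borel_measurable ((\<Pi>\<^sub>M i\<in>I. P) \<Otimes>\<^sub>M P)"
    and bdd: "\<And>D z. \<bar>\<Phi> D z\<bar> \<le> B"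
  shows "(\<integral>w. \<Phi> (\<lambda>j\<in>I. w (f j)) (w k) \<partial>(\<Pi>\<^sub>M k\<in>K. P)) = (\<integral>D. \<integral>z. \<Phi> D z \<partial>P \<partial>(\<Pi>\<^sub>M i\<in>I. P))"
proof -
  interpret P: prob_space P by fact
  interpret product_sigma_finite "\<lambda>_. P" by standard
  let ?J = "insert None (Some ` I)"
  define g where "g = (\<lambda>u. case u of None \<Rightarrow> k | Some j \<Rightarrow> f j)"
  define \<Psi> where "\<Psi> = (\<lambda>x. \<Phi> (\<lambda>j\<in>I. x (Some j)) (x None))"
  have [measurable]: "(\<lambda>w. \<lambda>j\<in>I. w (Some j)) \<in> (\<Pi>\<^sub>M u\<in>?J. P) \<rightarrow>\<^sub>M (\<Pi>\<^sub>M i\<in>I. P)"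
    by (intro measurable_Pi_restrict_reindex) auto
  have m2[measurable]: "(\<lambda>w. \<lambda>j\<in>I. w (Some j)) \<in> (\<Pi>\<^sub>M u\<in>Some ` I. P) \<rightarrow>\<^sub>M (\<Pi>\<^sub>M i\<in>I. P)"
    by (intro measurable_Pi_restrict_reindex) auto
  have [measurable]: "(\<lambda>w. w None) \<in> (\<Pi>\<^sub>M u\<in>?J. P) \<rightarrow>\<^sub>M P" by (intro measurable_component_singleton) auto
  have \<Psi>[measurable]: "\<Psi> \<in> borel_measurable (\<Pi>\<^sub>M u\<in>?J. P)"
    using measurable_compose[OF _ meas, of "\<lambda>x. (\<lambda>j\<in>I. x (Some j), x None)"] unfolding \<Psi>_def by simp
  have "(\<integral>w. \<Phi> (\<lambda>j\<in>I. w (f j)) (w k) \<partial>(\<Pi>\<^sub>M k\<in>K. P)) = (\<integral>w. \<Psi> (\<lambda>u\<in>?J. w (g u)) \<partial>(\<Pi>\<^sub>M k\<in>K. P))"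
    unfolding \<Psi>_def g_def by (intro Bochner_Integration.integral_cong refl) (auto cong: restrict_cong)
  also have "\<dots> = (\<integral>x. \<Psi> x \<partial>(\<Pi>\<^sub>M u\<in>?J. P))"
  proof (rule integral_PiM_reindex)
    show "inj_on g ?J" using f(1,4) by (auto simp: inj_on_def g_def)
    show "g \<in> ?J \<rightarrow> K" using f by (auto simp: g_def)
  qed (use assms in measurable)
  also have "\<dots> = (\<integral>x. \<integral>y. \<Psi> (x(None := y)) \<partial>P \<partial>(\<Pi>\<^sub>M u\<in>Some ` I. P))"
  proof (rule product_integral_insert)
    interpret J: prob_space "\<Pi>\<^sub>M u\<in>?J. P" by (intro prob_space_PiM) (rule assms)
    show "integrable (\<Pi>\<^sub>M u\<in>?J. P) \<Psi>"
      by (intro J.integrable_const_bound[where B = B] AE_I2 \<Psi>) (auto simp: \<Psi>_def bdd)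
  qed (use assms in auto)
  also have "\<dots> = (\<integral>x. \<integral>y. \<Phi> (\<lambda>j\<in>I. x (Some j)) y \<partial>P \<partial>(\<Pi>\<^sub>M u\<in>Some ` I. P))"
    by (simp add: \<Psi>_def)
  also have "\<dots> = (\<integral>D. \<integral>z. \<Phi> D z \<partial>P \<partial>(\<Pi>\<^sub>M i\<in>I. P))"
  proof (rule integral_PiM_reindex)
    show "(\<lambda>D. \<integral>z. \<Phi> D z \<partial>P) \<in> borel_measurable (\<Pi>\<^sub>M i\<in>I. P)"
      using meas by (rule P.borel_measurable_lebesgue_integral)
  qed (use assms in auto)
  finally show ?thesis .
qed

text \<open>Two copies of the sample live on \<open>I \<times> UNIV\<close>. The data set
  \<open>Ds s\<close> reads the copy \<open>True\<close> on \<open>s\<close> and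
  \<open>False\<close> elsewhere, so the unread copy at \<open>i\<close> is a fresh point. The
  expected difference between fresh and own points is the same for every \<open>s\<close>; it may be
  averaged over \<open>s\<close> under the integral, where a bound for each fixed doubled sample is
  enough.\<close>

lemma symmetrization:
  fixes \<Phi> :: "('i \<Rightarrow> 'z) \<Rightarrow> 'z \<Rightarrow> real"
  assumes P: "prob_space P" and I: "finite I" "G \<subseteq> I"
    and meas: "case_prod \<Phi> \<in> borel_measurable ((\<Pi>\<^sub>M i\<in>I. P) \<Otimes>\<^sub>M P)"
    and bdd: "\<And>D z. \<bar>\<Phi> D z\<bar> \<le> B"
    and swap: "\<And>D1 D2 D. (\<And>s. D s = (\<lambda>j\<in>I. if j \<in> s then D2 j else D1 j)) \<Longrightarrow>
      (\<Sum>s\<in>Pow G. \<Sum>i\<in>G. swap_sign s i * (\<Phi> (D s) (D2 i) - \<Phi> (D s) (D1 i))) \<le> 2 ^ card G * C"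
  shows "card G * (\<integral>D. \<integral>z. \<Phi> D z \<partial>P \<partial>(\<Pi>\<^sub>M i\<in>I. P)) \<le> (\<integral>D. (\<Sum>i\<in>G. \<Phi> D (D i)) \<partial>(\<Pi>\<^sub>M i\<in>I. P)) + C"
proof -
  let ?K = "I \<times> (UNIV :: bool set)"
  let ?W = "\<Pi>\<^sub>M k\<in>?K. P"
  interpret W: prob_space ?W by (intro prob_space_PiM) (rule P)
  interpret D: prob_space "\<Pi>\<^sub>M i\<in>I. P" by (intro prob_space_PiM) (rule P)
  have fin: "finite G" using I finite_subset by blast
  define Ds where "Ds s w = (\<lambda>j\<in>I. w (j, j \<in> s))" for s and w :: "'i \<times> bool \<Rightarrow> 'z"
  have Ds[measurable]: "Ds s \<in> ?W \<rightarrow>\<^sub>M (\<Pi>\<^sub>M i\<in>I. P)" for s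
    unfolding Ds_def by (intro measurable_Pi_restrict_reindex) auto
  have c[measurable]: "(\<lambda>w. w (i, b)) \<in> ?W \<rightarrow>\<^sub>M P" if "i \<in> G" for i b
    using that I by (intro measurable_component_singleton) auto
  have c'[measurable]: "(\<lambda>w. w i) \<in> (\<Pi>\<^sub>M i\<in>I. P) \<rightarrow>\<^sub>M P" if "i \<in> G" for i
    using that I by (intro measurable_component_singleton) auto
  have m1: "(\<lambda>w. \<Phi> (Ds s w) (w (i, b))) \<in> borel_measurable ?W" if "i \<in> G" for s i b
    using measurable_compose[OF measurable_Pair[OF Ds c[OF that]] meas] by simp
  have m2: "(\<lambda>D. \<Phi> D (D i)) \<in> borel_measurable (\<Pi>\<^sub>M i\<in>I. P)" if "i \<in> G" for i
    using measurable_compose[OF measurable_Pair[OF measurable_ident_sets[OF refl] c'[OF that]] meas] by simp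
  have i1: "integrable ?W (\<lambda>w. \<Phi> (Ds s w) (w (i, b)))" if "i \<in> G" for s i b
    using m1[OF that] by (intro W.integrable_const_bound[where B = B] AE_I2) (auto simp: bdd)
  have i2: "integrable (\<Pi>\<^sub>M i\<in>I. P) (\<lambda>D. \<Phi> D (D i))" if "i \<in> G" for i
    using m2[OF that] by (intro D.integrable_const_bound[where B = B] AE_I2) (auto simp: bdd)
  define E1 where "E1 = (\<integral>D. \<integral>z. \<Phi> D z \<partial>P \<partial>(\<Pi>\<^sub>M i\<in>I. P))"
  define E2 where "E2 = (\<integral>D. (\<Sum>i\<in>G. \<Phi> D (D i)) \<partial>(\<Pi>\<^sub>M i\<in>I. P))"
  have fresh: "(\<integral>w. \<Phi> (Ds s w) (w (i, i \<notin> s)) \<partial>?W) = E1" if "i \<in> G" for s i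
    unfolding Ds_def E1_def using that I by (intro integral_fresh_component[OF P I(1) _ _ _ _ meas bdd]) (auto simp: inj_on_def)
  have own: "(\<integral>w. \<Phi> (Ds s w) (w (i, i \<in> s)) \<partial>?W) = (\<integral>D. \<Phi> D (D i) \<partial>(\<Pi>\<^sub>M i\<in>I. P))" if "i \<in> G" for s i
  proof -
    have "(\<integral>w. \<Phi> (Ds s w) (w (i, i \<in> s)) \<partial>?W) = (\<integral>w. \<Phi> (Ds s w) (Ds s w i) \<partial>?W)"
      using that I by (intro Bochner_Integration.integral_cong refl) (auto simp: Ds_def)
    also have "\<dots> = (\<integral>D. \<Phi> D (D i) \<partial>(\<Pi>\<^sub>M i\<in>I. P))"
      unfolding Ds_def by (rule integral_PiM_reindex[OF P]) (auto simp: inj_on_def m2[OF that])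
    finally show ?thesis .
  qed
  \<comment> \<open>The sign makes each summand the loss at the fresh point minus the loss at the
    own point, whichever copy is the fresh one.\<close>
  have eq: "(\<integral>w. (\<Sum>i\<in>G. swap_sign s i * (\<Phi> (Ds s w) (w (i, True)) - \<Phi> (Ds s w) (w (i, False)))) \<partial>?W) = card G * E1 - E2" for s
  proof -
    have "(\<integral>w. (\<Sum>i\<in>G. swap_sign s i * (\<Phi> (Ds s w) (w (i, True)) - \<Phi> (Ds s w) (w (i, False)))) \<partial>?W)
      = (\<integral>w. (\<Sum>i\<in>G. \<Phi> (Ds s w) (w (i, i \<notin> s)) - \<Phi> (Ds s w) (w (i, i \<in> s))) \<partial>?W)"
      by (intro Bochner_Integration.integral_cong sum.cong refl) (auto simp: swap_sign_def)
    also have "\<dots> = (\<Sum>i\<in>G. E1 - (\<integral>D. \<Phi> D (D i) \<partial>(\<Pi>\<^sub>M i\<in>I. P)))"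
      using i1 by (simp add: fresh own)
    also have "\<dots> = card G * E1 - E2"
      using i2 by (simp add: sum_subtractf E2_def)
    finally show ?thesis .
  qed
  have int: "integrable ?W (\<lambda>w. \<Sum>i\<in>G. swap_sign s i * (\<Phi> (Ds s w) (w (i, True)) - \<Phi> (Ds s w) (w (i, False))))" for s
    using i1 by auto
  have "2 ^ card G * (card G * E1 - E2)
      = (\<integral>w. (\<Sum>s\<in>Pow G. \<Sum>i\<in>G. swap_sign s i * (\<Phi> (Ds s w) (w (i, True)) - \<Phi> (Ds s w) (w (i, False)))) \<partial>?W)"
    using int fin by (subst Bochner_Integration.integral_sum) (auto simp: eq card_Pow)
  also have "\<dots> \<le> (\<integral>w. 2 ^ card G * C \<partial>?W)"
  proof (rule integral_mono)
    fix w
    have "Ds s w = (\<lambda>j\<in>I. if j \<in> s then w (j, True) else w (j, False))" for s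
      by (auto simp: Ds_def fun_eq_iff restrict_def)
    from swap[OF this]
    show "(\<Sum>s\<in>Pow G. \<Sum>i\<in>G. swap_sign s i * (\<Phi> (Ds s w) (w (i, True)) - \<Phi> (Ds s w) (w (i, False)))) \<le> 2 ^ card G * C" .
  qed (use int in auto)
  also have "\<dots> = 2 ^ card G * C" by (simp add: W.prob_space)
  finally have "card G * E1 - E2 \<le> C" by (subst (asm) mult_le_cancel_left) auto
  then show ?thesis unfolding E1_def E2_def by simp
qed

section \<open>Impurity gain of a node\<close>

lemma finite_node_points [simp]: "finite G \<Longrightarrow> finite (node_points D G A)"
  by (simp add: node_points_def)

lemma node_points_split:
  shows "node_points D G (node_pos S c A) \<union> node_points D G (node_neg S c A) = node_points D G A"
    "node_points D G (node_pos S c A) \<inter> node_points D G (node_neg S c A) = {}"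
  by (auto simp: node_points_def node_pos_def node_neg_def case_prod_unfold)

lemma sum_node_points_split:
  fixes g :: "nat \<Rightarrow> real"
  assumes "finite G"
  shows "(\<Sum>i\<in>node_points D G (node_pos S c A). g i) + (\<Sum>i\<in>node_points D G (node_neg S c A). g i)
    = (\<Sum>i\<in>node_points D G A. g i)"
  by (metis assms finite_node_points node_points_split sum.union_disjoint)

text \<open>Steiner's identity for squares about a point other than the mean; on a node without data
  both sides are 0, since division by zero gives 0.\<close>

lemma node_sse_shift:
  assumes "finite G"
  shows "(\<Sum>i\<in>node_points D G A. (snd (D i) - z)\<^sup>2)
    = node_sse D G A + (\<Sum>i\<in>node_points D G A. snd (D i) - z)\<^sup>2 / real (node_count D G A)"
proof -
  let ?I = "node_points D G A" and ?m = "node_mean D G A" and ?n = "real (node_count D G A)"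
  have fin: "finite ?I" using assms by simp
  show ?thesis
  proof (cases "?n = 0")
    case True
    then have "?I = {}" using fin by (simp add: node_count_def)
    then show ?thesis by (simp add: node_sse_def)
  next
    case False
    have s: "(\<Sum>i\<in>?I. snd (D i)) = ?n * ?m" using False by (simp add: node_mean_def)
    have q: "(\<Sum>i\<in>?I. (snd (D i) - z)\<^sup>2) = (\<Sum>i\<in>?I. (snd (D i))\<^sup>2) - 2 * z * (?n * ?m) + ?n * z\<^sup>2" for z
    proof -
      have "(\<Sum>i\<in>?I. (snd (D i) - z)\<^sup>2) = (\<Sum>i\<in>?I. (snd (D i))\<^sup>2 - 2 * z * snd (D i) + z\<^sup>2)"
        by (intro sum.cong) (auto simp: power2_eq_square algebra_simps)
      also have "\<dots> = (\<Sum>i\<in>?I. (snd (D i))\<^sup>2) - 2 * z * (\<Sum>i\<in>?I. snd (D i)) + ?n * z\<^sup>2"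
        by (simp add: sum.distrib sum_subtractf sum_distrib_left node_count_def)
      finally show ?thesis unfolding s .
    qed
    have u: "(\<Sum>i\<in>?I. snd (D i) - z) = ?n * (?m - z)"
      by (simp add: sum_subtractf s node_count_def[symmetric] algebra_simps)
    show ?thesis using False unfolding node_sse_def q u
      by (simp add: power2_eq_square field_simps)
  qed
qed

lemma node_sse_small:
  assumes "finite G" "\<not> 2 \<le> node_count D G A"
  shows "node_sse D G A = 0"
proof -
  have "card (node_points D G A) \<le> 1" "finite (node_points D G A)"
    using assms by (auto simp: node_count_def)
  then have "node_points D G A = {} \<or> (\<exists>i. node_points D G A = {i})"
    by (metis card_0_eq card_1_singletonE le_eq_less_or_eq less_one)
  then show ?thesis by (auto simp: node_sse_def node_mean_def node_count_def)
qed

text \<open>The decrease is $u^2/n_L + u^2/n_R$, where $n_L$ and $n_R$ count the points of the daughters.\<close>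
lemma node_sse_decrease:
  fixes D :: "'p::{finite,linorder} data" and S :: "'p set" and c :: "(real, 'q::{finite,linorder}) vec \<times> real"
    and A :: "(real, 'p) vec set"
  assumes "finite G"
  defines "u \<equiv> (\<Sum>i\<in>node_points D G (node_pos S c A). snd (D i) - node_mean D G A)"
  shows "node_sse D G A - node_sse D G (node_pos S c A) - node_sse D G (node_neg S c A)
    \<ge> 4 * u\<^sup>2 / real (node_count D G A)"
proof -
  let ?m = "node_mean D G A" and ?L = "node_pos S c A" and ?R = "node_neg S c A"
  let ?n = "\<lambda>A. real (node_count D G A)"
  have fin: "finite (node_points D G A)" for A using assms(1) by simp
  have n: "?n A = ?n ?L + ?n ?R"
    using node_points_split[of D G S c A] fin unfolding node_count_def
    by (metis card_Un_disjoint of_nat_add)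
  have tot: "(\<Sum>i\<in>node_points D G A. snd (D i) - ?m) = 0"
    using fin by (cases "node_points D G A = {}") (auto simp: sum_subtractf node_mean_def node_count_def)
  then have uR: "(\<Sum>i\<in>node_points D G ?R. snd (D i) - ?m) = - u"
    using sum_node_points_split[OF assms(1), of "\<lambda>i. snd (D i) - ?m" D S c A] by (simp add: u_def)
  have "node_sse D G A = (\<Sum>i\<in>node_points D G ?L. (snd (D i) - ?m)\<^sup>2) + (\<Sum>i\<in>node_points D G ?R. (snd (D i) - ?m)\<^sup>2)"
    unfolding node_sse_def sum_node_points_split[OF assms(1)] by simp
  then have eq: "node_sse D G A - node_sse D G ?L - node_sse D G ?R = u\<^sup>2 / ?n ?L + u\<^sup>2 / ?n ?R"
    unfolding node_sse_shift[OF assms(1)] uR u_def by simp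
  \<comment> \<open>An empty daughter forces \<open>u = 0\<close>, so quotients with denominator 0
    do no harm.\<close>
  have z: "?n ?L = 0 \<Longrightarrow> u = 0" "?n ?R = 0 \<Longrightarrow> u = 0"
    using uR fin by (auto simp: u_def node_count_def)
  show ?thesis
  proof (cases "?n ?L = 0 \<or> ?n ?R = 0")
    case True
    then have "u = 0" using z by blast
    then show ?thesis unfolding eq by simp
  next
    case False
    then have p: "?n ?L > 0" "?n ?R > 0" by auto
    \<comment> \<open>After clearing denominators this is 1 / n_L + 1 / n_R \<ge> 4 / (n_L +
      n_R).\<close>
    have "0 \<le> u\<^sup>2 * (?n ?L - ?n ?R)\<^sup>2" by simp
    then show ?thesis unfolding eq n using p
      by (simp add: field_simps power2_eq_square)
  qed
qed

lemma node_sse_split_le: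
  assumes "finite G"
  shows "node_sse D G (node_pos S c A) + node_sse D G (node_neg S c A) \<le> node_sse D G A"
proof -
  have "0 \<le> 4 * (\<Sum>i\<in>node_points D G (node_pos S c A). snd (D i) - node_mean D G A)\<^sup>2 / real (node_count D G A)"
    by simp
  then show ?thesis using node_sse_decrease[OF assms, where D=D and S=S and c=c and A=A] by linarith
qed

text \<open>The half-spaces are closed on the same side as in \<open>node_pos\<close>, so each term
  with a unit normal and a feature set of the right size names an admissible split of any
  node.\<close>

definition step_function ::
    "nat \<Rightarrow> (nat \<Rightarrow> real) \<Rightarrow> (nat \<Rightarrow> 'p::{finite,linorder} set) \<Rightarrow> (nat \<Rightarrow> (real, 'q::{finite,linorder}) vec \<times> real)
      \<Rightarrow> (real, 'p) vec \<Rightarrow> real" where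
  "step_function K w S c x = (\<Sum>k<K. w k * (if fst (c k) \<bullet> subvec (S k) x \<le> snd (c k) then 1 else 0))"

text \<open>The shift is dictated by the tangent bound: \<open>2 * l * r - l\<^sup>2 * n\<close> is
  \<open>2 * l\<close> times \<open>r - l / 2 * n\<close>. The comparison terms are additive over
  the daughters, so a split lowers the total excess by exactly the decrease in squared
  error.\<close>

definition node_excess :: "real \<Rightarrow> ((real, 'p::finite) vec \<Rightarrow> real) \<Rightarrow> 'p data \<Rightarrow> nat set \<Rightarrow> (real, 'p) vec set \<Rightarrow> real" where
  "node_excess l h D G A = node_sse D G A - (\<Sum>i\<in>node_points D G A. (snd (D i) - h (fst (D i)))\<^sup>2) - l / 2 * real (node_count D G A)"

lemma node_excess_split:
  assumes "finite G"
  shows "node_excess l h D G (node_pos S c A) + node_excess l h D G (node_neg S c A)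
    = node_excess l h D G A - (node_sse D G A - node_sse D G (node_pos S c A) - node_sse D G (node_neg S c A))"
proof -
  have "real (node_count D G (node_pos S c A)) + real (node_count D G (node_neg S c A)) = real (node_count D G A)"
    using sum_node_points_split[OF assms, of "\<lambda>_. 1" D S c A] by (simp add: node_count_def)
  then show ?thesis
    using sum_node_points_split[OF assms, of "\<lambda>i. (snd (D i) - h (fst (D i)))\<^sup>2" D S c A]
    unfolding node_excess_def by (simp add: algebra_simps) (metis distrib_left mult.commute)
qed

lemma node_excess_split_le:
  assumes "finite G"
  shows "node_excess l h D G (node_pos S c A) + node_excess l h D G (node_neg S c A) \<le> node_excess l h D G A"
  unfolding node_excess_split[OF assms] using node_sse_split_le[OF assms, of D S c A] by linarith

text \<open>Centred responses sum to zero, so the node mean may be subtracted from \<open>h\<close>.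
  Polarization then writes the product as half of a sum of squares, from which the square of
  \<open>h\<close> minus the mean is dropped.\<close>

lemma inner_centered_ge:
  assumes "finite G"
  shows "(\<Sum>i\<in>node_points D G A. (snd (D i) - node_mean D G A) * h (fst (D i)))
    \<ge> (node_sse D G A - (\<Sum>i\<in>node_points D G A. (snd (D i) - h (fst (D i)))\<^sup>2)) / 2"
proof -
  let ?I = "node_points D G A" and ?m = "node_mean D G A"
  have fin: "finite ?I" using assms by simp
  have tot: "(\<Sum>i\<in>?I. snd (D i) - ?m) = 0"
    using fin by (cases "?I = {}") (auto simp: sum_subtractf node_mean_def node_count_def)
  have "(\<Sum>i\<in>?I. (snd (D i) - ?m) * h (fst (D i))) = (\<Sum>i\<in>?I. (snd (D i) - ?m) * (h (fst (D i)) - ?m))"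
    using tot by (simp add: right_diff_distrib sum_subtractf sum_distrib_right[symmetric])
  also have "\<dots> \<ge> (\<Sum>i\<in>?I. ((snd (D i) - ?m)\<^sup>2 - (snd (D i) - h (fst (D i)))\<^sup>2) / 2)"
  proof (rule sum_mono)
    fix i
    have "0 \<le> (h (fst (D i)) - ?m)\<^sup>2" by simp
    then show "((snd (D i) - ?m)\<^sup>2 - (snd (D i) - h (fst (D i)))\<^sup>2) / 2 \<le> (snd (D i) - ?m) * (h (fst (D i)) - ?m)"
      by (simp add: power2_eq_square field_simps)
  qed
  also have "(\<Sum>i\<in>?I. ((snd (D i) - ?m)\<^sup>2 - (snd (D i) - h (fst (D i)))\<^sup>2) / 2)
     = (node_sse D G A - (\<Sum>i\<in>?I. (snd (D i) - h (fst (D i)))\<^sup>2)) / 2"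
    by (simp add: sum_divide_distrib[symmetric] sum_subtractf node_sse_def)
  finally show ?thesis .
qed

lemma exists_good_split:
  fixes c :: "nat \<Rightarrow> (real, 'q::{finite,linorder}) vec \<times> real" and S :: "nat \<Rightarrow> 'p::{finite,linorder} set"
  assumes "finite G" and W: "(\<Sum>k<K. \<bar>w k\<bar>) \<le> W" "W > 0"
    and r: "r = node_sse D G A - (\<Sum>i\<in>node_points D G A. (snd (D i) - step_function K w S c (fst (D i)))\<^sup>2)" "r > 0"
  shows "\<exists>k<K. node_sse D G A - node_sse D G (node_pos (S k) (c k) A) - node_sse D G (node_neg (S k) (c k) A)
    \<ge> (r / W)\<^sup>2 / real (node_count D G A)"
proof -
  let ?m = "node_mean D G A"
  define u where "u k = (\<Sum>i\<in>node_points D G (node_pos (S k) (c k) A). snd (D i) - ?m)" for k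
  have fin: "finite (node_points D G A)" for A using assms(1) by simp
  have "r / 2 \<le> (\<Sum>i\<in>node_points D G A. (snd (D i) - ?m) * step_function K w S c (fst (D i)))"
    using inner_centered_ge[OF assms(1), of D A "step_function K w S c"] r by simp
  also have "\<dots> = (\<Sum>k<K. w k * (\<Sum>i\<in>node_points D G A. if fst (c k) \<bullet> subvec (S k) (fst (D i)) \<le> snd (c k) then snd (D i) - ?m else 0))"
    unfolding step_function_def sum_distrib_left
    by (subst sum.swap) (intro sum.cong refl, auto simp: algebra_simps)
  also have "\<dots> = (\<Sum>k<K. w k * u k)"
  proof -
    have "node_points D G (node_pos (S k) (c k) A) = {i \<in> node_points D G A. fst (c k) \<bullet> subvec (S k) (fst (D i)) \<le> snd (c k)}" for k
      by (auto simp: node_points_def node_pos_def case_prod_unfold)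
    then show ?thesis unfolding u_def using fin by (simp add: sum.inter_filter)
  qed
  finally have le: "r / 2 \<le> (\<Sum>k<K. w k * u k)" .
  have "\<exists>k<K. \<bar>u k\<bar> \<ge> r / (2 * W)"
  proof (rule ccontr)
    assume "\<not> ?thesis"
    then have lt: "\<And>k. k < K \<Longrightarrow> \<bar>u k\<bar> < r / (2 * W)" by auto
    \<comment> \<open>A strict inequality between the sums requires one nonzero term, which
      \<open>r > 0\<close> provides.\<close>
    have "\<exists>k<K. w k * u k \<noteq> 0"
    proof (rule ccontr)
      assume "\<not> ?thesis"
      then have "(\<Sum>k<K. w k * u k) = 0" by (intro sum.neutral) auto
      then show False using le r by simp
    qed
    then obtain k where k: "k < K" "w k * u k \<noteq> 0" by blast
    have "(\<Sum>k<K. w k * u k) < (\<Sum>k<K. \<bar>w k\<bar> * (r / (2 * W)))"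
    proof (rule sum_strict_mono_ex1)
      show "\<forall>k\<in>{..<K}. w k * u k \<le> \<bar>w k\<bar> * (r / (2 * W))"
      proof
        fix k assume "k \<in> {..<K}"
        then have "\<bar>w k\<bar> * \<bar>u k\<bar> \<le> \<bar>w k\<bar> * (r / (2 * W))" using lt[of k] by (intro mult_left_mono) auto
        then show "w k * u k \<le> \<bar>w k\<bar> * (r / (2 * W))" by (metis abs_ge_self abs_mult order_trans)
      qed
      have "\<bar>w k\<bar> * \<bar>u k\<bar> < \<bar>w k\<bar> * (r / (2 * W))" using lt[OF k(1)] k(2) by (intro mult_strict_left_mono) auto
      then have "w k * u k < \<bar>w k\<bar> * (r / (2 * W))" by (metis abs_ge_self abs_mult order_le_less_trans)
      then show "\<exists>k\<in>{..<K}. w k * u k < \<bar>w k\<bar> * (r / (2 * W))" using k(1) by auto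
    qed auto
    also have "\<dots> = (\<Sum>k<K. \<bar>w k\<bar>) * (r / (2 * W))" by (simp only: sum_distrib_right)
    also have "\<dots> \<le> W * (r / (2 * W))" using W r by (intro mult_right_mono) auto
    also have "\<dots> = r / 2" using W by simp
    finally show False using le by linarith
  qed
  then obtain k where k: "k < K" "\<bar>u k\<bar> \<ge> r / (2 * W)" by blast
  have "(r / W)\<^sup>2 = 4 * (r / (2 * W))\<^sup>2" using W by (simp add: power2_eq_square)
  also have "(r / (2 * W))\<^sup>2 \<le> \<bar>u k\<bar>\<^sup>2" using k W r by (intro power_mono) auto
  finally have "(r / W)\<^sup>2 \<le> 4 * (u k)\<^sup>2" by simp
  then have "(r / W)\<^sup>2 / real (node_count D G A) \<le> 4 * (u k)\<^sup>2 / real (node_count D G A)"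
    by (intro divide_right_mono) auto
  also have "\<dots> \<le> node_sse D G A - node_sse D G (node_pos (S k) (c k) A) - node_sse D G (node_neg (S k) (c k) A)"
    unfolding u_def by (rule node_sse_decrease[OF assms(1)])
  finally show ?thesis using k(1) by blast
qed

section \<open>Expected training error\<close>

abbreviation feature_sets :: "nat \<Rightarrow> 'p set set" where
  "feature_sets q \<equiv> {S. card S = q}"

abbreviation feature_pmf :: "nat \<Rightarrow> nat set \<Rightarrow> (nat \<Rightarrow> 'p::finite set) pmf" where
  "feature_pmf q J \<equiv> Pi_pmf J {} (\<lambda>_. pmf_of_set (feature_sets q))"

lemma finite_feature_pmf: "finite J \<Longrightarrow> finite (set_pmf (feature_pmf q J))"
  by (subst set_Pi_pmf) (auto intro!: finite_PiE_dflt)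

text \<open>Whether a node of the given layer is split depends on the split counter and on its own
  points. The number of splits in a layer, hence the indices of the feature sets it reads, is
  therefore known before these sets are drawn.\<close>

lemma fst_odt_layer_eq: "fst (odt_layer sel t G Ss D k As) = fst (odt_layer sel t G Ss' D k As)"
  by (induction As arbitrary: k) (auto simp: Let_def case_prod_unfold)

lemma odt_layer_cong:
  "(\<And>i. k < i \<Longrightarrow> i \<le> fst (odt_layer sel t G Ss D k As) \<Longrightarrow> Ss i = Ss' i) \<Longrightarrow>
    odt_layer sel t G Ss D k As = odt_layer sel t G Ss' D k As"
proof (induction As arbitrary: k)
  case (Cons A As)
  show ?case
  proof (cases "k + 1 < t \<and> 2 \<le> node_count D G A")
    case True
    have le: "k + 1 \<le> fst (odt_layer sel t G Ss D (k + 1) As)" by (rule odt_layer_mono)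
    have "fst (odt_layer sel t G Ss D k (A # As)) = fst (odt_layer sel t G Ss D (k + 1) As)"
      using True by (simp add: Let_def case_prod_unfold)
    then have p: "\<And>i. k < i \<Longrightarrow> i \<le> fst (odt_layer sel t G Ss D (k + 1) As) \<Longrightarrow> Ss i = Ss' i"
      using Cons.prems by simp
    have "odt_layer sel t G Ss D (k + 1) As = odt_layer sel t G Ss' D (k + 1) As"
      using p by (intro Cons.IH) auto
    moreover have "Ss (k + 1) = Ss' (k + 1)" using p le by auto
    ultimately show ?thesis using True by (simp add: Let_def case_prod_unfold)
  next
    case False
    have "fst (odt_layer sel t G Ss D k (A # As)) = fst (odt_layer sel t G Ss D k As)"
      using False by (auto simp add: Let_def case_prod_unfold)
    then have "odt_layer sel t G Ss D k As = odt_layer sel t G Ss' D k As"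
      using Cons.prems by (intro Cons.IH) auto
    then show ?thesis using False by (auto simp add: Let_def case_prod_unfold)
  qed
qed simp

section \<open>Contraction of the excess for fixed data and random feature sets\<close>

context
  fixes sel :: "('p::{finite,linorder}, 'q::{finite,linorder}) split_rule"
    and D :: "'p data" and G :: "nat set" and t :: nat
    and h :: "(real, 'p) vec \<Rightarrow> real" and K :: nat and w :: "nat \<Rightarrow> real" and S :: "nat \<Rightarrow> 'p set"
    and c :: "nat \<Rightarrow> (real, 'q) vec \<times> real" and W l :: real and \<delta> :: real
  assumes q: "CARD('q) \<le> CARD('p)" and sel: "maximizing_rule sel" and fin: "finite G"
    and h: "h = step_function K w S c"
    and S: "\<And>k. k < K \<Longrightarrow> card (S k) = CARD('q)" and c: "\<And>k. k < K \<Longrightarrow> c k \<in> sphere 0 1 \<times> UNIV"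
    and W: "(\<Sum>k<K. \<bar>w k\<bar>) \<le> W" "W > 0" and l: "l > 0"
    and \<delta>: "\<delta> = 2 * l / (real (card {S :: 'p set. card S = CARD('q)}) * W\<^sup>2)"
begin

abbreviation excess :: "(real, 'p) vec set \<Rightarrow> real" where
  "excess \<equiv> node_excess l h D G"

abbreviation gain :: "'p set \<Rightarrow> (real, 'q) vec \<times> real \<Rightarrow> (real, 'p) vec set \<Rightarrow> real" where
  "gain S' c' A \<equiv> node_sse D G A - node_sse D G (node_pos S' c' A) - node_sse D G (node_neg S' c' A)"

lemma feature_sets_nonempty: "(feature_sets CARD('q) :: 'p set set) \<noteq> {}"
  using q obtain_subset_with_card_n[of "CARD('q)" "UNIV :: 'p set"] by auto

lemma card_feature_sets_pos: "card (feature_sets CARD('q) :: 'p set set) > 0"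
  using feature_sets_nonempty by (simp add: card_gt_0_iff)

lemma gain_sel_ge:
  assumes "2 \<le> node_count D G A" "card S' = CARD('q)" "c' \<in> sphere 0 1 \<times> UNIV"
  shows "gain S' (sel D G S' A) A \<ge> gain S' c' A"
proof -
  have "is_arg_max (impurity_gain D G S' A) (\<lambda>c. c \<in> sphere 0 1 \<times> UNIV) (sel D G S' A)"
    using sel fin assms unfolding maximizing_rule_def by blast
  then have "impurity_gain D G S' A c' \<le> impurity_gain D G S' A (sel D G S' A)"
    using assms unfolding is_arg_max_def by (meson not_le)
  then show ?thesis using assms(1) unfolding impurity_gain_def by (simp add: divide_le_cancel)
qed

text \<open>All gains are nonnegative, so the sum is at least the gain for the feature set of one
  good half-space of \<open>h\<close>, and the maximizer does no worse than that half-space.\<close>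

lemma sum_gain_ge:
  assumes "2 \<le> node_count D G A"
  shows "(\<Sum>S'\<in>(feature_sets CARD('q)). gain S' (sel D G S' A) A) \<ge> 2 * l * excess A / W\<^sup>2"
proof -
  define r where "r = node_sse D G A - (\<Sum>i\<in>node_points D G A. (snd (D i) - h (fst (D i)))\<^sup>2)"
  let ?n = "real (node_count D G A)"
  have n: "?n > 0" using assms by simp
  have nn: "gain S' (sel D G S' A) A \<ge> 0" for S'
    using node_sse_split_le[OF fin, of D S' "sel D G S' A" A] by simp
  have ex: "excess A = r - l / 2 * ?n" by (simp add: node_excess_def r_def)
  show ?thesis
  proof (cases "r > 0")
    case True
    obtain k where k: "k < K" "gain (S k) (c k) A \<ge> (r / W)\<^sup>2 / ?n"
      using exists_good_split[OF fin W _ True] r_def unfolding h by blast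
    \<comment> \<open>The tangent to r^2 at r = l n, which replaces the quadratic gain by one linear
      in the excess.\<close>
    have "0 \<le> (r - l * ?n)\<^sup>2" by simp
    then have "2 * l * excess A * ?n \<le> r\<^sup>2"
      by (simp add: ex power2_eq_square algebra_simps)
    then have "2 * l * excess A / W\<^sup>2 \<le> (r / W)\<^sup>2 / ?n"
      using n W by (simp add: power_divide field_simps)
    also have "\<dots> \<le> gain (S k) (sel D G (S k) A) A"
      using k gain_sel_ge[OF assms S[OF k(1)] c[OF k(1)]] by linarith
    also have "\<dots> \<le> (\<Sum>S'\<in>(feature_sets CARD('q)). gain S' (sel D G S' A) A)"
      using nn S[OF k(1)] by (intro member_le_sum[of "S k" _ "\<lambda>S'. gain S' (sel D G S' A) A"]) auto
    finally show ?thesis .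
  next
    case False
    then have "excess A \<le> 0" using ex l n by (smt (verit) mult_pos_pos half_gt_zero)
    then have "2 * l * excess A / W\<^sup>2 \<le> 0" using l by (simp add: divide_le_0_iff mult_le_0_iff)
    also have "\<dots> \<le> (\<Sum>S'\<in>(feature_sets CARD('q)). gain S' (sel D G S' A) A)" using nn by (intro sum_nonneg) auto
    finally show ?thesis .
  qed
qed

text \<open>Averaging divides the summed gain by the number of feature sets, which is how that
  number enters \<open>\<delta>\<close>.\<close>

lemma expected_excess_split_le:
  assumes "2 \<le> node_count D G A"
  shows "measure_pmf.expectation (pmf_of_set (feature_sets CARD('q)))
      (\<lambda>S'. excess (node_pos S' (sel D G S' A) A) + excess (node_neg S' (sel D G S' A) A))
    \<le> (1 - \<delta>) * excess A"
proof -
  define N where "N = real (card (feature_sets CARD('q) :: 'p set set))"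
  have N: "N > 0" using card_feature_sets_pos by (simp add: N_def del: of_nat_0_less_iff)
  have const: "(\<Sum>S'\<in>(feature_sets CARD('q) :: 'p set set). excess A) = N * excess A" by (simp add: N_def)
  have "measure_pmf.expectation (pmf_of_set (feature_sets CARD('q)))
      (\<lambda>S'. excess (node_pos S' (sel D G S' A) A) + excess (node_neg S' (sel D G S' A) A))
    = (\<Sum>S'\<in>feature_sets CARD('q). excess A - gain S' (sel D G S' A) A) / N"
    unfolding N_def using feature_sets_nonempty
    by (subst integral_pmf_of_set) (auto simp: node_excess_split[OF fin])
  also have "\<dots> = excess A - (\<Sum>S'\<in>feature_sets CARD('q). gain S' (sel D G S' A) A) / N"
    using N unfolding sum_subtractf[of "\<lambda>_. excess A"] const by (simp add: diff_divide_distrib)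
  also have "\<dots> \<le> excess A - (2 * l * excess A / W\<^sup>2) / N"
    using N sum_gain_ge[OF assms] by (intro diff_left_mono divide_right_mono) auto
  also have "\<dots> = (1 - \<delta>) * excess A"
    using N W by (simp add: \<delta> N_def[symmetric] field_simps)
  finally show ?thesis .
qed

lemma delta_pos: "\<delta> > 0"
  using card_feature_sets_pos l W by (simp add: \<delta>)

text \<open>Such a node has squared error 0 and hence nonpositive excess, which the factor
  \<open>1 - \<delta>\<close> can only raise. Nodes passed on unsplit thus fit the
  contraction.\<close>

lemma excess_small:
  assumes "\<not> 2 \<le> node_count D G A"
  shows "excess A \<le> (1 - \<delta>) * excess A"
proof -
  have "excess A \<le> 0"
  proof -
    have "0 \<le> (\<Sum>i\<in>node_points D G A. (snd (D i) - h (fst (D i)))\<^sup>2)" by (simp add: sum_nonneg)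
    moreover have "0 \<le> l / 2 * real (node_count D G A)" using l by simp
    ultimately show ?thesis using node_sse_small[OF fin assms] by (simp only: node_excess_def)
  qed
  then have "\<delta> * excess A \<le> 0" using delta_pos by (simp add: mult_le_0_iff)
  then show ?thesis by (simp add: algebra_simps)
qed

definition layer :: "(nat \<Rightarrow> 'p set) \<Rightarrow> nat \<times> (real, 'p) vec set list \<Rightarrow> nat \<times> (real, 'p) vec set list" where
  "layer Ss = (\<lambda>(k, As). odt_layer sel t G Ss D k As)"

lemma excess_layer_le: "(\<Sum>A\<leftarrow>snd (odt_layer sel t G Ss D k As). excess A) \<le> (\<Sum>A\<leftarrow>As. excess A)"
proof (induction As arbitrary: k)
  case (Cons A As)
  show ?case
    using Cons.IH[of k] Cons.IH[of "Suc k"]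
      node_excess_split_le[OF fin, of l h D "Ss (Suc k)" "sel D G (Ss (Suc k)) A" A]
    by (simp add: Let_def case_prod_unfold)
qed simp

text \<open>Each split node reads a feature set of its own, so linearity brings in the marginals of
  \<open>F\<close>. The bound on \<open>k + length As\<close> keeps the split budget from running
  out inside the layer.\<close>

lemma expected_excess_layer_le:
  assumes F: "finite (set_pmf F)"
    "\<And>i. k < i \<Longrightarrow> i < t \<Longrightarrow> map_pmf (\<lambda>Ss. Ss i) F = pmf_of_set (feature_sets CARD('q))"
    and "k + length As + 1 \<le> t"
  shows "measure_pmf.expectation F (\<lambda>Ss. \<Sum>A\<leftarrow>snd (odt_layer sel t G Ss D k As). excess A)
    \<le> (1 - \<delta>) * (\<Sum>A\<leftarrow>As. excess A)"
  using assms(2,3)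
proof (induction As arbitrary: k)
  case (Cons A As)
  have int: "integrable F f" for f :: "(nat \<Rightarrow> 'p set) \<Rightarrow> real"
    using F(1) by (rule integrable_measure_pmf_finite)
  have k: "k + 1 < t" using Cons.prems by simp
  show ?case
  proof (cases "2 \<le> node_count D G A")
    case True
    let ?c = "\<lambda>Ss. sel D G (Ss (k + 1)) A"
    have "measure_pmf.expectation F (\<lambda>Ss. excess (node_pos (Ss (k + 1)) (?c Ss) A) + excess (node_neg (Ss (k + 1)) (?c Ss) A))
      = measure_pmf.expectation (map_pmf (\<lambda>Ss. Ss (k + 1)) F)
        (\<lambda>S'. excess (node_pos S' (sel D G S' A) A) + excess (node_neg S' (sel D G S' A) A))" by simp
    also have "\<dots> \<le> (1 - \<delta>) * excess A"
      using k by (subst Cons.prems(1)) (auto intro: expected_excess_split_le True)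
    finally have 1: "measure_pmf.expectation F (\<lambda>Ss. excess (node_pos (Ss (k + 1)) (?c Ss) A) + excess (node_neg (Ss (k + 1)) (?c Ss) A))
      \<le> (1 - \<delta>) * excess A" .
    have 2: "measure_pmf.expectation F (\<lambda>Ss. \<Sum>A\<leftarrow>snd (odt_layer sel t G Ss D (k + 1) As). excess A)
      \<le> (1 - \<delta>) * (\<Sum>A\<leftarrow>As. excess A)"
      using Cons.prems by (intro Cons.IH) auto
    have "(\<lambda>Ss. \<Sum>A\<leftarrow>snd (odt_layer sel t G Ss D k (A # As)). excess A)
      = (\<lambda>Ss. (excess (node_pos (Ss (k + 1)) (?c Ss) A) + excess (node_neg (Ss (k + 1)) (?c Ss) A))
          + (\<Sum>A\<leftarrow>snd (odt_layer sel t G Ss D (k + 1) As). excess A))"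
      using True k by (auto simp: Let_def case_prod_unfold fun_eq_iff)
    then show ?thesis using 1 2 int
      by (simp only: Bochner_Integration.integral_add[OF int int]) (simp add: algebra_simps)
  next
    case False
    have "measure_pmf.expectation F (\<lambda>Ss. \<Sum>A\<leftarrow>snd (odt_layer sel t G Ss D k As). excess A)
      \<le> (1 - \<delta>) * (\<Sum>A\<leftarrow>As. excess A)"
      using Cons.prems by (intro Cons.IH) auto
    moreover have "(\<lambda>Ss. \<Sum>A\<leftarrow>snd (odt_layer sel t G Ss D k (A # As)). excess A)
      = (\<lambda>Ss. excess A + (\<Sum>A\<leftarrow>snd (odt_layer sel t G Ss D k As). excess A))"
      using False by (auto simp: Let_def case_prod_unfold fun_eq_iff)
    ultimately show ?thesis using excess_small[OF False] int
      by (simp only: Bochner_Integration.integral_add[OF int int]) (simp add: algebra_simps)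
  qed
qed simp

lemma fst_layers_mono: "fst x \<le> fst ((layer Ss ^^ j) x)"
proof (induction j)
  case (Suc j)
  then show ?case using odt_layer_mono[of "fst ((layer Ss ^^ j) x)" sel t G Ss D "snd ((layer Ss ^^ j) x)"]
    by (simp add: layer_def case_prod_unfold)
qed simp

lemma layers_cong:
  assumes "\<And>i. fst x < i \<Longrightarrow> Ss i = Ss' i"
  shows "(layer Ss ^^ j) x = (layer Ss' ^^ j) x"
proof (induction j)
  case (Suc j)
  obtain k As where y: "(layer Ss ^^ j) x = (k, As)" by (cases "(layer Ss ^^ j) x")
  then have "fst x \<le> k" using fst_layers_mono[of x j Ss] by simp
  then have "layer Ss (k, As) = layer Ss' (k, As)"
    unfolding layer_def prod.case by (intro odt_layer_cong assms) simp
  then show ?case using Suc y by simp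
qed simp

text \<open>Since a layer at most doubles its nodes, \<open>2 ^ j * length As \<le> t\<close> leaves
  room for \<open>j\<close> full layers. The features read by the first layer are independent of the
  later ones, so the induction hypothesis applies given the first layer and its bound is averaged
  afterwards.\<close>

lemma expected_excess_layers_le:
  assumes "\<delta> \<le> 1" "k + 1 = length As" "2 ^ j * length As \<le> t"
  shows "measure_pmf.expectation (feature_pmf CARD('q) {k+1..<t}) (\<lambda>Ss. \<Sum>A\<leftarrow>snd ((layer Ss ^^ j) (k, As)). excess A)
    \<le> (1 - \<delta>) ^ j * (\<Sum>A\<leftarrow>As. excess A)"
  using assms(2,3)
proof (induction j arbitrary: k As)
  case (Suc j)
  \<comment> \<open>The argument \<open>undefined\<close> is harmless: the split count of the layer
    is the same for all feature sets.\<close>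
  define k' where "k' = fst (odt_layer sel t G undefined D k As)"
  have k': "fst (odt_layer sel t G Ss D k As) = k'" for Ss unfolding k'_def by (rule fst_odt_layer_eq)
  have "length As * 2 \<le> length As * (2 * 2 ^ j)" by (intro mult_le_mono2) simp
  also have "\<dots> \<le> t" using Suc.prems by (simp add: algebra_simps)
  finally have len: "2 * length As \<le> t" by simp
  have kk: "k \<le> k'" unfolding k'_def by (rule odt_layer_mono)
  have k't: "k' + 1 \<le> t" unfolding k'_def using len Suc.prems by (intro odt_layer_le) simp
  let ?F = "feature_pmf CARD('q) {k+1..<k'+1}" and ?H = "feature_pmf CARD('q) {k'+1..<t}"
  let ?j = "\<lambda>f g i. if i \<in> {k+1..<k'+1} then f i else g i"
  let ?L = "\<lambda>f. snd (odt_layer sel t G f D k As)"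
  have un: "{k+1..<t} = {k+1..<k'+1} \<union> {k'+1..<t}" using kk k't by auto
  have lenL: "length (?L f) = k' + 1" for f
    using odt_layer_length[of sel t G f D k As] Suc.prems k'[of f] by simp
  have lenL2: "length (?L f) \<le> 2 * length As" for f
  proof -
    have "fst (odt_layer sel t G f D k As) \<le> k + length As" for f
    proof (induction As arbitrary: k)
      case (Cons A As)
      then show ?case by (auto simp: Let_def case_prod_unfold) (metis Cons.IH add_Suc add_Suc_right le_SucI)+
    qed simp
    from this[of f] show ?thesis using lenL[of f] k'[of f] Suc.prems by simp
  qed
  have step: "(\<Sum>A\<leftarrow>snd ((layer (?j f g) ^^ Suc j) (k, As)). excess A)
      = (\<Sum>A\<leftarrow>snd ((layer g ^^ j) (k', ?L f)). excess A)" for f g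
  proof -
    have "odt_layer sel t G (?j f g) D k As = odt_layer sel t G f D k As"
      by (rule odt_layer_cong) (auto simp: k')
    then have "layer (?j f g) (k, As) = (k', ?L f)"
      using k'[of f] unfolding layer_def by (simp add: prod_eq_iff)
    moreover have "(layer (?j f g) ^^ j) (k', ?L f) = (layer g ^^ j) (k', ?L f)"
      by (rule layers_cong) auto
    ultimately show ?thesis by (simp add: funpow_Suc_right del: funpow.simps)
  qed
  have "measure_pmf.expectation (feature_pmf CARD('q) {k+1..<t}) (\<lambda>Ss. \<Sum>A\<leftarrow>snd ((layer Ss ^^ Suc j) (k, As)). excess A)
    = measure_pmf.expectation (map_pmf (\<lambda>(f, g). ?j f g) (pair_pmf ?F ?H))
        (\<lambda>Ss. \<Sum>A\<leftarrow>snd ((layer Ss ^^ Suc j) (k, As)). excess A)"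
    unfolding un by (subst Pi_pmf_union) auto
  also have "\<dots> = measure_pmf.expectation (pair_pmf ?F ?H)
        (\<lambda>(f, g). \<Sum>A\<leftarrow>snd ((layer (?j f g) ^^ Suc j) (k, As)). excess A)"
    by (simp only: integral_map_pmf case_prod_unfold)
  also have "\<dots> = measure_pmf.expectation (?F \<bind> (\<lambda>f. map_pmf (Pair f) ?H))
        (\<lambda>(f, g). \<Sum>A\<leftarrow>snd ((layer (?j f g) ^^ Suc j) (k, As)). excess A)"
    by (simp only: pair_pmf_def map_pmf_def)
  also have "\<dots> = (\<Sum>f\<in>set_pmf ?F. pmf ?F f * measure_pmf.expectation ?H
        (\<lambda>g. \<Sum>A\<leftarrow>snd ((layer g ^^ j) (k', ?L f)). excess A))"
    unfolding step by (subst pmf_expectation_bind[OF finite_feature_pmf]) (auto intro: finite_feature_pmf)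
  also have "\<dots> \<le> (\<Sum>f\<in>set_pmf ?F. pmf ?F f * ((1 - \<delta>) ^ j * (\<Sum>A\<leftarrow>?L f. excess A)))"
  proof (intro sum_mono mult_left_mono)
    fix f
    have "2 ^ j * length (?L f) \<le> 2 ^ j * (2 * length As)" using lenL2 by (intro mult_le_mono2)
    then show "measure_pmf.expectation ?H (\<lambda>g. \<Sum>A\<leftarrow>snd ((layer g ^^ j) (k', ?L f)). excess A)
      \<le> (1 - \<delta>) ^ j * (\<Sum>A\<leftarrow>?L f. excess A)"
      using Suc.prems lenL by (intro Suc.IH) auto
  qed simp
  also have "\<dots> = (1 - \<delta>) ^ j * measure_pmf.expectation ?F (\<lambda>f. \<Sum>A\<leftarrow>?L f. excess A)"
    by (subst integral_measure_pmf_real[OF finite_feature_pmf]) (auto simp: sum_distrib_left mult_ac)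
  \<comment> \<open>The first layer ignores features numbered above \<open>k'\<close>, so its
    average may be taken over the whole family again, as the one-layer bound is stated.\<close>
  also have "measure_pmf.expectation ?F (\<lambda>f. \<Sum>A\<leftarrow>?L f. excess A)
      = measure_pmf.expectation (feature_pmf CARD('q) {k+1..<t}) (\<lambda>f. \<Sum>A\<leftarrow>?L f. excess A)"
  proof -
    have "?L (\<lambda>x. if x \<in> {k+1..<k'+1} then f x else {}) = ?L f" for f
      by (intro arg_cong[where f = snd] odt_layer_cong) (auto simp: k')
    then show ?thesis
      using Pi_pmf_subset[of "{k+1..<t}" "{k+1..<k'+1}" "{} :: 'p set" "\<lambda>_. pmf_of_set (feature_sets CARD('q))"] un by auto
  qed
  finally have "measure_pmf.expectation (feature_pmf CARD('q) {k+1..<t}) (\<lambda>Ss. \<Sum>A\<leftarrow>snd ((layer Ss ^^ Suc j) (k, As)). excess A)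
      \<le> (1 - \<delta>) ^ j * measure_pmf.expectation (feature_pmf CARD('q) {k+1..<t}) (\<lambda>f. \<Sum>A\<leftarrow>?L f. excess A)" .
  also have "\<dots> \<le> (1 - \<delta>) ^ j * ((1 - \<delta>) * (\<Sum>A\<leftarrow>As. excess A))"
    using len Suc.prems assms(1)
    by (intro mult_left_mono expected_excess_layer_le finite_feature_pmf) (auto simp: Pi_pmf_component)
  finally show ?case by (simp add: mult_ac)
qed simp

lemma excess_layers_le: "(\<Sum>A\<leftarrow>snd ((layer Ss ^^ j) x). excess A) \<le> (\<Sum>A\<leftarrow>snd x. excess A)"
proof (induction j)
  case (Suc j)
  then show ?case
    using excess_layer_le[of Ss "fst ((layer Ss ^^ j) x)" "snd ((layer Ss ^^ j) x)"]
    by (simp add: layer_def case_prod_unfold)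
qed simp

text \<open>The \<open>t - j\<close> rounds after the \<open>j\<close> full layers may be cut short
  by the leaf budget, but they cannot raise the excess. At the root the excess is at most the sum of
  the squared responses.\<close>

lemma expected_excess_leaves_le:
  assumes "\<delta> \<le> 1" "2 ^ j \<le> t"
  shows "measure_pmf.expectation (feature_pmf CARD('q) {1..<t}) (\<lambda>Ss. \<Sum>A\<leftarrow>odt_leaves sel t G Ss D. excess A)
    \<le> (1 - \<delta>) ^ j * (\<Sum>i\<in>G. (snd (D i))\<^sup>2)"
proof -
  have jt: "j \<le> t" using assms(2) by (meson less_exp less_imp_le order_trans)
  have "measure_pmf.expectation (feature_pmf CARD('q) {1..<t}) (\<lambda>Ss. \<Sum>A\<leftarrow>odt_leaves sel t G Ss D. excess A)
    \<le> measure_pmf.expectation (feature_pmf CARD('q) {1..<t}) (\<lambda>Ss. \<Sum>A\<leftarrow>snd ((layer Ss ^^ j) (0, [unit_cube])). excess A)"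
  proof (intro integral_mono integrable_measure_pmf_finite finite_feature_pmf)
    fix Ss
    have "odt_leaves sel t G Ss D = snd ((layer Ss ^^ (t - j)) ((layer Ss ^^ j) (0, [unit_cube])))"
      using jt unfolding odt_leaves_def layer_def
      by (metis (no_types, lifting) comp_apply funpow_add le_add_diff_inverse2)
    then show "(\<Sum>A\<leftarrow>odt_leaves sel t G Ss D. excess A) \<le> (\<Sum>A\<leftarrow>snd ((layer Ss ^^ j) (0, [unit_cube])). excess A)"
      using excess_layers_le[of "t - j" Ss] by simp
  qed auto
  also have "\<dots> \<le> (1 - \<delta>) ^ j * excess unit_cube"
    using expected_excess_layers_le[of 0 "[unit_cube]" j] assms by simp
  also have "\<dots> \<le> (1 - \<delta>) ^ j * (\<Sum>i\<in>G. (snd (D i))\<^sup>2)"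
  proof (intro mult_left_mono)
    have "0 \<le> (\<Sum>i\<in>node_points D G unit_cube. (snd (D i) - h (fst (D i)))\<^sup>2)" by (simp add: sum_nonneg)
    moreover have "0 \<le> l / 2 * real (node_count D G unit_cube)" using l by simp
    ultimately have "excess unit_cube \<le> node_sse D G unit_cube" unfolding node_excess_def by linarith
    also have "\<dots> \<le> (\<Sum>i\<in>node_points D G unit_cube. (snd (D i) - 0)\<^sup>2)"
      unfolding node_sse_shift[OF fin] by simp
    also have "\<dots> \<le> (\<Sum>i\<in>G. (snd (D i))\<^sup>2)"
      using fin by (simp, intro sum_mono2) (auto simp: node_points_def)
    finally show "excess unit_cube \<le> (\<Sum>i\<in>G. (snd (D i))\<^sup>2)" .
  qed (use assms in auto)
  finally show ?thesis .
qed

end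

section \<open>Training error of the estimator\<close>

lemma find_neq_None: "length (filter P L) = 1 \<Longrightarrow> find P L \<noteq> None"
  by (metis filter_False find_None_iff list.size(3) zero_neq_one)

lemma sum_list_node_points:
  fixes \<phi> :: "(real, 'p::finite) vec set \<Rightarrow> nat \<Rightarrow> real"
  assumes "finite G" and L: "\<And>i. i \<in> G \<Longrightarrow> length (filter (\<lambda>A. fst (D i) \<in> A) L) = 1"
  shows "(\<Sum>A\<leftarrow>L. \<Sum>i\<in>node_points D G A. \<phi> A i)
    = (\<Sum>i\<in>G. \<phi> (the (find (\<lambda>A. fst (D i) \<in> A) L)) i)"
proof -
  have "(\<Sum>A\<leftarrow>L. \<Sum>i\<in>node_points D G A. \<phi> A i) = (\<Sum>j<length L. \<Sum>i\<in>G. \<phi> (L ! j) i * indicator (L ! j) (fst (D i)))"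
  proof -
    have "(\<Sum>i\<in>node_points D G A. \<phi> A i) = (\<Sum>i\<in>G. \<phi> A i * indicator A (fst (D i)))" for A
      unfolding node_points_def sum.inter_filter[OF assms(1)] by (intro sum.cong) (auto simp: indicator_def)
    then show ?thesis by (simp add: sum_list_sum_nth atLeast0LessThan)
  qed
  also have "\<dots> = (\<Sum>i\<in>G. \<Sum>j<length L. \<phi> (L ! j) i * indicator (L ! j) (fst (D i)))" by (rule sum.swap)
  also have "\<dots> = (\<Sum>i\<in>G. \<phi> (the (find (\<lambda>A. fst (D i) \<in> A) L)) i)"
  proof (rule sum.cong[OF refl])
    fix i assume i: "i \<in> G"
    have "find (\<lambda>A. fst (D i) \<in> A) L \<noteq> None"
      using L[OF i] by (rule find_neq_None)
    then show "(\<Sum>j<length L. \<phi> (L ! j) i * indicator (L ! j) (fst (D i))) = \<phi> (the (find (\<lambda>A. fst (D i) \<in> A) L)) i"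
      using sum_leaf_eq_find[of "fst (D i)" L "\<lambda>A. \<phi> A i"] L[OF i] by (auto split: option.splits)
  qed
  finally show ?thesis .
qed

lemma node_points_restrict [simp]: "node_points (restrict D G) G A = node_points D G A"
  by (auto simp: node_points_def)

lemma node_mean_restrict [simp]: "node_mean (restrict D G) G A = node_mean D G A"
  unfolding node_mean_def node_count_def node_points_restrict
  by (intro arg_cong2[where f = "(/)"] sum.cong refl) (auto simp: node_points_def)

text \<open>At a training point the estimator is the mean of its leaf. The total excess of the
  leaves is therefore the training error minus that of the comparison function and minus
  \<open>l / 2 * card G\<close>.\<close>

lemma expected_training_error_le:
  fixes sel :: "('p::{finite,linorder}, 'q::{finite,linorder}) split_rule"
    and c :: "nat \<Rightarrow> (real, 'q) vec \<times> real"
  assumes "CARD('q) \<le> CARD('p)" "maximizing_rule sel" and fin: "finite G"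
    and "\<And>k. k < K \<Longrightarrow> card (S k) = CARD('q)" "\<And>k. k < K \<Longrightarrow> c k \<in> sphere 0 1 \<times> UNIV"
    and "(\<Sum>k<K. \<bar>w k\<bar>) \<le> W" "W > 0" "l > 0"
    and "\<delta> = 2 * l / (real (card (feature_sets CARD('q) :: 'p set set)) * W\<^sup>2)"
    and "\<delta> \<le> 1" "2 ^ j \<le> t" and D: "\<And>i. i \<in> G \<Longrightarrow> fst (D i) \<in> unit_cube"
  shows "measure_pmf.expectation (feature_pmf CARD('q) {1..<t})
      (\<lambda>Ss. \<Sum>i\<in>G. (snd (D i) - odt_estimator sel t G Ss D (fst (D i)))\<^sup>2)
    \<le> (\<Sum>i\<in>G. (snd (D i) - step_function K w S c (fst (D i)))\<^sup>2) + l / 2 * card G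
      + (1 - \<delta>) ^ j * (\<Sum>i\<in>G. (snd (D i))\<^sup>2)"
proof -
  define D' where "D' = restrict D G"
  define h where "h = step_function K w S c"
  have t: "1 \<le> t" using assms(11) by (meson le_trans one_le_numeral one_le_power)
  have D': "\<And>i. i \<in> G \<Longrightarrow> D' i = D i" by (simp add: D'_def)
  let ?L = "\<lambda>Ss. odt_leaves sel t G Ss D'"
  have eq: "(\<Sum>A\<leftarrow>?L Ss. node_excess l h D' G A)
      = (\<Sum>i\<in>G. (snd (D i) - odt_estimator sel t G Ss D (fst (D i)))\<^sup>2)
        - ((\<Sum>i\<in>G. (snd (D i) - h (fst (D i)))\<^sup>2) + l / 2 * card G)" for Ss
  proof -
    have part: "length (filter (\<lambda>A. fst (D' i) \<in> A) (?L Ss)) = 1" if "i \<in> G" for i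
      using odt_leaves_partition[OF t] D[OF that] D'[OF that] by metis
    have "node_excess l h D' G A = (\<Sum>i\<in>node_points D' G A. (snd (D' i) - node_mean D' G A)\<^sup>2
        - (snd (D' i) - h (fst (D' i)))\<^sup>2 - l / 2)" for A
      by (simp add: node_excess_def node_sse_def node_count_def sum_subtractf mult.commute)
    then have "(\<Sum>A\<leftarrow>?L Ss. node_excess l h D' G A)
      = (\<Sum>i\<in>G. (snd (D' i) - node_mean D' G (the (find (\<lambda>A. fst (D' i) \<in> A) (?L Ss))))\<^sup>2
        - (snd (D' i) - h (fst (D' i)))\<^sup>2 - l / 2)"
      by (simp only: sum_list_node_points[OF fin part])
    also have "\<dots> = (\<Sum>i\<in>G. (snd (D i) - odt_estimator sel t G Ss D (fst (D i)))\<^sup>2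
        - (snd (D i) - h (fst (D i)))\<^sup>2 - l / 2)"
    proof (intro sum.cong refl)
      fix i assume i: "i \<in> G"
      have "find (\<lambda>A. fst (D i) \<in> A) (?L Ss) \<noteq> None"
        using part[OF i] unfolding D'[OF i] by (rule find_neq_None)
      then have "odt_estimator sel t G Ss D (fst (D i)) = node_mean D' G (the (find (\<lambda>A. fst (D' i) \<in> A) (?L Ss)))"
        using D'[OF i] by (auto simp: odt_estimator_def D'_def)
      then show "(snd (D' i) - node_mean D' G (the (find (\<lambda>A. fst (D' i) \<in> A) (?L Ss))))\<^sup>2
          - (snd (D' i) - h (fst (D' i)))\<^sup>2 - l / 2
        = (snd (D i) - odt_estimator sel t G Ss D (fst (D i)))\<^sup>2 - (snd (D i) - h (fst (D i)))\<^sup>2 - l / 2"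
        using D'[OF i] by simp
    qed
    finally show ?thesis by (simp add: sum_subtractf mult.commute)
  qed
  have int: "integrable (feature_pmf CARD('q) {1..<t}) f" for f :: "(nat \<Rightarrow> 'p set) \<Rightarrow> real"
    by (intro integrable_measure_pmf_finite finite_feature_pmf) simp
  have "measure_pmf.expectation (feature_pmf CARD('q) {1..<t}) (\<lambda>Ss. \<Sum>A\<leftarrow>?L Ss. node_excess l h D' G A)
    \<le> (1 - \<delta>) ^ j * (\<Sum>i\<in>G. (snd (D' i))\<^sup>2)"
    by (rule expected_excess_leaves_le[where K = K and S = S and c = c and w = w and W = W])
      (use assms h_def in auto)
  moreover have "(\<Sum>i\<in>G. (snd (D' i))\<^sup>2) = (\<Sum>i\<in>G. (snd (D i))\<^sup>2)" using D' by simp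
  ultimately show ?thesis unfolding eq using int by (simp add: h_def)
qed

section \<open>Approximation by half-space step functions\<close>

lemma step_function_append:
  "step_function (K1 + K2) (\<lambda>k. if k < K1 then w1 k else w2 (k - K1)) (\<lambda>k. if k < K1 then S1 k else S2 (k - K1))
     (\<lambda>k. if k < K1 then c1 k else c2 (k - K1)) x
   = step_function K1 w1 S1 c1 x + step_function K2 w2 S2 c2 x"
proof -
  have *: "(\<Sum>k<K1 + K2. f k) = (\<Sum>k<K1. f k) + (\<Sum>k<K2. f (K1 + k))" for f :: "nat \<Rightarrow> real"
    by (induction K2) (auto simp: algebra_simps)
  show ?thesis unfolding step_function_def * by (intro arg_cong2[where f = "(+)"] sum.cong) auto
qed

text \<open>The type argument fixes the number of coordinates per half-space, which \<open>f\<close>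
  does not show. The weights are free to grow as the accuracy improves.\<close>

definition step_approximable ::
    "'q::{finite,linorder} itself \<Rightarrow> ((real, 'p::{finite,linorder}) vec \<Rightarrow> real) \<Rightarrow> bool" where
  "step_approximable q f \<longleftrightarrow> (\<forall>e>0. \<exists>K w S (c :: nat \<Rightarrow> (real, 'q) vec \<times> real).
     (\<forall>k<K. card (S k) = CARD('q) \<and> c k \<in> sphere 0 1 \<times> UNIV) \<and>
     (\<forall>x\<in>unit_cube. \<bar>f x - step_function K w S c x\<bar> \<le> e))"

lemma step_approximableE:
  fixes q :: "'q::{finite,linorder} itself"
  assumes "step_approximable q f" "e > 0"
  obtains K w S and c :: "nat \<Rightarrow> (real, 'q) vec \<times> real" where
    "\<forall>k<K. card (S k) = CARD('q) \<and> c k \<in> sphere 0 1 \<times> UNIV"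
    "\<forall>x\<in>unit_cube. \<bar>f x - step_function K w S c x\<bar> \<le> e"
  using assms(1)[unfolded step_approximable_def, rule_format, OF assms(2)] that
  by (elim exE conjE)

lemma step_approximable_limit:
  fixes q :: "'q::{finite,linorder} itself"
    and f :: "(real, 'b::{finite,linorder}) vec \<Rightarrow> real"
  assumes "\<And>e. e > 0 \<Longrightarrow> \<exists>g. step_approximable q g \<and> (\<forall>x\<in>unit_cube. \<bar>f x - g x\<bar> \<le> e)"
  shows "step_approximable q f"
  unfolding step_approximable_def
proof (intro allI impI)
  fix e :: real assume "e > 0"
  then obtain g where g: "step_approximable q g" "\<And>x. x \<in> unit_cube \<Longrightarrow> \<bar>f x - g x\<bar> \<le> e / 2"
    using assms[of "e / 2"] by auto
  from g(1) half_gt_zero[OF \<open>e > 0\<close>] obtain K w S and c :: "nat \<Rightarrow> (real, 'q) vec \<times> real" where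
    c: "\<forall>k<K. card (S k) = CARD('q) \<and> c k \<in> sphere 0 1 \<times> UNIV"
      "\<forall>x\<in>unit_cube. \<bar>g x - step_function K w S c x\<bar> \<le> e / 2"
    by (rule step_approximableE)
  have "\<forall>x\<in>unit_cube. \<bar>f x - step_function K w S c x\<bar> \<le> e"
  proof
    fix x :: "(real, 'b) vec" assume "x \<in> unit_cube"
    with g(2)[of x] c(2) have "\<bar>f x - g x\<bar> \<le> e / 2" "\<bar>g x - step_function K w S c x\<bar> \<le> e / 2" by auto
    then show "\<bar>f x - step_function K w S c x\<bar> \<le> e" by linarith
  qed
  then show "\<exists>K w S (c :: nat \<Rightarrow> (real, 'q) vec \<times> real).
     (\<forall>k<K. card (S k) = CARD('q) \<and> c k \<in> sphere 0 1 \<times> UNIV) \<and>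
     (\<forall>x\<in>unit_cube. \<bar>f x - step_function K w S c x\<bar> \<le> e)"
    by (intro exI[of _ K] exI[of _ w] exI[of _ S] exI[of _ c] conjI c(1))
qed

lemma step_approximable_add:
  fixes q :: "'q::{finite,linorder} itself"
    and f :: "(real, 'b::{finite,linorder}) vec \<Rightarrow> real"
  assumes "step_approximable q f" "step_approximable q g"
  shows "step_approximable q (\<lambda>x. f x + g x)"
  unfolding step_approximable_def
proof (intro allI impI)
  fix e :: real assume "e > 0"
  then have e: "e / 2 > 0" by simp
  from assms(1) e obtain K1 w1 S1 and c1 :: "nat \<Rightarrow> (real, 'q) vec \<times> real" where
    1: "\<forall>k<K1. card (S1 k) = CARD('q) \<and> c1 k \<in> sphere 0 1 \<times> UNIV"
      "\<forall>x\<in>unit_cube. \<bar>f x - step_function K1 w1 S1 c1 x\<bar> \<le> e / 2"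
    by (rule step_approximableE)
  from assms(2) e obtain K2 w2 S2 and c2 :: "nat \<Rightarrow> (real, 'q) vec \<times> real" where
    2: "\<forall>k<K2. card (S2 k) = CARD('q) \<and> c2 k \<in> sphere 0 1 \<times> UNIV"
      "\<forall>x\<in>unit_cube. \<bar>g x - step_function K2 w2 S2 c2 x\<bar> \<le> e / 2"
    by (rule step_approximableE)
  let ?w = "\<lambda>k. if k < K1 then w1 k else w2 (k - K1)"
  let ?S = "\<lambda>k. if k < K1 then S1 k else S2 (k - K1)"
  let ?c = "\<lambda>k. if k < K1 then c1 k else c2 (k - K1)"
  have "\<forall>k<K1 + K2. card (?S k) = CARD('q) \<and> ?c k \<in> sphere 0 1 \<times> UNIV"
  proof (intro allI impI)
    fix k assume "k < K1 + K2"
    then show "card (?S k) = CARD('q) \<and> ?c k \<in> sphere 0 1 \<times> UNIV"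
      using 1(1)[rule_format, of k] 2(1)[rule_format, of "k - K1"] by (cases "k < K1") auto
  qed
  moreover have "\<forall>x\<in>unit_cube. \<bar>f x + g x - step_function (K1 + K2) ?w ?S ?c x\<bar> \<le> e"
  proof
    fix x :: "(real, 'b) vec" assume "x \<in> unit_cube"
    with 1(2) 2(2) have "\<bar>f x - step_function K1 w1 S1 c1 x\<bar> \<le> e / 2" "\<bar>g x - step_function K2 w2 S2 c2 x\<bar> \<le> e / 2" by auto
    then show "\<bar>f x + g x - step_function (K1 + K2) ?w ?S ?c x\<bar> \<le> e" unfolding step_function_append by linarith
  qed
  ultimately show "\<exists>K w S (c :: nat \<Rightarrow> (real, 'q) vec \<times> real).
     (\<forall>k<K. card (S k) = CARD('q) \<and> c k \<in> sphere 0 1 \<times> UNIV) \<and>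
     (\<forall>x\<in>unit_cube. \<bar>f x + g x - step_function K w S c x\<bar> \<le> e)"
    by (intro exI conjI)
qed

lemma step_approximable_zero: "step_approximable q (\<lambda>x. 0)"
  unfolding step_approximable_def by (auto intro!: exI[of _ 0] simp: step_function_def)

lemma step_approximable_sum:
  "finite I \<Longrightarrow> (\<And>i. i \<in> I \<Longrightarrow> step_approximable q (f i)) \<Longrightarrow> step_approximable q (\<lambda>x. \<Sum>i\<in>I. f i x)"
  by (induction I rule: finite_induct) (auto intro: step_approximable_zero step_approximable_add)

lemma compact_unit_cube: "compact (unit_cube :: (real, 'n::finite) vec set)"
proof -
  have "unit_cube = cbox (0 :: (real, 'n) vec) 1"
    by (auto simp: unit_cube_def mem_box_cart)
  then show ?thesis by (metis compact_cbox)
qed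

lemma subvec_unit_cube: "x \<in> unit_cube \<Longrightarrow> subvec S x \<in> unit_cube"
  by (simp add: unit_cube_def subvec_def)

text \<open>Uniform continuity on an equidistant grid of [-b, b]. The weights are differences of
  consecutive grid values, so the active terms telescope to the value of \<open>g\<close> at the
  first grid point not below \<open>u\<close>.\<close>

lemma staircase_approximation:
  fixes g :: "real \<Rightarrow> real"
  assumes "continuous_on UNIV g" "b > 0" "e > 0"
  obtains M w s where "\<And>u. \<bar>u\<bar> \<le> b \<Longrightarrow> \<bar>g u - (\<Sum>k<Suc M. w k * (if u \<le> s k then 1 else 0))\<bar> \<le> (e :: real)"
proof -
  have "uniformly_continuous_on {-b..b} g"
    using assms(1) by (intro compact_uniformly_continuous) (auto intro: continuous_on_subset)
  then obtain d where d: "d > 0" "\<And>u v. u \<in> {-b..b} \<Longrightarrow> v \<in> {-b..b} \<Longrightarrow> dist v u < d \<Longrightarrow> dist (g v) (g u) < e"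
    using assms(3) unfolding uniformly_continuous_on_def by metis
  obtain M :: nat where M: "2 * b / d < real M" using reals_Archimedean2 by blast
  then have Mpos: "real M > 0" using assms(2) d(1) by (smt (verit) divide_pos_pos)
  define s where "s k = - b + 2 * b * real k / real M" for k
  \<comment> \<open>The last weight is the full value at the right end, which closes the
    telescope.\<close>
  define w where "w k = (if k < M then g (s k) - g (s (Suc k)) else g (s M))" for k
  have s0: "s 0 = - b" "s M = b" using Mpos by (auto simp: s_def)
  have mono: "j \<le> k \<Longrightarrow> s j \<le> s k" for j k
    using Mpos assms(2) by (auto simp: s_def intro!: divide_right_mono mult_left_mono)
  have step: "s (Suc k) - s k < d" for k
  proof -
    have "s (Suc k) - s k = 2 * b / real M" using Mpos by (simp add: s_def field_simps)
    also have "\<dots> < d" using M Mpos d(1) by (simp add: field_simps)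
    finally show ?thesis .
  qed
  show thesis
  proof (rule that[where M = M and w = w and s = s])
    fix u assume u: "\<bar>u\<bar> \<le> b"
    define k0 where "k0 = (LEAST k. u \<le> s k)"
    have uM: "u \<le> s M" using u s0 by simp
    have k0: "u \<le> s k0" "k0 \<le> M" "\<And>k. u \<le> s k \<Longrightarrow> k0 \<le> k"
      unfolding k0_def by (auto intro: LeastI[of _ M] Least_le uM)
    have iff: "u \<le> s k \<longleftrightarrow> k0 \<le> k" for k using k0 mono[of k0 k] by fastforce
    have "(\<Sum>k<Suc M. w k * (if u \<le> s k then 1 else 0)) = (\<Sum>k<M. (if k0 \<le> k then g (s k) - g (s (Suc k)) else 0)) + g (s M)"
      using k0(2) by (simp add: iff w_def if_distrib cong: if_cong sum.cong_simp)
    also have "(\<Sum>k<M. (if k0 \<le> k then g (s k) - g (s (Suc k)) else 0)) = (\<Sum>k\<in>{k0..<M}. g (s k) - g (s (Suc k)))"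
      by (subst sum.inter_filter[symmetric]) (auto intro!: sum.cong)
    also have "\<dots> = - (\<Sum>k\<in>{k0..<M}. g (s (Suc k)) - g (s k))" by (simp add: sum_negf[symmetric])
    also have "\<dots> = g (s k0) - g (s M)" using k0(2) by (subst sum_Suc_diff'[of k0 M "\<lambda>k. g (s k)"]) auto
    finally have eq: "(\<Sum>k<Suc M. w k * (if u \<le> s k then 1 else 0)) = g (s k0)" by simp
    have "dist u (s k0) < d"
    proof (cases k0)
      case 0
      then have "u = - b" using k0(1) s0 u by simp
      then show ?thesis using 0 s0 d(1) by simp
    next
      case (Suc k)
      then have "s k < u" using iff[of k] by simp
      then show ?thesis using step[of k] k0(1) Suc by (simp add: dist_real_def)
    qed
    moreover have "s k0 \<in> {-b..b}" using mono[of 0 k0] mono[of k0 M] k0(2) s0 by simp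
    ultimately have "dist (g u) (g (s k0)) < e" using d(2)[of "s k0" u] u by (simp add: dist_commute abs_le_iff)
    then show "\<bar>g u - (\<Sum>k<Suc M. w k * (if u \<le> s k then 1 else 0))\<bar> \<le> e" unfolding eq by (simp add: dist_real_def)
  qed
qed

text \<open>All steps of one staircase share the direction \<open>\<theta>\<close>, so each step is
  a half-space in the coordinates of \<open>S\<close>.\<close>

lemma step_approximable_ridge:
  fixes \<theta> :: "(real, 'q::{finite,linorder}) vec" and S :: "'p::{finite,linorder} set"
  assumes "continuous_on UNIV g" "norm \<theta> = 1" "card S = CARD('q)"
  shows "step_approximable TYPE('q) (\<lambda>x :: (real, 'p) vec. g (\<theta> \<bullet> subvec S x))"
  unfolding step_approximable_def
proof (intro allI impI)
  fix e :: real assume "e > 0"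
  have "bounded (unit_cube :: (real, 'q) vec set)" using compact_unit_cube by (rule compact_imp_bounded)
  then obtain b where b: "b > 0" "\<And>z. z \<in> (unit_cube :: (real, 'q) vec set) \<Longrightarrow> norm z \<le> b"
    unfolding bounded_pos by blast
  obtain M w s where a: "\<And>u. \<bar>u\<bar> \<le> b \<Longrightarrow> \<bar>g u - (\<Sum>k<Suc M. w k * (if u \<le> s k then 1 else 0))\<bar> \<le> e"
    using staircase_approximation[OF assms(1) b(1) \<open>e > 0\<close>] by metis
  have "\<bar>g (\<theta> \<bullet> subvec S x) - step_function (Suc M) w (\<lambda>_. S) (\<lambda>k. (\<theta>, s k)) x\<bar> \<le> e" if "x \<in> unit_cube" for x :: "(real, 'p) vec"
  proof -
    have "\<bar>\<theta> \<bullet> subvec S x\<bar> \<le> norm \<theta> * norm (subvec S x :: (real, 'q) vec)" by (rule Cauchy_Schwarz_ineq2)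
    also have "\<dots> \<le> b" using assms(2) b(2)[OF subvec_unit_cube[OF that, of S]] by simp
    finally show ?thesis using a unfolding step_function_def by simp
  qed
  then show "\<exists>K w S' (c :: nat \<Rightarrow> (real, 'q) vec \<times> real).
     (\<forall>k<K. card (S' k) = CARD('q) \<and> c k \<in> sphere 0 1 \<times> UNIV) \<and>
     (\<forall>x\<in>unit_cube. \<bar>g (\<theta> \<bullet> subvec S x) - step_function K w S' c x\<bar> \<le> e)"
    using assms by (intro exI[of _ "Suc M"] exI[of _ w] exI[of _ "\<lambda>_. S"] exI[of _ "\<lambda>k. (\<theta>, s k)"]) auto
qed

text \<open>An algebra, since exponents add under multiplication, and unlike monomials in several
  coordinates every generator is a function of one linear form.\<close>

inductive exponential_sum :: "('a::euclidean_space \<Rightarrow> real) \<Rightarrow> bool" where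
  exp: "exponential_sum (\<lambda>z. r * exp (v \<bullet> z))"
| add: "exponential_sum f \<Longrightarrow> exponential_sum g \<Longrightarrow> exponential_sum (\<lambda>z. f z + g z)"

lemma exponential_sum_mult:
  assumes "exponential_sum f" "exponential_sum g"
  shows "exponential_sum (\<lambda>z. f z * g z)"
  using assms
proof (induction f arbitrary: g)
  case (exp r v)
  from exp.prems show ?case
  proof (induction g)
    case (exp r' v')
    have eq: "(\<lambda>z. r * exp (v \<bullet> z) * (r' * exp (v' \<bullet> z))) = (\<lambda>z. (r * r') * exp ((v + v') \<bullet> z))"
      by (simp add: inner_add_left exp_add fun_eq_iff)
    show ?case by (subst eq) (rule exponential_sum.exp)
  next
    case (add f g)
    show ?case unfolding distrib_left by (rule exponential_sum.add[OF add.IH])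
  qed
next
  case (add f1 f2)
  show ?case unfolding distrib_right
    by (rule exponential_sum.add[OF add.IH(1)[OF add.prems] add.IH(2)[OF add.prems]])
qed

lemma exponential_sum_approximation:
  fixes f :: "'a::euclidean_space \<Rightarrow> real"
  assumes "compact T" "continuous_on T f" "e > 0"
  shows "\<exists>g. exponential_sum g \<and> (\<forall>x\<in>T. \<bar>f x - g x\<bar> < e)"
proof (rule Stone_Weierstrass_HOL[OF assms(1) _ _ _ _ _ assms(2,3)])
  show "exponential_sum (\<lambda>x :: 'a. r)" for r
    using exponential_sum.exp[of r 0] by simp
  show "continuous_on T f" if "exponential_sum f" for f :: "'a \<Rightarrow> real"
    using that by induction (auto intro!: continuous_intros)
  show "\<exists>f. exponential_sum f \<and> f x \<noteq> f y" if "x \<in> T \<and> y \<in> T \<and> x \<noteq> y" for x y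
  proof (intro exI conjI)
    show "exponential_sum (\<lambda>z. 1 * exp ((x - y) \<bullet> z))" by (rule exponential_sum.exp)
    have "(x - y) \<bullet> (x - y) \<noteq> 0" using that by simp
    then show "1 * exp ((x - y) \<bullet> x) \<noteq> 1 * exp ((x - y) \<bullet> y)" by (simp add: inner_diff_right)
  qed
  show "exponential_sum (\<lambda>x. f x + g x)" if "exponential_sum f \<and> exponential_sum g" for f g :: "'a \<Rightarrow> real"
    using that by (elim conjE) (rule exponential_sum.add)
  show "exponential_sum (\<lambda>x. f x * g x)" if "exponential_sum f \<and> exponential_sum g" for f g :: "'a \<Rightarrow> real"
    using that by (elim conjE) (rule exponential_sum_mult)
qed

lemma step_approximable_subvec:
  fixes f :: "(real, 'q::{finite,linorder}) vec \<Rightarrow> real" and S :: "'p::{finite,linorder} set"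
  assumes "continuous_on unit_cube f" "card S = CARD('q)"
  shows "step_approximable TYPE('q) (\<lambda>x :: (real, 'p) vec. f (subvec S x))"
proof (rule step_approximable_limit)
  fix e :: real assume "e > 0"
  then obtain g where g: "exponential_sum g" "\<forall>z\<in>unit_cube. \<bar>f z - g z\<bar> < e"
    using exponential_sum_approximation[OF compact_unit_cube assms(1)] by blast
  from g(1) have "step_approximable TYPE('q) (\<lambda>x :: (real, 'p) vec. g (subvec S x))"
  proof induction
    case (exp r v)
    \<comment> \<open>Split directions have norm 1, so the length of \<open>v\<close> moves into the
      one-dimensional profile; for \<open>v = 0\<close> any unit vector serves.\<close>
    obtain \<theta> :: "(real, 'q) vec" where \<theta>: "norm \<theta> = 1" "v = norm v *\<^sub>R \<theta>"
    proof (cases "v = 0")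
      case True
      obtain \<theta> :: "(real, 'q) vec" where "norm \<theta> = 1" using vector_choose_size[of 1] by auto
      then show thesis using True that by simp
    next
      case False
      then show thesis by (intro that[of "v /\<^sub>R norm v"]) auto
    qed
    have "v \<bullet> z = norm v * (\<theta> \<bullet> z)" for z by (subst \<theta>(2)) simp
    moreover have "continuous_on UNIV (\<lambda>u. r * exp (norm v * u))" by (intro continuous_intros)
    from step_approximable_ridge[OF this \<theta>(1) assms(2)]
    have "step_approximable TYPE('q) (\<lambda>x. r * exp (norm v * (\<theta> \<bullet> subvec S x)))" .
    ultimately show ?case by simp
  next
    case (add f g)
    then show ?case by (intro step_approximable_add)
  qed
  moreover have "\<forall>x\<in>unit_cube. \<bar>f (subvec S x) - g (subvec S x)\<bar> \<le> e"
    using g(2) subvec_unit_cube by (auto intro: less_imp_le)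
  ultimately show "\<exists>g. step_approximable TYPE('q) g \<and> (\<forall>x\<in>unit_cube. \<bar>f (subvec S x) - g x\<bar> \<le> e)" by blast
qed

section \<open>Estimation error of a tree\<close>

definition trunc :: "real \<Rightarrow> real \<Rightarrow> real" where
  "trunc b u = max (- b) (min b u)"

lemma abs_trunc_le: "b \<ge> 0 \<Longrightarrow> \<bar>trunc b u\<bar> \<le> b"
  by (auto simp: trunc_def)

lemma trunc_zero [simp]: "b \<ge> 0 \<Longrightarrow> trunc b 0 = 0"
  by (auto simp: trunc_def)

lemma trunc_diff_square_le: "(trunc b u - trunc b v)\<^sup>2 \<le> (u - v)\<^sup>2"
  by (intro iffD1[OF abs_le_square_iff]) (auto simp: trunc_def max_def min_def)

lemma trunc_measurable [measurable]: "trunc b \<in> borel_measurable borel"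
  unfolding trunc_def by measurable

text \<open>For \<open>N\<close> points and \<open>N\<close> ghosts in dimension \<open>d\<close>:
  \<open>t\<close> possible numbers of splits, at most
  \<open>(t * (2 * N + 1) ^ (d + 1)) ^ t\<close> cut lists for each, and \<open>2 ^ t\<close> sign
  patterns on the leaves.\<close>

definition tree_class_bound :: "nat \<Rightarrow> nat \<Rightarrow> nat \<Rightarrow> real" where
  "tree_class_bound d N t = real t * (real t * (2 * real N + 1) ^ (d + 1)) ^ t * 2 ^ t"

text \<open>With both samples fixed, only their at most \<open>2 * card G\<close> points matter. On
  these the tree grown on any mixture \<open>D s\<close> is one of finitely many cut lists, and
  truncation bounds its leaf values.\<close>

lemma tree_sign_sum_le:
  fixes sel :: "('p::{finite,linorder}, 'q::{finite,linorder}) split_rule" and D1 D2 :: "'p data"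
  assumes G: "finite G" "G \<noteq> {}" and t: "1 \<le> t" and b: "b > 0"
    and f: "\<And>s x. f s x = trunc b (odt_estimator sel t G Ss (D s) x)"
  shows "(\<Sum>s\<in>Pow G. \<Sum>i\<in>G. swap_sign s i *
      ((trunc b (snd (D2 i)) - f s (fst (D2 i)))\<^sup>2 - (trunc b (snd (D1 i)) - f s (fst (D1 i)))\<^sup>2))
    \<le> 2 ^ card G * (7 * b\<^sup>2 * sqrt (2 * card G * (ln (tree_class_bound CARD('p) (card G) t) + 1)))"
proof -
  define P where "P = (\<lambda>i. fst (D1 i)) ` G \<union> (\<lambda>i. fst (D2 i)) ` G"
  define hs where "hs = (\<lambda>H. H \<inter> P) ` (halfspaces :: (real, 'p) vec set set)"
  define LL where "LL = (\<Union>k<t. split_lists hs (unit_cube \<inter> P) k)"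
  define T where "T s = odt_leaves sel t G Ss (restrict (D s) G)" for s
  define L where "L s = map (\<lambda>A. A \<inter> P) (T s)" for s
  \<comment> \<open>The value 0 beyond the last leaf makes the bound \<open>b\<close> hold for every
    index.\<close>
  define c where "c s j = (if j < length (T s) then trunc b (node_mean (D s) G (T s ! j)) else 0)" for s j
  have fin: "finite P" using G by (simp add: P_def)
  have cP: "card P \<le> 2 * card G"
    unfolding P_def using card_image_le[OF G(1), of "\<lambda>i. fst (D1 i)"] card_image_le[OF G(1), of "\<lambda>i. fst (D2 i)"]
      card_Un_le[of "(\<lambda>i. fst (D1 i)) ` G" "(\<lambda>i. fst (D2 i)) ` G"] by linarith
  have hs: "finite hs" "card hs \<le> (2 * card G + 1) ^ (CARD('p) + 1)"
  proof -
    show "finite hs" unfolding hs_def by (rule card_halfspace_traces_le[OF fin])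
    have "card hs \<le> (card P + 1) ^ (CARD('p) + 1)"
      using card_halfspace_traces_le(2)[OF fin] by (simp add: hs_def)
    also have "\<dots> \<le> (2 * card G + 1) ^ (CARD('p) + 1)" using cP by (intro power_mono) auto
    finally show "card hs \<le> (2 * card G + 1) ^ (CARD('p) + 1)" .
  qed
  define h where "h = (2 * card G + 1) ^ (CARD('p) + 1)"
  have h: "h \<ge> 1" unfolding h_def by (rule one_le_power) simp
  have LLcard: "finite LL" "card LL \<le> t * (t * h) ^ t"
  proof -
    show "finite LL" unfolding LL_def using card_split_lists[OF hs(1)] by auto
    have "card LL \<le> (\<Sum>k<t. card (split_lists hs (unit_cube \<inter> P) k))"
      unfolding LL_def by (rule card_UN_le) simp
    also have "\<dots> \<le> (\<Sum>k<t. (t * h) ^ t)"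
    proof (rule sum_mono)
      fix k assume k: "k \<in> {..<t}"
      have "card (split_lists hs (unit_cube \<inter> P) k) \<le> (t * card hs) ^ k"
        using card_split_lists[OF hs(1), of k t] k by auto
      also have "\<dots> \<le> (t * h) ^ k" using hs(2) by (intro power_mono mult_le_mono) (auto simp: h_def)
      also have "\<dots> \<le> (t * h) ^ t" using k t h by (intro power_increasing) auto
      finally show "card (split_lists hs (unit_cube \<inter> P) k) \<le> (t * h) ^ t" .
    qed
    finally show "card LL \<le> t * (t * h) ^ t" by simp
  qed
  \<comment> \<open>At points of \<open>P\<close> a leaf and its trace agree: values are attached to
    leaves, while the class is counted by traces.\<close>
  have ind: "(\<Sum>j<length (L s). g (T s ! j) * indicator (L s ! j) x)
      = (case find (\<lambda>A. x \<in> A) (T s) of Some A \<Rightarrow> g A | None \<Rightarrow> 0)"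
    if "x \<in> P" for s x and g :: "(real, 'p) vec set \<Rightarrow> real"
  proof -
    have "(\<Sum>j<length (L s). g (T s ! j) * indicator (L s ! j) x) = (\<Sum>j<length (T s). g (T s ! j) * indicator (T s ! j) x)"
      using that by (intro sum.cong) (auto simp: L_def indicator_def)
    then show ?thesis using sum_leaf_eq_find[OF odt_leaves_disjoint[OF t]] unfolding T_def by simp
  qed
  have fx: "f s x = (case find (\<lambda>A. x \<in> A) (T s) of Some A \<Rightarrow> trunc b (node_mean (D s) G A) | None \<Rightarrow> 0)" for s x
    unfolding f odt_estimator_def T_def using b by (auto split: option.splits)
  show ?thesis
  proof (rule sum_sign_square_loss_le[where LL = LL and L = L and c = c and t = t])
    have "real (card LL) \<le> real (t * (t * h) ^ t)" using LLcard(2) by (rule of_nat_mono)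
    also have "\<dots> = real t * (real t * (2 * real (card G) + 1) ^ (CARD('p) + 1)) ^ t"
      by (simp only: h_def of_nat_mult of_nat_power of_nat_add of_nat_1 of_nat_numeral)
    finally show "real (card LL) * 2 ^ t \<le> tree_class_bound CARD('p) (card G) t"
      unfolding tree_class_bound_def by (intro mult_right_mono) auto
    show "length L \<le> t" if "L \<in> LL" for L
      using that length_split_lists unfolding LL_def by fastforce
    show "L s \<in> LL" for s
      using odt_leaves_trace[OF t, of P sel G Ss "restrict (D s) G"] unfolding L_def T_def LL_def hs_def by auto
    show "length (filter (\<lambda>A. x \<in> A) (L s)) \<le> 1" for s x
    proof -
      have "length (filter (\<lambda>A. x \<in> A) (L s)) \<le> length (filter (\<lambda>A. x \<in> A) (T s))"
        unfolding L_def filter_map length_map by (cases "x \<in> P") (auto simp: o_def)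
      then show ?thesis using odt_leaves_disjoint[OF t] unfolding T_def by (rule order_trans)
    qed
    show "\<bar>c s j\<bar> \<le> b" for s j using b by (auto simp: c_def abs_trunc_le)
    fix s x assume "s \<subseteq> G" "x \<in> (\<lambda>i. fst (D1 i)) ` G \<union> (\<lambda>i. fst (D2 i)) ` G"
    then have x: "x \<in> P" by (simp add: P_def)
    have "(\<Sum>j<length (L s). c s j * indicator (L s ! j) x)
      = (\<Sum>j<length (L s). (\<lambda>A. trunc b (node_mean (D s) G A)) (T s ! j) * indicator (L s ! j) x)"
      by (intro sum.cong) (auto simp: c_def L_def)
    then show "f s x = (\<Sum>j<length (L s). c s j * indicator (L s ! j) x)"
      using ind[OF x, of "\<lambda>A. trunc b (node_mean (D s) G A)" s] by (simp add: fx)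
    have "(\<Sum>j<length (L s). (c s j)\<^sup>2 * indicator (L s ! j) x)
      = (\<Sum>j<length (L s). (\<lambda>A. (trunc b (node_mean (D s) G A))\<^sup>2) (T s ! j) * indicator (L s ! j) x)"
      by (intro sum.cong) (auto simp: c_def L_def)
    then show "(f s x)\<^sup>2 = (\<Sum>j<length (L s). (c s j)\<^sup>2 * indicator (L s ! j) x)"
      using ind[OF x, of "\<lambda>A. (trunc b (node_mean (D s) G A))\<^sup>2" s] by (simp add: fx split: option.splits)
  qed (use G b LLcard abs_trunc_le[of b] in auto)
qed

definition squared_loss ::
    "real \<Rightarrow> ('p::finite data \<Rightarrow> (real, 'p) vec \<Rightarrow> real) \<Rightarrow> 'p data \<Rightarrow> (real, 'p) vec \<times> real \<Rightarrow> real" where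
  "squared_loss b f D z = (trunc b (snd z) - trunc b (f D (fst z)))\<^sup>2"

lemma squared_loss_bounds: "b \<ge> 0 \<Longrightarrow> 0 \<le> squared_loss b f D z" "b \<ge> 0 \<Longrightarrow> squared_loss b f D z \<le> (2 * b)\<^sup>2"
proof -
  assume b: "b \<ge> 0"
  have "\<bar>trunc b (snd z) - trunc b (f D (fst z))\<bar> \<le> \<bar>2 * b\<bar>"
    using abs_trunc_le[OF b, of "snd z"] abs_trunc_le[OF b, of "f D (fst z)"] by linarith
  then show "squared_loss b f D z \<le> (2 * b)\<^sup>2" unfolding squared_loss_def by (simp only: abs_le_square_iff)
qed (simp add: squared_loss_def)

lemma squared_loss_measurable:
  fixes f :: "'p::finite data \<Rightarrow> (real, 'p) vec \<Rightarrow> real"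
  assumes "case_prod f \<in> borel_measurable ((\<Pi>\<^sub>M i\<in>I. borel) \<Otimes>\<^sub>M borel)" and P: "sets P = sets borel"
  shows "case_prod (squared_loss b f) \<in> borel_measurable ((\<Pi>\<^sub>M i\<in>I. P) \<Otimes>\<^sub>M P)"
proof -
  have s: "sets ((\<Pi>\<^sub>M i\<in>I. P) \<Otimes>\<^sub>M P) = sets ((\<Pi>\<^sub>M i\<in>I. borel) \<Otimes>\<^sub>M (borel :: ((real, 'p) vec \<times> real) measure))"
    using P by (intro sets_pair_measure_cong sets_PiM_cong) auto
  have [measurable]: "(\<lambda>p. f (fst p) (fst (snd p))) \<in> borel_measurable ((\<Pi>\<^sub>M i\<in>I. borel) \<Otimes>\<^sub>M (borel :: ((real, 'p) vec \<times> real) measure))"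
  proof -
    have "(\<lambda>p. (fst p, fst (snd p))) \<in> (\<Pi>\<^sub>M i\<in>I. borel) \<Otimes>\<^sub>M (borel :: ((real, 'p) vec \<times> real) measure) \<rightarrow>\<^sub>M (\<Pi>\<^sub>M i\<in>I. borel) \<Otimes>\<^sub>M borel"
      by (intro measurable_Pair measurable_fst measurable_compose[OF measurable_snd] borel_measurable_continuous_onI continuous_intros)
    from measurable_compose[OF this assms(1)] show ?thesis by simp
  qed
  have [measurable]: "(\<lambda>p. snd (snd p)) \<in> borel_measurable ((\<Pi>\<^sub>M i\<in>I. borel) \<Otimes>\<^sub>M (borel :: ((real, 'p) vec \<times> real) measure))"
    by (intro measurable_compose[OF measurable_snd] borel_measurable_continuous_onI continuous_intros)
  have "case_prod (squared_loss b f) \<in> borel_measurable ((\<Pi>\<^sub>M i\<in>I. borel) \<Otimes>\<^sub>M (borel :: ((real, 'p) vec \<times> real) measure))"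
    unfolding squared_loss_def case_prod_unfold by measurable
  then show ?thesis using s by (simp cong: measurable_cong_sets)
qed

lemma tree_estimation:
  fixes sel :: "('p::{finite,linorder}, 'q::{finite,linorder}) split_rule"
  assumes "prob_space P" and P: "sets P = sets borel"
    and G: "G \<subseteq> {1..n}" "G \<noteq> {}" and t: "1 \<le> t" and b: "b > 0"
    and meas: "(\<lambda>(D, x). odt_estimator sel t G Ss D x) \<in> borel_measurable ((\<Pi>\<^sub>M i\<in>{1..n}. borel) \<Otimes>\<^sub>M borel)"
  shows "card G * (\<integral>D. \<integral>z. squared_loss b (odt_estimator sel t G Ss) D z \<partial>P \<partial>(\<Pi>\<^sub>M i\<in>{1..n}. P))
    \<le> (\<integral>D. (\<Sum>i\<in>G. squared_loss b (odt_estimator sel t G Ss) D (D i)) \<partial>(\<Pi>\<^sub>M i\<in>{1..n}. P))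
      + 7 * b\<^sup>2 * sqrt (2 * card G * (ln (tree_class_bound CARD('p) (card G) t) + 1))"
proof (rule symmetrization)
  show "case_prod (squared_loss b (odt_estimator sel t G Ss)) \<in> borel_measurable ((\<Pi>\<^sub>M i\<in>{1..n}. P) \<Otimes>\<^sub>M P)"
    using meas P by (rule squared_loss_measurable)
  show "\<bar>squared_loss b (odt_estimator sel t G Ss) D z\<bar> \<le> (2 * b)\<^sup>2" for D z
    using squared_loss_bounds[of b "odt_estimator sel t G Ss" D z] b by simp
  fix D1 D2 D
  show "(\<Sum>s\<in>Pow G. \<Sum>i\<in>G. swap_sign s i * (squared_loss b (odt_estimator sel t G Ss) (D s) (D2 i)
        - squared_loss b (odt_estimator sel t G Ss) (D s) (D1 i)))
    \<le> 2 ^ card G * (7 * b\<^sup>2 * sqrt (2 * card G * (ln (tree_class_bound CARD('p) (card G) t) + 1)))"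
    unfolding squared_loss_def
    using finite_subset[OF G(1)] G t b by (intro tree_sign_sum_le) auto
qed (use assms in auto)

section \<open>Risk of a single tree\<close>

definition tail_square :: "real \<Rightarrow> real \<Rightarrow> real" where
  "tail_square b y = (if \<bar>y\<bar> > b then y\<^sup>2 else 0)"

lemma tail_square_measurable [measurable]: "tail_square b \<in> borel_measurable borel"
  unfolding tail_square_def by measurable

lemma tail_square_nonneg: "0 \<le> tail_square b y"
  by (simp add: tail_square_def)

text \<open>For f > b the difference (f - u)^2 - (b - u)^2 factors as (f - b) (f + b - 2 u), which
  is at most f times 4 f; so truncation costs something only in the tail.\<close>

lemma square_diff_le_trunc:
  assumes "\<bar>u\<bar> \<le> b"
  shows "(f - u)\<^sup>2 \<le> (trunc b f - u)\<^sup>2 + 4 * tail_square b f"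
    "(y - trunc b f)\<^sup>2 \<le> (trunc b y - trunc b f)\<^sup>2 + 4 * tail_square b y"
proof -
  have b: "b \<ge> 0" using assms by linarith
  have *: "(f - u)\<^sup>2 \<le> (trunc b f - u)\<^sup>2 + 4 * tail_square b f" if u: "\<bar>u\<bar> \<le> b" for f u
  proof -
    have m: "(f - b) * (f + b - 2 * u) \<le> f * (4 * f)" if "f > b" "\<bar>u\<bar> \<le> b" for f u :: real
      using that b by (intro mult_mono) auto
    consider "\<bar>f\<bar> \<le> b" | "f > b" | "- f > b" by linarith
    then show ?thesis
    proof cases
      case 1
      then have "trunc b f = f" by (auto simp: trunc_def)
      then show ?thesis using tail_square_nonneg[of b f] by simp
    next
      case 2
      then have "trunc b f = b" "tail_square b f = f\<^sup>2" using b by (auto simp: trunc_def tail_square_def)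
      then show ?thesis using m[OF 2 u] by (simp add: power2_eq_square algebra_simps)
    next
      case 3
      then have "trunc b f = - b" "tail_square b f = f\<^sup>2" using b by (auto simp: trunc_def tail_square_def)
      then show ?thesis using m[OF 3, of "- u"] u by (simp add: power2_eq_square algebra_simps)
    qed
  qed
  show "(f - u)\<^sup>2 \<le> (trunc b f - u)\<^sup>2 + 4 * tail_square b f" by (rule *[OF assms])
  show "(y - trunc b f)\<^sup>2 \<le> (trunc b y - trunc b f)\<^sup>2 + 4 * tail_square b y"
    by (rule *) (rule abs_trunc_le[OF b])
qed

text \<open>A mean beyond \<open>b\<close> in modulus is dominated by one of the averaged responses.
  Replacing that response by the sum over \<open>G\<close> costs a factor \<open>card G\<close> in
  expectation.\<close>

lemma tail_square_node_mean_le: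
  assumes "finite G" "b \<ge> 0"
  shows "tail_square b (node_mean D G A) \<le> (\<Sum>i\<in>G. tail_square b (snd (D i)))"
proof (cases "\<bar>node_mean D G A\<bar> > b")
  case True
  let ?m = "node_mean D G A" and ?I = "node_points D G A"
  have "\<exists>i\<in>?I. \<bar>?m\<bar> \<le> \<bar>snd (D i)\<bar>"
  proof (rule ccontr)
    assume "\<not> ?thesis"
    then have lt: "\<And>i. i \<in> ?I \<Longrightarrow> \<bar>snd (D i)\<bar> < \<bar>?m\<bar>" by auto
    have ne: "?I \<noteq> {}" using True assms(2) by (auto simp: node_mean_def)
    have "\<bar>\<Sum>i\<in>?I. snd (D i)\<bar> \<le> (\<Sum>i\<in>?I. \<bar>snd (D i)\<bar>)" by (rule sum_abs)
    also have "\<dots> < (\<Sum>i\<in>?I. \<bar>?m\<bar>)" using assms ne lt by (intro sum_strict_mono) auto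
    also have "\<dots> = card ?I * \<bar>?m\<bar>" by simp
    also have "\<dots> = \<bar>\<Sum>i\<in>?I. snd (D i)\<bar>"
      using ne assms(1) by (simp add: node_mean_def node_count_def abs_divide)
    finally show False by simp
  qed
  then obtain i where i: "i \<in> ?I" "\<bar>?m\<bar> \<le> \<bar>snd (D i)\<bar>" by blast
  have "tail_square b ?m \<le> tail_square b (snd (D i))"
    using True i(2) abs_le_square_iff[of ?m "snd (D i)"] by (simp add: tail_square_def)
  also have "\<dots> \<le> (\<Sum>i\<in>G. tail_square b (snd (D i)))"
    using i(1) assms(1) by (intro member_le_sum tail_square_nonneg) (auto simp: node_points_def)
  finally show ?thesis .
next
  case False
  then show ?thesis by (simp add: tail_square_def sum_nonneg)
qed

lemma tail_square_odt_estimator_le: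
  assumes "finite G" "b \<ge> 0"
  shows "tail_square b (odt_estimator sel t G Ss D x) \<le> (\<Sum>i\<in>G. tail_square b (snd (D i)))"
  unfolding odt_estimator_def using tail_square_node_mean_le[OF assms] assms
  by (auto split: option.splits intro!: sum_nonneg tail_square_nonneg simp: tail_square_def[of b 0])

context
  fixes M :: "'w measure" and X :: "'w \<Rightarrow> (real, 'p::{finite,linorder}) vec" and Y :: "'w \<Rightarrow> real"
    and m :: "(real, 'p) vec \<Rightarrow> real" and c Mb :: real
  assumes M: "prob_space M" and X: "X \<in> borel_measurable M" "\<And>\<omega>. \<omega> \<in> space M \<Longrightarrow> X \<omega> \<in> unit_cube"
    and Y: "Y \<in> borel_measurable M" and c: "c > 0" and exp: "integrable M (\<lambda>\<omega>. exp (c * (Y \<omega>)\<^sup>2))"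
    and reg: "regression_function M X Y m" and Mb: "\<And>x. x \<in> unit_cube \<Longrightarrow> \<bar>m x\<bar> \<le> Mb"
begin

interpretation prob_space M by (rule M)

lemmas data_measurable [measurable] = X(1) Y

lemma m_measurable [measurable]: "m \<in> borel_measurable borel"
  using reg by (simp add: regression_function_def)

section \<open>Moments of the response and the bias-variance decomposition\<close>

lemma integrable_square_response: "integrable M (\<lambda>\<omega>. (Y \<omega>)\<^sup>2)"
proof (rule Bochner_Integration.integrable_bound)
  show "integrable M (\<lambda>\<omega>. 1 / c * exp (c * (Y \<omega>)\<^sup>2))" using exp by simp
  have "(Y \<omega>)\<^sup>2 \<le> 1 / c * exp (c * (Y \<omega>)\<^sup>2)" for \<omega>
  proof -
    have "c * (Y \<omega>)\<^sup>2 \<le> exp (c * (Y \<omega>)\<^sup>2)" using exp_ge_add_one_self[of "c * (Y \<omega>)\<^sup>2"] by linarith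
    then show ?thesis using c by (simp add: field_simps)
  qed
  then show "AE \<omega> in M. norm ((Y \<omega>)\<^sup>2) \<le> norm (1 / c * exp (c * (Y \<omega>)\<^sup>2))"
    using c by (intro AE_I2) auto
qed measurable

lemma integrable_response: "integrable M Y"
proof (rule Bochner_Integration.integrable_bound)
  show "integrable M (\<lambda>\<omega>. 1 + (Y \<omega>)\<^sup>2)" using integrable_square_response by simp
  have "\<bar>Y \<omega>\<bar> \<le> 1 + (Y \<omega>)\<^sup>2" for \<omega>
  proof -
    have "0 \<le> (\<bar>Y \<omega>\<bar> - 1)\<^sup>2" by simp
    also have "\<dots> = (Y \<omega>)\<^sup>2 - 2 * \<bar>Y \<omega>\<bar> + 1" by (simp add: power2_diff)
    finally show ?thesis by linarith
  qed
  then show "AE \<omega> in M. norm (Y \<omega>) \<le> norm (1 + (Y \<omega>)\<^sup>2)" by (intro AE_I2) auto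
qed measurable

lemma integrable_bounded_regressor:
  assumes [measurable]: "g \<in> borel_measurable borel" and "\<And>x. x \<in> unit_cube \<Longrightarrow> \<bar>g x\<bar> \<le> B"
  shows "integrable M (\<lambda>\<omega>. g (X \<omega>))" "integrable M (\<lambda>\<omega>. g (X \<omega>) * Y \<omega>)" "integrable M (\<lambda>\<omega>. (Y \<omega> - g (X \<omega>))\<^sup>2)"
proof -
  show 1: "integrable M (\<lambda>\<omega>. g (X \<omega>))"
    using assms(2) X(2) by (intro integrable_const_bound[where B = B] AE_I2) auto
  show 2: "integrable M (\<lambda>\<omega>. g (X \<omega>) * Y \<omega>)"
  proof (rule Bochner_Integration.integrable_bound)
    show "integrable M (\<lambda>\<omega>. B * Y \<omega>)" using integrable_response by simp
    show "AE \<omega> in M. norm (g (X \<omega>) * Y \<omega>) \<le> norm (B * Y \<omega>)"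
    proof (rule AE_I2)
      fix \<omega> assume "\<omega> \<in> space M"
      then have "\<bar>g (X \<omega>)\<bar> \<le> B" using assms(2) X(2) by auto
      then show "norm (g (X \<omega>) * Y \<omega>) \<le> norm (B * Y \<omega>)" by (simp add: abs_mult mult_right_mono)
    qed
  qed measurable
  have 3: "integrable M (\<lambda>\<omega>. (g (X \<omega>))\<^sup>2)"
  proof (intro integrable_const_bound[where B = "B\<^sup>2"] AE_I2)
    fix \<omega> assume "\<omega> \<in> space M"
    then have "\<bar>g (X \<omega>)\<bar> \<le> B" using assms(2) X(2) by auto
    then show "norm ((g (X \<omega>))\<^sup>2) \<le> B\<^sup>2" using power_mono[of "\<bar>g (X \<omega>)\<bar>" B 2] by simp
  qed measurable
  have "integrable M (\<lambda>\<omega>. (Y \<omega>)\<^sup>2 - 2 * (g (X \<omega>) * Y \<omega>) + (g (X \<omega>))\<^sup>2)"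
    using integrable_square_response 2 3 by simp
  then show "integrable M (\<lambda>\<omega>. (Y \<omega> - g (X \<omega>))\<^sup>2)"
    by (simp add: power2_eq_square algebra_simps)
qed

lemma integral_regressor_mult:
  assumes [measurable]: "g \<in> borel_measurable borel" and b: "\<And>x. x \<in> unit_cube \<Longrightarrow> \<bar>g x\<bar> \<le> B"
  shows "(\<integral>\<omega>. g (X \<omega>) * m (X \<omega>) \<partial>M) = (\<integral>\<omega>. g (X \<omega>) * Y \<omega> \<partial>M)"
proof -
  let ?F = "vimage_algebra (space M) X borel"
  have sub: "subalgebra M ?F"
    unfolding subalgebra_def using sets_image_in_sets[OF refl X(1)] by simp
  interpret finite_measure_subalgebra M ?F by standard (rule sub)
  have gF: "(\<lambda>\<omega>. g (X \<omega>)) \<in> borel_measurable ?F"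
    by (rule measurable_compose[OF measurable_vimage_algebra1 assms(1)]) simp
  have "(\<integral>\<omega>. g (X \<omega>) * Y \<omega> \<partial>M) = (\<integral>\<omega>. g (X \<omega>) * real_cond_exp M ?F Y \<omega> \<partial>M)"
    using integrable_bounded_regressor(2)[OF assms] gF Y by (rule real_cond_exp_intg(2)[symmetric])
  also have "\<dots> = (\<integral>\<omega>. g (X \<omega>) * m (X \<omega>) \<partial>M)"
  proof (rule integral_cong_AE)
    show "AE \<omega> in M. g (X \<omega>) * real_cond_exp M ?F Y \<omega> = g (X \<omega>) * m (X \<omega>)"
      using reg unfolding regression_function_def by auto
    show "(\<lambda>\<omega>. g (X \<omega>) * real_cond_exp M ?F Y \<omega>) \<in> borel_measurable M"
      by (intro borel_measurable_times borel_measurable_cond_exp2) measurable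
  qed measurable
  finally show ?thesis by simp
qed

definition noise :: real where
  "noise = (\<integral>\<omega>. (Y \<omega> - m (X \<omega>))\<^sup>2 \<partial>M)"

text \<open>The error Y - m(X) is orthogonal to the bounded function m - g of X, so the cross term
  vanishes.\<close>

lemma risk_decomposition:
  assumes g[measurable]: "g \<in> borel_measurable borel" and b: "\<And>x. x \<in> unit_cube \<Longrightarrow> \<bar>g x\<bar> \<le> B"
  shows "(\<integral>\<omega>. (m (X \<omega>) - g (X \<omega>))\<^sup>2 \<partial>M) = (\<integral>\<omega>. (Y \<omega> - g (X \<omega>))\<^sup>2 \<partial>M) - noise"
    "integrable M (\<lambda>\<omega>. (m (X \<omega>) - g (X \<omega>))\<^sup>2)"
proof -
  let ?d = "\<lambda>x. m x - g x"
  have d: "\<And>x. x \<in> unit_cube \<Longrightarrow> \<bar>?d x\<bar> \<le> Mb + B" using Mb b by (smt (verit))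
  have d2: "\<bar>(?d x)\<^sup>2\<bar> \<le> (Mb + B)\<^sup>2" if "x \<in> unit_cube" for x
    using power_mono[OF d[OF that], of 2] by simp
  have dm: "\<bar>?d x * m x\<bar> \<le> (Mb + B) * Mb" if "x \<in> unit_cube" for x
    unfolding abs_mult using d[OF that] Mb[OF that] by (intro mult_mono) auto
  have i1: "integrable M (\<lambda>\<omega>. ?d (X \<omega>) * Y \<omega>)" by (rule integrable_bounded_regressor(2)[OF _ d]) measurable
  have i2: "integrable M (\<lambda>\<omega>. (Y \<omega> - m (X \<omega>))\<^sup>2)" by (rule integrable_bounded_regressor(3)[OF _ Mb]) measurable
  show i3: "integrable M (\<lambda>\<omega>. (?d (X \<omega>))\<^sup>2)" by (rule integrable_bounded_regressor(1)[OF _ d2]) measurable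
  have i4: "integrable M (\<lambda>\<omega>. ?d (X \<omega>) * m (X \<omega>))" by (rule integrable_bounded_regressor(1)[OF _ dm]) measurable
  have "(\<integral>\<omega>. (Y \<omega> - g (X \<omega>))\<^sup>2 \<partial>M)
      = (\<integral>\<omega>. (Y \<omega> - m (X \<omega>))\<^sup>2 + 2 * (?d (X \<omega>) * Y \<omega> - ?d (X \<omega>) * m (X \<omega>)) + (?d (X \<omega>))\<^sup>2 \<partial>M)"
    by (intro Bochner_Integration.integral_cong refl) (simp add: power2_eq_square algebra_simps)
  also have "\<dots> = noise + 2 * ((\<integral>\<omega>. ?d (X \<omega>) * Y \<omega> \<partial>M) - (\<integral>\<omega>. ?d (X \<omega>) * m (X \<omega>) \<partial>M)) + (\<integral>\<omega>. (?d (X \<omega>))\<^sup>2 \<partial>M)"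
    using i1 i2 i3 i4 by (simp add: noise_def)
  also have "(\<integral>\<omega>. ?d (X \<omega>) * m (X \<omega>) \<partial>M) = (\<integral>\<omega>. ?d (X \<omega>) * Y \<omega> \<partial>M)"
    by (rule integral_regressor_mult[OF _ d]) measurable
  finally show "(\<integral>\<omega>. (?d (X \<omega>))\<^sup>2 \<partial>M) = (\<integral>\<omega>. (Y \<omega> - g (X \<omega>))\<^sup>2 \<partial>M) - noise" by simp
qed

definition tail_moment :: "real \<Rightarrow> real" where
  "tail_moment b = (\<integral>\<omega>. tail_square b (Y \<omega>) \<partial>M)"

lemma integrable_tail: "integrable M (\<lambda>\<omega>. tail_square b (Y \<omega>))"
  by (rule Bochner_Integration.integrable_bound[OF integrable_square_response])
    (measurable, auto simp: tail_square_def)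

text \<open>One half of the exponent absorbs the factor y^2, with constant 2 / c; for |y| > b the
  other half exceeds c b^2 / 2.\<close>

lemma tail_moment_le:
  assumes "b \<ge> 0"
  shows "tail_moment b \<le> 2 / c * exp (- (c * b\<^sup>2 / 2)) * (\<integral>\<omega>. exp (c * (Y \<omega>)\<^sup>2) \<partial>M)"
proof -
  have "tail_moment b \<le> (\<integral>\<omega>. 2 / c * exp (- (c * b\<^sup>2 / 2)) * exp (c * (Y \<omega>)\<^sup>2) \<partial>M)"
    unfolding tail_moment_def
  proof (rule integral_mono[OF integrable_tail])
    fix \<omega>
    let ?y = "Y \<omega>"
    show "tail_square b ?y \<le> 2 / c * exp (- (c * b\<^sup>2 / 2)) * exp (c * ?y\<^sup>2)"
    proof (cases "\<bar>?y\<bar> > b")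
      case True
      then have "b\<^sup>2 \<le> ?y\<^sup>2" using power_mono[of b "\<bar>?y\<bar>" 2] assms by simp
      have "c * ?y\<^sup>2 / 2 \<le> exp (c * ?y\<^sup>2 / 2)" using exp_ge_add_one_self[of "c * ?y\<^sup>2 / 2"] by linarith
      then have "?y\<^sup>2 \<le> 2 / c * exp (c * ?y\<^sup>2 / 2)" using c by (simp add: field_simps)
      also have "\<dots> \<le> 2 / c * exp (- (c * b\<^sup>2 / 2) + c * ?y\<^sup>2)"
        using \<open>b\<^sup>2 \<le> ?y\<^sup>2\<close> c by (intro mult_left_mono) (auto simp: field_simps)
      also have "\<dots> = 2 / c * exp (- (c * b\<^sup>2 / 2)) * exp (c * ?y\<^sup>2)" by (simp only: exp_add mult.assoc)
      finally show ?thesis using True by (simp add: tail_square_def)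
    next
      case False
      then show ?thesis using c by (simp add: tail_square_def)
    qed
  qed (use exp in simp)
  then show ?thesis by simp
qed

section \<open>Law of the sample and removal of the truncation\<close>

abbreviation law :: "((real, 'p) vec \<times> real) measure" where
  "law \<equiv> distr M borel (\<lambda>\<omega>. (X \<omega>, Y \<omega>))"

lemma pair_measurable [measurable]: "(\<lambda>\<omega>. (X \<omega>, Y \<omega>)) \<in> M \<rightarrow>\<^sub>M borel"
  by (subst borel_prod[symmetric]) measurable

lemma prob_space_law: "prob_space law"
  by (rule prob_space_distr) measurable

lemma integral_law:
  fixes F :: "(real, 'p) vec \<times> real \<Rightarrow> real"
  assumes "F \<in> borel_measurable borel"
  shows "(\<integral>z. F z \<partial>law) = (\<integral>\<omega>. F (X \<omega>, Y \<omega>) \<partial>M)" "integrable law F \<longleftrightarrow> integrable M (\<lambda>\<omega>. F (X \<omega>, Y \<omega>))"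
  using integral_distr[OF pair_measurable assms] integrable_distr_eq[OF pair_measurable assms] by simp_all

lemma sample_component:
  fixes F :: "(real, 'p) vec \<times> real \<Rightarrow> real"
  assumes F: "F \<in> borel_measurable borel" and int: "integrable M (\<lambda>\<omega>. F (X \<omega>, Y \<omega>))" and i: "i \<in> {1..n}"
  shows "(\<integral>D. F (D i) \<partial>sample_measure M X Y n) = (\<integral>\<omega>. F (X \<omega>, Y \<omega>) \<partial>M)"
    "integrable (sample_measure M X Y n) (\<lambda>D. F (D i))"
proof -
  have d: "distr (sample_measure M X Y n) law (\<lambda>D. D i) = law"
    unfolding sample_measure_def using i prob_space_law by (intro distr_PiM_component)
  have ms: "(\<lambda>D. D i) \<in> sample_measure M X Y n \<rightarrow>\<^sub>M law"
    unfolding sample_measure_def using i by (intro measurable_component_singleton)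
  have F': "F \<in> borel_measurable law" using F by simp
  show "(\<integral>D. F (D i) \<partial>sample_measure M X Y n) = (\<integral>\<omega>. F (X \<omega>, Y \<omega>) \<partial>M)"
    using integral_distr[OF ms F'] unfolding d integral_law(1)[OF F] by simp
  show "integrable (sample_measure M X Y n) (\<lambda>D. F (D i))"
    using integrable_distr_eq[OF ms F'] int unfolding d integral_law(2)[OF F] by simp
qed

lemma snd_measurable [measurable]: "snd \<in> borel_measurable (borel :: ((real, 'p) vec \<times> real) measure)"
  by (intro borel_measurable_continuous_onI continuous_intros)

lemma fst_measurable [measurable]: "fst \<in> (borel :: ((real, 'p) vec \<times> real) measure) \<rightarrow>\<^sub>M borel"
  by (intro borel_measurable_continuous_onI continuous_intros)

lemma sets_sample: "sets (sample_measure M X Y n) = sets (\<Pi>\<^sub>M i\<in>{1..n}. borel)"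
  unfolding sample_measure_def by (intro sets_PiM_cong) auto

lemma prob_space_sample: "prob_space (sample_measure M X Y n)"
  unfolding sample_measure_def by (intro prob_space_PiM prob_space_law)

context
  fixes f :: "'p data \<Rightarrow> (real, 'p) vec \<Rightarrow> real" and n :: nat and G :: "nat set" and b :: real
  assumes G: "G \<subseteq> {1..n}" and b: "b > 0" "Mb \<le> b"
    and f: "case_prod f \<in> borel_measurable ((\<Pi>\<^sub>M i\<in>{1..n}. borel) \<Otimes>\<^sub>M borel)"
    and f_tail: "\<And>D x. tail_square b (f D x) \<le> (\<Sum>i\<in>G. tail_square b (snd (D i)))"
begin

lemma section_measurable:
  assumes "D \<in> space (sample_measure M X Y n)"
  shows "f D \<in> borel_measurable borel"
proof -
  have "space (sample_measure M X Y n) = space (\<Pi>\<^sub>M i\<in>{1..n}. (borel :: ((real, 'p) vec \<times> real) measure))"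
    by (rule sets_eq_imp_space_eq[OF sets_sample])
  then have "Pair D \<in> borel \<rightarrow>\<^sub>M (\<Pi>\<^sub>M i\<in>{1..n}. borel) \<Otimes>\<^sub>M borel"
    using assms by (intro measurable_Pair1') simp
  from measurable_compose[OF this f] show ?thesis by simp
qed

lemma squared_loss_section:
  assumes "D \<in> space (sample_measure M X Y n)"
  shows "(\<integral>\<omega>. (trunc b (f D (X \<omega>)) - m (X \<omega>))\<^sup>2 \<partial>M)
      \<le> (\<integral>z. squared_loss b f D z \<partial>law) + 4 * tail_moment b - noise"
    "integrable M (\<lambda>\<omega>. (trunc b (f D (X \<omega>)) - m (X \<omega>))\<^sup>2)"
proof -
  note [measurable] = section_measurable[OF assms]
  have bd: "\<bar>trunc b (f D x)\<bar> \<le> b" for x using b by (simp add: abs_trunc_le)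
  have sl[measurable]: "squared_loss b f D \<in> borel_measurable borel" unfolding squared_loss_def by measurable
  have int: "integrable M (\<lambda>\<omega>. squared_loss b f D (X \<omega>, Y \<omega>))"
    using squared_loss_bounds[of b f D] b
    by (intro integrable_const_bound[where B = "(2 * b)\<^sup>2"] AE_I2) auto
  show "integrable M (\<lambda>\<omega>. (trunc b (f D (X \<omega>)) - m (X \<omega>))\<^sup>2)"
    using risk_decomposition(2)[of "\<lambda>x. trunc b (f D x)" b, OF _ bd] by (simp add: power2_commute)
  have "(\<integral>\<omega>. (trunc b (f D (X \<omega>)) - m (X \<omega>))\<^sup>2 \<partial>M) = (\<integral>\<omega>. (Y \<omega> - trunc b (f D (X \<omega>)))\<^sup>2 \<partial>M) - noise"
    using risk_decomposition(1)[of "\<lambda>x. trunc b (f D x)" b, OF _ bd] by (simp add: power2_commute)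
  also have "(\<integral>\<omega>. (Y \<omega> - trunc b (f D (X \<omega>)))\<^sup>2 \<partial>M)
      \<le> (\<integral>\<omega>. squared_loss b f D (X \<omega>, Y \<omega>) + 4 * tail_square b (Y \<omega>) \<partial>M)"
  proof (rule integral_mono)
    show "integrable M (\<lambda>\<omega>. (Y \<omega> - trunc b (f D (X \<omega>)))\<^sup>2)"
      by (rule integrable_bounded_regressor(3)[of "\<lambda>x. trunc b (f D x)" b, OF _ bd]) measurable
    show "integrable M (\<lambda>\<omega>. squared_loss b f D (X \<omega>, Y \<omega>) + 4 * tail_square b (Y \<omega>))"
      using int integrable_tail by simp
    show "(Y \<omega> - trunc b (f D (X \<omega>)))\<^sup>2 \<le> squared_loss b f D (X \<omega>, Y \<omega>) + 4 * tail_square b (Y \<omega>)" for \<omega>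
      using square_diff_le_trunc(2)[of 0 b] b by (simp add: squared_loss_def)
  qed
  also have "\<dots> = (\<integral>z. squared_loss b f D z \<partial>law) + 4 * tail_moment b"
    using int integrable_tail by (simp add: integral_law(1)[OF sl] tail_moment_def)
  finally show "(\<integral>\<omega>. (trunc b (f D (X \<omega>)) - m (X \<omega>))\<^sup>2 \<partial>M)
      \<le> (\<integral>z. squared_loss b f D z \<partial>law) + 4 * tail_moment b - noise" by simp
qed

text \<open>Undoing the truncation costs 4 tail moments for the response and, through
  \<open>f_tail\<close>, 4 per subsample point for the estimator. Nonnegativity of the right-hand
  side keeps \<open>ennreal\<close> from cutting off the subtraction of \<open>noise\<close>, so the
  feature average can later be taken inside.\<close>

lemma risk_le_squared_loss:
  "(\<integral>\<^sup>+D. (\<integral>\<^sup>+x. ennreal (\<bar>f D x - m x\<bar> ^ 2) \<partial>distr M borel X) \<partial>sample_measure M X Y n)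
    \<le> ennreal ((\<integral>D. \<integral>z. squared_loss b f D z \<partial>law \<partial>sample_measure M X Y n)
        + 4 * (real (card G) + 1) * tail_moment b - noise)"
  "0 \<le> (\<integral>D. \<integral>z. squared_loss b f D z \<partial>law \<partial>sample_measure M X Y n)
        + 4 * (real (card G) + 1) * tail_moment b - noise"
proof -
  interpret S: prob_space "sample_measure M X Y n" by (rule prob_space_sample)
  interpret law: prob_space law by (rule prob_space_law)
  define T where "T D = (\<Sum>i\<in>G. tail_square b (snd (D i)))" for D :: "'p data"
  define u where "u D = (\<integral>z. squared_loss b f D z \<partial>law) + 4 * tail_moment b - noise + 4 * T D" for D
  have T_nonneg: "T D \<ge> 0" for D unfolding T_def by (intro sum_nonneg tail_square_nonneg)
  have le_u: "(\<integral>\<^sup>+x. ennreal (\<bar>f D x - m x\<bar> ^ 2) \<partial>distr M borel X) \<le> ennreal (u D)" "0 \<le> u D"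
    if D: "D \<in> space (sample_measure M X Y n)" for D
  proof -
    note [measurable] = section_measurable[OF D]
    have le: "(\<integral>\<omega>. (trunc b (f D (X \<omega>)) - m (X \<omega>))\<^sup>2 \<partial>M) + 4 * T D \<le> u D"
      using squared_loss_section(1)[OF D] by (simp add: u_def)
    have "0 \<le> (\<integral>\<omega>. (trunc b (f D (X \<omega>)) - m (X \<omega>))\<^sup>2 \<partial>M) + 4 * T D" using T_nonneg by simp
    with le show "0 \<le> u D" by linarith
    have "(\<integral>\<^sup>+x. ennreal (\<bar>f D x - m x\<bar> ^ 2) \<partial>distr M borel X) = (\<integral>\<^sup>+\<omega>. ennreal (\<bar>f D (X \<omega>) - m (X \<omega>)\<bar> ^ 2) \<partial>M)"
      by (rule nn_integral_distr) measurable
    also have "\<dots> \<le> (\<integral>\<^sup>+\<omega>. ennreal ((trunc b (f D (X \<omega>)) - m (X \<omega>))\<^sup>2 + 4 * T D) \<partial>M)"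
    proof (intro nn_integral_mono ennreal_leI)
      fix \<omega> assume "\<omega> \<in> space M"
      then have "\<bar>m (X \<omega>)\<bar> \<le> b" using Mb[OF X(2)] b(2) by force
      from square_diff_le_trunc(1)[OF this, of "f D (X \<omega>)"]
      show "\<bar>f D (X \<omega>) - m (X \<omega>)\<bar> ^ 2 \<le> (trunc b (f D (X \<omega>)) - m (X \<omega>))\<^sup>2 + 4 * T D"
        using f_tail[of D "X \<omega>"] by (simp add: T_def)
    qed
    also have "\<dots> = ennreal (\<integral>\<omega>. (trunc b (f D (X \<omega>)) - m (X \<omega>))\<^sup>2 + 4 * T D \<partial>M)"
      using squared_loss_section(2)[OF D] T_nonneg by (intro nn_integral_eq_integral) auto
    also have "\<dots> \<le> ennreal (u D)"
      using squared_loss_section(2)[OF D] le by (intro ennreal_leI) (simp add: prob_space)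
    finally show "(\<integral>\<^sup>+x. ennreal (\<bar>f D x - m x\<bar> ^ 2) \<partial>distr M borel X) \<le> ennreal (u D)" .
  qed
  have int1: "integrable (sample_measure M X Y n) (\<lambda>D. \<integral>z. squared_loss b f D z \<partial>law)"
  proof (rule S.integrable_const_bound[where B = "(2 * b)\<^sup>2"])
    have "case_prod (squared_loss b f) \<in> borel_measurable (sample_measure M X Y n \<Otimes>\<^sub>M law)"
      unfolding sample_measure_def by (rule squared_loss_measurable[OF f]) simp
    then show "(\<lambda>D. \<integral>z. squared_loss b f D z \<partial>law) \<in> borel_measurable (sample_measure M X Y n)"
      by (rule law.borel_measurable_lebesgue_integral)
    have "\<bar>\<integral>z. squared_loss b f D z \<partial>law\<bar> \<le> (2 * b)\<^sup>2" if D: "D \<in> space (sample_measure M X Y n)" for D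
    proof -
      note [measurable] = section_measurable[OF D]
      have [measurable]: "squared_loss b f D \<in> borel_measurable borel" unfolding squared_loss_def by measurable
      have "integrable law (squared_loss b f D)"
        using squared_loss_bounds[of b f D] b
        by (intro law.integrable_const_bound[where B = "(2 * b)\<^sup>2"] AE_I2) auto
      have "0 \<le> (\<integral>z. squared_loss b f D z \<partial>law)" using b by (intro integral_nonneg_AE AE_I2 squared_loss_bounds) simp
      moreover have "(\<integral>z. squared_loss b f D z \<partial>law) \<le> (2 * b)\<^sup>2"
        using b \<open>integrable law _\<close> by (intro law.integral_le_const AE_I2 squared_loss_bounds) auto
      ultimately show ?thesis by simp
    qed
    then show "AE D in sample_measure M X Y n. norm (\<integral>z. squared_loss b f D z \<partial>law) \<le> (2 * b)\<^sup>2"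
      by (intro AE_I2) (simp only: real_norm_def)
  qed
  have comp: "(\<integral>D. tail_square b (snd (D i)) \<partial>sample_measure M X Y n) = tail_moment b"
    "integrable (sample_measure M X Y n) (\<lambda>D. tail_square b (snd (D i)))" if "i \<in> G" for i
  proof -
    have F: "(\<lambda>z :: (real, 'p) vec \<times> real. tail_square b (snd z)) \<in> borel_measurable borel" by measurable
    have int: "integrable M (\<lambda>\<omega>. tail_square b (snd (X \<omega>, Y \<omega>)))" using integrable_tail[of b] by simp
    show "(\<integral>D. tail_square b (snd (D i)) \<partial>sample_measure M X Y n) = tail_moment b"
      "integrable (sample_measure M X Y n) (\<lambda>D. tail_square b (snd (D i)))"
      using sample_component[OF F int subsetD[OF G that]] by (simp_all add: tail_moment_def)
  qed
  have int2: "integrable (sample_measure M X Y n) T" unfolding T_def by (intro Bochner_Integration.integrable_sum comp(2))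
  have intT: "(\<integral>D. T D \<partial>sample_measure M X Y n) = real (card G) * tail_moment b"
    unfolding T_def using comp by simp
  have int_u: "integrable (sample_measure M X Y n) u" unfolding u_def using int1 int2 by simp
  have eq: "(\<integral>D. u D \<partial>sample_measure M X Y n) = (\<integral>D. \<integral>z. squared_loss b f D z \<partial>law \<partial>sample_measure M X Y n)
        + 4 * (real (card G) + 1) * tail_moment b - noise"
    unfolding u_def using int1 int2 by (simp add: intT S.prob_space algebra_simps)
  have "0 \<le> (\<integral>D. u D \<partial>sample_measure M X Y n)" using le_u(2) by (intro integral_nonneg_AE AE_I2)
  then show "0 \<le> (\<integral>D. \<integral>z. squared_loss b f D z \<partial>law \<partial>sample_measure M X Y n)
        + 4 * (real (card G) + 1) * tail_moment b - noise" unfolding eq .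
  have "(\<integral>\<^sup>+D. (\<integral>\<^sup>+x. ennreal (\<bar>f D x - m x\<bar> ^ 2) \<partial>distr M borel X) \<partial>sample_measure M X Y n)
      \<le> (\<integral>\<^sup>+D. ennreal (u D) \<partial>sample_measure M X Y n)"
    using le_u(1) by (rule nn_integral_mono)
  also have "\<dots> = ennreal (\<integral>D. u D \<partial>sample_measure M X Y n)"
    using int_u le_u(2) by (intro nn_integral_eq_integral AE_I2)
  finally show "(\<integral>\<^sup>+D. (\<integral>\<^sup>+x. ennreal (\<bar>f D x - m x\<bar> ^ 2) \<partial>distr M borel X) \<partial>sample_measure M X Y n)
    \<le> ennreal ((\<integral>D. \<integral>z. squared_loss b f D z \<partial>law \<partial>sample_measure M X Y n)
        + 4 * (real (card G) + 1) * tail_moment b - noise)" unfolding eq .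
qed

end

text \<open>Symmetrization compares population and training loss for fixed features, on average over
  the data; the training bound holds for fixed data, on average over the features. Exchanging the
  two averages joins them, and the noise in the error of the comparison function cancels the
  subtracted \<open>noise\<close>.\<close>

lemma expected_tree_risk_le:
  fixes sel :: "('p, 'q::{finite,linorder}) split_rule"
    and ck :: "nat \<Rightarrow> (real, 'q) vec \<times> real" and S :: "nat \<Rightarrow> 'p set"
  assumes q: "CARD('q) \<le> CARD('p)" and sel: "maximizing_rule sel"
    and G: "G \<subseteq> {1..n}" "card G = N" "N \<ge> 1" and meas: "measurable_trees sel n N t"
    and b: "b > 0" "Mb \<le> b"
    and S: "\<And>k. k < K \<Longrightarrow> card (S k) = CARD('q)" and ck: "\<And>k. k < K \<Longrightarrow> ck k \<in> sphere 0 1 \<times> UNIV"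
    and W: "(\<Sum>k<K. \<bar>w k\<bar>) \<le> W" "W > 0" and l: "l > 0"
    and \<delta>: "\<delta> = 2 * l / (real (card (feature_sets CARD('q) :: 'p set set)) * W\<^sup>2)" "\<delta> \<le> 1"
    and j: "2 ^ j \<le> t"
    and \<eta>: "\<And>x. x \<in> unit_cube \<Longrightarrow> \<bar>m x - step_function K w S ck x\<bar> \<le> \<eta>"
  shows "(\<integral>\<^sup>+Ss. (\<integral>\<^sup>+D. (\<integral>\<^sup>+x. ennreal (\<bar>odt_estimator sel t G Ss D x - m x\<bar> ^ 2) \<partial>distr M borel X)
        \<partial>sample_measure M X Y n) \<partial>measure_pmf (feature_pmf CARD('q) {1..<t}))
    \<le> ennreal (\<eta>\<^sup>2 + l / 2 + (1 - \<delta>) ^ j * (\<integral>\<omega>. (Y \<omega>)\<^sup>2 \<partial>M)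
        + 7 * b\<^sup>2 * sqrt (2 * real N * (ln (tree_class_bound CARD('p) N t) + 1)) / real N
        + 4 * (real N + 1) * tail_moment b)"
proof -
  interpret S: prob_space "sample_measure M X Y n" by (rule prob_space_sample)
  let ?F = "feature_pmf CARD('q) {1..<t} :: (nat \<Rightarrow> 'p set) pmf"
  define est where "est Ss = odt_estimator sel t G Ss" for Ss
  define R where "R Ss = (\<integral>D. \<integral>z. squared_loss b (est Ss) D z \<partial>law \<partial>sample_measure M X Y n)" for Ss
  define A where "A Ss D = (\<Sum>i\<in>G. squared_loss b (est Ss) D (D i))" for Ss and D :: "'p data"
  define h where "h = step_function K w S ck"
  define sym where "sym = 7 * b\<^sup>2 * sqrt (2 * real N * (ln (tree_class_bound CARD('p) N t) + 1))"
  have fin: "finite G" "G \<noteq> {}" using G finite_subset[OF G(1)] by auto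
  have t: "1 \<le> t" using j by (meson le_trans one_le_numeral one_le_power)
  have finF: "finite (set_pmf ?F)" by (rule finite_feature_pmf) simp
  have intF: "integrable (measure_pmf ?F) g" for g :: "(nat \<Rightarrow> 'p set) \<Rightarrow> real" using finF by (rule integrable_measure_pmf_finite)
  have valid: "\<forall>\<tau>\<in>{1..<t}. card (Ss \<tau>) = CARD('q)" if "Ss \<in> set_pmf ?F" for Ss
  proof -
    have "feature_sets CARD('q) \<noteq> ({} :: 'p set set)"
      using q obtain_subset_with_card_n[of "CARD('q)" "UNIV :: 'p set"] by auto
    then show ?thesis using that by (auto simp: set_Pi_pmf PiE_dflt_def)
  qed
  have m_est: "case_prod (est Ss) \<in> borel_measurable ((\<Pi>\<^sub>M i\<in>{1..n}. borel) \<Otimes>\<^sub>M borel)" if "Ss \<in> set_pmf ?F" for Ss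
    using meas G valid[OF that] unfolding measurable_trees_def est_def by blast
  have tail: "tail_square b (est Ss D x) \<le> (\<Sum>i\<in>G. tail_square b (snd (D i)))" for Ss D x
    unfolding est_def using fin(1) b by (intro tail_square_odt_estimator_le) auto
  note risk = risk_le_squared_loss[OF G(1) b m_est tail, folded R_def, unfolded G(2)]
  have mA: "integrable (sample_measure M X Y n) (A Ss)" if Ss: "Ss \<in> set_pmf ?F" for Ss
    unfolding A_def
  proof (intro Bochner_Integration.integrable_sum S.integrable_const_bound[where B = "(2 * b)\<^sup>2"] AE_I2)
    fix i assume i: "i \<in> G"
    have k: "(\<lambda>D. (D, D i)) \<in> (\<Pi>\<^sub>M i\<in>{1..n}. law) \<rightarrow>\<^sub>M (\<Pi>\<^sub>M i\<in>{1..n}. law) \<Otimes>\<^sub>M law"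
      using i G by (intro measurable_Pair measurable_ident_sets[OF refl] measurable_component_singleton) auto
    have "case_prod (squared_loss b (est Ss)) \<in> borel_measurable ((\<Pi>\<^sub>M i\<in>{1..n}. law) \<Otimes>\<^sub>M law)"
      using m_est[OF Ss] by (rule squared_loss_measurable) simp
    from measurable_compose[OF k this]
    show "(\<lambda>D. squared_loss b (est Ss) D (D i)) \<in> borel_measurable (sample_measure M X Y n)"
      unfolding sample_measure_def prod.case .
    show "norm (squared_loss b (est Ss) D (D i)) \<le> (2 * b)\<^sup>2" for D
      using squared_loss_bounds[of b "est Ss" D "D i"] b by simp
  qed
  have est: "R Ss \<le> (\<integral>D. A Ss D \<partial>sample_measure M X Y n) / real N + sym / real N" if Ss: "Ss \<in> set_pmf ?F" for Ss
  proof -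
    have "real N * R Ss \<le> (\<integral>D. A Ss D \<partial>sample_measure M X Y n) + sym"
      using tree_estimation[OF prob_space_law _ G(1) fin(2) t b(1), of sel Ss] m_est[OF Ss]
      unfolding R_def A_def sym_def sample_measure_def est_def G(2) by simp
    then show ?thesis using G(3) by (simp add: field_simps)
  qed
  have h_meas: "h \<in> borel_measurable borel"
  proof -
    have "(\<lambda>x. subvec S' x) \<in> borel_measurable borel" for S' :: "'p set" 
      using linear_continuous_on[of "subvec S'" UNIV] linear_subvec
      by (intro borel_measurable_continuous_onI) (auto simp: linear_conv_bounded_linear)
    note [measurable] = this
    show ?thesis unfolding h_def step_function_def by measurable
  qed
  have h_bd: "\<bar>h x\<bar> \<le> Mb + \<eta>" if "x \<in> unit_cube" for x
    using Mb[OF that] \<eta>[OF that] unfolding h_def by linarith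
  \<comment> \<open>Summed over the subsample, this bounds the averaged training loss. The tree no
    longer occurs in it, so its expectation is computed point by point.\<close>
  define \<psi> where "\<psi> z = (snd z - h (fst z))\<^sup>2 + l / 2 + (1 - \<delta>) ^ j * (snd z)\<^sup>2" for z
  have \<psi>m: "\<psi> \<in> borel_measurable borel" 
  proof -
    note [measurable] = h_meas
    show ?thesis unfolding \<psi>_def by measurable
  qed
  have ih: "integrable M (\<lambda>\<omega>. (Y \<omega> - h (X \<omega>))\<^sup>2)" by (rule integrable_bounded_regressor(3)[OF h_meas h_bd])
  have \<psi>i: "integrable M (\<lambda>\<omega>. \<psi> (X \<omega>, Y \<omega>))"
    unfolding \<psi>_def using ih integrable_square_response by simp
  have \<psi>_le: "(\<integral>\<omega>. \<psi> (X \<omega>, Y \<omega>) \<partial>M) \<le> noise + \<eta>\<^sup>2 + l / 2 + (1 - \<delta>) ^ j * (\<integral>\<omega>. (Y \<omega>)\<^sup>2 \<partial>M)"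
  proof -
    have "(\<integral>\<omega>. (m (X \<omega>) - h (X \<omega>))\<^sup>2 \<partial>M) \<le> (\<integral>\<omega>. \<eta>\<^sup>2 \<partial>M)"
    proof (rule integral_mono)
      fix \<omega> assume "\<omega> \<in> space M"
      then have "\<bar>m (X \<omega>) - h (X \<omega>)\<bar> \<le> \<eta>" using \<eta>[OF X(2)] unfolding h_def by simp
      then show "(m (X \<omega>) - h (X \<omega>))\<^sup>2 \<le> \<eta>\<^sup>2" using power_mono[of "\<bar>m (X \<omega>) - h (X \<omega>)\<bar>" \<eta> 2] by simp
    qed (use risk_decomposition(2)[OF h_meas h_bd] in auto)
    then have "(\<integral>\<omega>. (Y \<omega> - h (X \<omega>))\<^sup>2 \<partial>M) \<le> noise + \<eta>\<^sup>2"
      using risk_decomposition(1)[OF h_meas h_bd] by (simp add: prob_space)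
    then show ?thesis unfolding \<psi>_def using ih integrable_square_response by (simp add: prob_space)
  qed
  have train: "measure_pmf.expectation ?F (\<lambda>Ss. A Ss D) \<le> (\<Sum>i\<in>G. \<psi> (D i))"
    if D: "\<And>i. i \<in> G \<Longrightarrow> fst (D i) \<in> unit_cube" for D
  proof -
    have "measure_pmf.expectation ?F (\<lambda>Ss. A Ss D)
      \<le> measure_pmf.expectation ?F (\<lambda>Ss. \<Sum>i\<in>G. (snd (D i) - est Ss D (fst (D i)))\<^sup>2)"
      unfolding A_def squared_loss_def by (intro integral_mono intF sum_mono trunc_diff_square_le)
    also have "\<dots> \<le> (\<Sum>i\<in>G. (snd (D i) - h (fst (D i)))\<^sup>2) + l / 2 * real (card G) + (1 - \<delta>) ^ j * (\<Sum>i\<in>G. (snd (D i))\<^sup>2)"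
      unfolding est_def h_def using expected_training_error_le[OF q sel fin(1) S ck W l \<delta> j D] by simp
    also have "\<dots> = (\<Sum>i\<in>G. \<psi> (D i))" by (simp add: \<psi>_def sum.distrib sum_distrib_left mult.commute)
    finally show ?thesis .
  qed
  have EA: "measure_pmf.expectation ?F (\<lambda>Ss. \<integral>D. A Ss D \<partial>sample_measure M X Y n) \<le> real N * (\<integral>\<omega>. \<psi> (X \<omega>, Y \<omega>) \<partial>M)"
  proof -
    have comp: "(\<integral>D. \<psi> (D i) \<partial>sample_measure M X Y n) = (\<integral>\<omega>. \<psi> (X \<omega>, Y \<omega>) \<partial>M)"
      "integrable (sample_measure M X Y n) (\<lambda>D. \<psi> (D i))" if "i \<in> G" for i
      using sample_component[OF \<psi>m \<psi>i subsetD[OF G(1) that]] by simp_all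
    \<comment> \<open>There are finitely many feature families, so exchanging the averages is
      linearity of the integral.\<close>
    have sum_form: "measure_pmf.expectation ?F g = (\<Sum>Ss\<in>set_pmf ?F. g Ss * pmf ?F Ss)" for g :: "_ \<Rightarrow> real"
      by (rule integral_measure_pmf_real[OF finF])
    have "measure_pmf.expectation ?F (\<lambda>Ss. \<integral>D. A Ss D \<partial>sample_measure M X Y n)
      = (\<integral>D. measure_pmf.expectation ?F (\<lambda>Ss. A Ss D) \<partial>sample_measure M X Y n)"
      unfolding sum_form using mA by simp
    also have "\<dots> \<le> (\<integral>D. (\<Sum>i\<in>G. \<psi> (D i)) \<partial>sample_measure M X Y n)"
    \<comment> \<open>The training bound requires all points in the cube, which under the product
      law is an almost sure event.\<close>
    proof (rule integral_mono_AE)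
      show "integrable (sample_measure M X Y n) (\<lambda>D. measure_pmf.expectation ?F (\<lambda>Ss. A Ss D))"
        unfolding sum_form using mA by simp
      show "integrable (sample_measure M X Y n) (\<lambda>D. \<Sum>i\<in>G. \<psi> (D i))"
        by (intro Bochner_Integration.integrable_sum comp)
      have "closed (fst -` unit_cube :: ((real, 'p) vec \<times> real) set)"
        by (intro closed_vimage compact_imp_closed compact_unit_cube continuous_intros)
      then have "{z :: (real, 'p) vec \<times> real. fst z \<in> unit_cube} \<in> sets borel"
        by (intro borel_closed) (simp add: vimage_def)
      then have "AE z in law. fst z \<in> unit_cube"
        using X(2) by (subst AE_distr_iff[OF pair_measurable]) simp_all
      then have "AE D in sample_measure M X Y n. fst (D i) \<in> unit_cube" if "i \<in> G" for i
        unfolding sample_measure_def using subsetD[OF G(1) that] by (intro AE_PiM_component prob_space_law)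
      then have "AE D in sample_measure M X Y n. \<forall>i\<in>G. fst (D i) \<in> unit_cube"
        using fin(1) by (simp add: AE_finite_all)
      then show "AE D in sample_measure M X Y n. measure_pmf.expectation ?F (\<lambda>Ss. A Ss D) \<le> (\<Sum>i\<in>G. \<psi> (D i))"
        by eventually_elim (rule train, simp)
    qed
    also have "\<dots> = (\<Sum>i\<in>G. \<integral>D. \<psi> (D i) \<partial>sample_measure M X Y n)"
      by (rule Bochner_Integration.integral_sum[OF comp(2)])
    also have "\<dots> = real N * (\<integral>\<omega>. \<psi> (X \<omega>, Y \<omega>) \<partial>M)"
      using comp(1) G(2) by simp
    finally show ?thesis .
  qed
  have ER: "measure_pmf.expectation ?F R \<le> (\<integral>\<omega>. \<psi> (X \<omega>, Y \<omega>) \<partial>M) + sym / real N"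
  proof -
    have "measure_pmf.expectation ?F R \<le> measure_pmf.expectation ?F (\<lambda>Ss. (\<integral>D. A Ss D \<partial>sample_measure M X Y n) / real N + sym / real N)"
      by (intro integral_mono_AE intF) (auto simp: AE_measure_pmf_iff est)
    also have "\<dots> = measure_pmf.expectation ?F (\<lambda>Ss. \<integral>D. A Ss D \<partial>sample_measure M X Y n) / real N + sym / real N"
      using intF by simp
    also have "\<dots> \<le> (real N * (\<integral>\<omega>. \<psi> (X \<omega>, Y \<omega>) \<partial>M)) / real N + sym / real N"
      using EA by (intro add_right_mono divide_right_mono) auto
    finally show ?thesis using G(3) by simp
  qed
  have "(\<integral>\<^sup>+Ss. (\<integral>\<^sup>+D. (\<integral>\<^sup>+x. ennreal (\<bar>odt_estimator sel t G Ss D x - m x\<bar> ^ 2) \<partial>distr M borel X)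
        \<partial>sample_measure M X Y n) \<partial>measure_pmf ?F)
    \<le> (\<integral>\<^sup>+Ss. ennreal (R Ss + 4 * (real N + 1) * tail_moment b - noise) \<partial>measure_pmf ?F)"
    using risk(1) unfolding est_def by (intro nn_integral_mono_AE) (auto simp: AE_measure_pmf_iff)
  also have "\<dots> = ennreal (measure_pmf.expectation ?F (\<lambda>Ss. R Ss + 4 * (real N + 1) * tail_moment b - noise))"
    using risk(2) intF by (intro nn_integral_eq_integral) (auto simp: AE_measure_pmf_iff)
  also have "\<dots> = ennreal (measure_pmf.expectation ?F R + 4 * (real N + 1) * tail_moment b - noise)"
    using intF by simp
  also have "\<dots> \<le> ennreal (\<eta>\<^sup>2 + l / 2 + (1 - \<delta>) ^ j * (\<integral>\<omega>. (Y \<omega>)\<^sup>2 \<partial>M) + sym / real N + 4 * (real N + 1) * tail_moment b)"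
    using ER \<psi>_le by (intro ennreal_leI) linarith
  finally show ?thesis unfolding sym_def .
qed

end

declare data_measurable [measurable del] m_measurable [measurable del] pair_measurable [measurable del]

section \<open>Risk of the forest\<close>

lemma abs_mean_diff_square_le:
  fixes f :: "nat \<Rightarrow> real"
  assumes "1 \<le> B"
  shows "\<bar>(\<Sum>b=1..B. f b) / real B - u\<bar> ^ 2 \<le> (\<Sum>b=1..B. 1 / real B * \<bar>f b - u\<bar> ^ 2)"
proof -
  have B: "real B > 0" using assms by simp
  have "(\<Sum>b=1..B. f b) / real B - u = (\<Sum>b=1..B. f b - u) / real B"
    using B by (simp add: sum_subtractf field_simps)
  then have "\<bar>(\<Sum>b=1..B. f b) / real B - u\<bar> ^ 2 = (\<Sum>b=1..B. (f b - u) * 1)\<^sup>2 / (real B)\<^sup>2"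
    by (simp add: power_divide)
  also have "\<dots> \<le> ((\<Sum>b=1..B. (f b - u)\<^sup>2) * (\<Sum>b=1..B. 1\<^sup>2)) / (real B)\<^sup>2"
    by (intro divide_right_mono Cauchy_Schwarz_ineq_sum) simp
  also have "\<dots> = (\<Sum>b=1..B. 1 / real B * \<bar>f b - u\<bar> ^ 2)"
    using B by (simp add: power2_eq_square sum_divide_distrib[symmetric] field_simps)
  finally show ?thesis .
qed

text \<open>By convexity of the square the loss of the average is at most the average loss of the
  trees, each of which has the law of a single seed. A bound uniform in the subsample survives
  averaging over it.\<close>

lemma forest_risk_le:
  fixes M :: "'w measure" and X :: "'w \<Rightarrow> (real, 'p::{finite,linorder}) vec"
    and sel :: "('p, 'q::{finite,linorder}) split_rule"
  assumes M: "prob_space M" and X[measurable]: "X \<in> borel_measurable M" and Y[measurable]: "Y \<in> borel_measurable M"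
    and m[measurable]: "m \<in> borel_measurable borel" and B: "1 \<le> B" and a: "a \<le> n" and q: "CARD('q) \<le> CARD('p)"
    and meas: "measurable_trees sel n a t"
    and bound: "\<And>G. G \<subseteq> {1..n} \<Longrightarrow> card G = a \<Longrightarrow>
      (\<integral>\<^sup>+Ss. (\<integral>\<^sup>+D. (\<integral>\<^sup>+x. ennreal (\<bar>odt_estimator sel t G Ss D x - m x\<bar> ^ 2) \<partial>distr M borel X)
        \<partial>sample_measure M X Y n) \<partial>measure_pmf (feature_pmf CARD('q) {1..<t})) \<le> R"
  shows "(\<integral>\<^sup>+D. (\<integral>\<^sup>+\<xi>. (\<integral>\<^sup>+x. ennreal (\<bar>odrf_estimator sel t B \<xi> D x - m x\<bar> ^ 2) \<partial>distr M borel X)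
          \<partial>measure_pmf (odrf_seed B n a t CARD('q))) \<partial>sample_measure M X Y n) \<le> R"
proof -
  interpret M: prob_space M by (rule M)
  interpret \<mu>: prob_space "distr M borel X" by (rule M.prob_space_distr) measurable
  define est where "est s = odt_estimator sel t (fst s) (snd s)" for s :: "'p seed"
  let ?S = "sample_measure M X Y n" and ?\<mu> = "distr M borel X"
  let ?sd = "odt_seed n a t CARD('q) :: 'p seed pmf"
  let ?Gs = "{G. G \<subseteq> {1..n} \<and> card G = a}"
  define \<phi> where "\<phi> s D = (\<integral>\<^sup>+x. ennreal (\<bar>est s D x - m x\<bar> ^ 2) \<partial>?\<mu>)" for s D
  have Gs: "finite ?Gs" "?Gs \<noteq> {}"
    using obtain_subset_with_card_n[of a "{1..n}"] a by (auto intro: finite_subset[of _ "Pow {1..n}"])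
  have fs: "feature_sets CARD('q) \<noteq> ({} :: 'p set set)"
    using q obtain_subset_with_card_n[of "CARD('q)" "UNIV :: 'p set"] by auto
  have finite_seed: "finite (set_pmf ?sd)"
    unfolding odt_seed_def using Gs by (simp add: finite_feature_pmf)
  have sets_S: "sets ?S = sets (\<Pi>\<^sub>M i\<in>{1..n}. (borel :: ((real, 'p) vec \<times> real) measure))"
    unfolding sample_measure_def by (intro sets_PiM_cong) auto
  have m_est: "case_prod (est s) \<in> borel_measurable (?S \<Otimes>\<^sub>M borel)" if s: "s \<in> set_pmf ?sd" for s
  proof -
    have "fst s \<subseteq> {1..n}" "card (fst s) = a" "\<forall>\<tau>\<in>{1..<t}. card (snd s \<tau>) = CARD('q)"
      using s Gs fs by (auto simp: odt_seed_def set_Pi_pmf PiE_dflt_def)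
    then have "case_prod (est s) \<in> borel_measurable ((\<Pi>\<^sub>M i\<in>{1..n}. borel) \<Otimes>\<^sub>M borel)"
      using meas unfolding measurable_trees_def est_def by blast
    moreover have "sets (?S \<Otimes>\<^sub>M (borel :: (real, 'p) vec measure)) = sets ((\<Pi>\<^sub>M i\<in>{1..n}. borel) \<Otimes>\<^sub>M borel)"
      by (intro sets_pair_measure_cong sets_S refl)
    ultimately show ?thesis by (simp cong: measurable_cong_sets)
  qed
  have m_sec: "est s D \<in> borel_measurable borel" if s: "s \<in> set_pmf ?sd" and D: "D \<in> space ?S" for s D
    using measurable_compose[OF measurable_Pair1'[OF D] m_est[OF s]] by simp
  have m_\<phi>: "\<phi> s \<in> borel_measurable ?S" if s: "s \<in> set_pmf ?sd" for s
  proof -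
    have 1: "case_prod (est s) \<in> borel_measurable (?S \<Otimes>\<^sub>M ?\<mu>)"
      using m_est[OF s] by (simp cong: measurable_cong_sets sets_pair_measure_cong)
    have "(\<lambda>p. ennreal (\<bar>est s (fst p) (snd p) - m (snd p)\<bar> ^ 2)) \<in> borel_measurable (?S \<Otimes>\<^sub>M ?\<mu>)"
    proof -
      have [measurable]: "(\<lambda>p. est s (fst p) (snd p)) \<in> borel_measurable (?S \<Otimes>\<^sub>M ?\<mu>)"
        using 1 by (simp add: case_prod_unfold)
      show ?thesis by measurable
    qed
    then show ?thesis unfolding \<phi>_def by (intro \<mu>.borel_measurable_nn_integral) (simp add: case_prod_unfold)
  qed
  have inner: "(\<integral>\<^sup>+\<xi>. (\<integral>\<^sup>+x. ennreal (\<bar>odrf_estimator sel t B \<xi> D x - m x\<bar> ^ 2) \<partial>?\<mu>)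
      \<partial>measure_pmf (odrf_seed B n a t CARD('q))) \<le> (\<integral>\<^sup>+s. \<phi> s D \<partial>measure_pmf ?sd)"
    if D: "D \<in> space ?S" for D
  proof -
    have "(\<integral>\<^sup>+\<xi>. (\<integral>\<^sup>+x. ennreal (\<bar>odrf_estimator sel t B \<xi> D x - m x\<bar> ^ 2) \<partial>?\<mu>) \<partial>measure_pmf (odrf_seed B n a t CARD('q)))
      \<le> (\<integral>\<^sup>+\<xi>. (\<Sum>b=1..B. ennreal (1 / real B) * \<phi> (\<xi> b) D) \<partial>measure_pmf (odrf_seed B n a t CARD('q)))"
    proof (rule nn_integral_mono_AE, unfold AE_measure_pmf_iff, rule ballI)
      fix \<xi> :: "nat \<Rightarrow> 'p seed" assume "\<xi> \<in> set_pmf (odrf_seed B n a t CARD('q))"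
      then have \<xi>: "\<xi> b \<in> set_pmf ?sd" if "b \<in> {1..B}" for b
        using that by (auto simp: odrf_seed_def set_Pi_pmf PiE_dflt_def)
      have "(\<integral>\<^sup>+x. ennreal (\<bar>odrf_estimator sel t B \<xi> D x - m x\<bar> ^ 2) \<partial>?\<mu>)
        \<le> (\<integral>\<^sup>+x. (\<Sum>b=1..B. ennreal (1 / real B) * ennreal (\<bar>est (\<xi> b) D x - m x\<bar> ^ 2)) \<partial>?\<mu>)"
      proof (rule nn_integral_mono)
        fix x
        have "ennreal (\<bar>odrf_estimator sel t B \<xi> D x - m x\<bar> ^ 2) \<le> ennreal (\<Sum>b=1..B. 1 / real B * \<bar>est (\<xi> b) D x - m x\<bar> ^ 2)"
          unfolding odrf_estimator_def est_def by (intro ennreal_leI abs_mean_diff_square_le B)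
        also have "\<dots> = (\<Sum>b=1..B. ennreal (1 / real B) * ennreal (\<bar>est (\<xi> b) D x - m x\<bar> ^ 2))"
          by (subst sum_ennreal[symmetric]) (auto simp: ennreal_mult[symmetric])
        finally show "ennreal (\<bar>odrf_estimator sel t B \<xi> D x - m x\<bar> ^ 2)
          \<le> (\<Sum>b=1..B. ennreal (1 / real B) * ennreal (\<bar>est (\<xi> b) D x - m x\<bar> ^ 2))" .
      qed
      also have "\<dots> = (\<Sum>b=1..B. \<integral>\<^sup>+x. ennreal (1 / real B) * ennreal (\<bar>est (\<xi> b) D x - m x\<bar> ^ 2) \<partial>?\<mu>)"
      proof (rule nn_integral_sum)
        fix b assume "b \<in> {1..B}"
        note [measurable] = m_sec[OF \<xi>[OF this] D]
        show "(\<lambda>x. ennreal (1 / real B) * ennreal (\<bar>est (\<xi> b) D x - m x\<bar> ^ 2)) \<in> borel_measurable ?\<mu>" by measurable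
      qed
      also have "\<dots> = (\<Sum>b=1..B. ennreal (1 / real B) * \<phi> (\<xi> b) D)"
      proof (rule sum.cong[OF refl])
        fix b assume "b \<in> {1..B}"
        note [measurable] = m_sec[OF \<xi>[OF this] D]
        show "(\<integral>\<^sup>+x. ennreal (1 / real B) * ennreal (\<bar>est (\<xi> b) D x - m x\<bar> ^ 2) \<partial>?\<mu>) = ennreal (1 / real B) * \<phi> (\<xi> b) D"
          unfolding \<phi>_def by (rule nn_integral_cmult) measurable
      qed
      finally show "(\<integral>\<^sup>+x. ennreal (\<bar>odrf_estimator sel t B \<xi> D x - m x\<bar> ^ 2) \<partial>?\<mu>)
        \<le> (\<Sum>b=1..B. ennreal (1 / real B) * \<phi> (\<xi> b) D)" .
    qed
    also have "\<dots> = (\<Sum>b=1..B. ennreal (1 / real B) * (\<integral>\<^sup>+\<xi>. \<phi> (\<xi> b) D \<partial>measure_pmf (odrf_seed B n a t CARD('q))))"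
      by (subst nn_integral_sum) (auto intro!: sum.cong nn_integral_cmult)
    also have "\<dots> = (\<Sum>b=1..B. ennreal (1 / real B) * (\<integral>\<^sup>+s. \<phi> s D \<partial>measure_pmf ?sd))"
    proof (rule sum.cong[OF refl])
      fix b assume b: "b \<in> {1..B}"
      have "(\<integral>\<^sup>+\<xi>. \<phi> (\<xi> b) D \<partial>measure_pmf (odrf_seed B n a t CARD('q)))
        = (\<integral>\<^sup>+s. \<phi> s D \<partial>measure_pmf (map_pmf (\<lambda>\<xi>. \<xi> b) (odrf_seed B n a t CARD('q))))" by simp
      also have "map_pmf (\<lambda>\<xi>. \<xi> b) (odrf_seed B n a t CARD('q)) = ?sd"
        unfolding odrf_seed_def using b by (subst Pi_pmf_component) auto
      finally show "ennreal (1 / real B) * (\<integral>\<^sup>+\<xi>. \<phi> (\<xi> b) D \<partial>measure_pmf (odrf_seed B n a t CARD('q)))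
        = ennreal (1 / real B) * (\<integral>\<^sup>+s. \<phi> s D \<partial>measure_pmf ?sd)" by simp
    qed
    also have "\<dots> = (of_nat B * ennreal (1 / real B)) * (\<integral>\<^sup>+s. \<phi> s D \<partial>measure_pmf ?sd)"
      by (simp add: mult.assoc)
    also have "of_nat B * ennreal (1 / real B) = 1"
      using B by (simp add: ennreal_of_nat_eq_real_of_nat ennreal_mult[symmetric])
    finally show ?thesis by simp
  qed
  have "(\<integral>\<^sup>+D. (\<integral>\<^sup>+\<xi>. (\<integral>\<^sup>+x. ennreal (\<bar>odrf_estimator sel t B \<xi> D x - m x\<bar> ^ 2) \<partial>?\<mu>)
          \<partial>measure_pmf (odrf_seed B n a t CARD('q))) \<partial>?S) \<le> (\<integral>\<^sup>+D. (\<integral>\<^sup>+s. \<phi> s D \<partial>measure_pmf ?sd) \<partial>?S)"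
    by (rule nn_integral_mono) (rule inner)
  also have "\<dots> = (\<integral>\<^sup>+D. (\<Sum>s\<in>set_pmf ?sd. \<phi> s D * ennreal (pmf ?sd s)) \<partial>?S)"
    using finite_seed by (simp add: nn_integral_measure_pmf_finite)
  also have "\<dots> = (\<Sum>s\<in>set_pmf ?sd. (\<integral>\<^sup>+D. \<phi> s D * ennreal (pmf ?sd s) \<partial>?S))"
    by (intro nn_integral_sum borel_measurable_times_ennreal m_\<phi> borel_measurable_const)
  also have "\<dots> = (\<Sum>s\<in>set_pmf ?sd. (\<integral>\<^sup>+D. \<phi> s D \<partial>?S) * ennreal (pmf ?sd s))"
    by (intro sum.cong refl nn_integral_multc m_\<phi>)
  also have "\<dots> = (\<integral>\<^sup>+s. (\<integral>\<^sup>+D. \<phi> s D \<partial>?S) \<partial>measure_pmf ?sd)"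
    using finite_seed by (simp add: nn_integral_measure_pmf_finite)
  also have "\<dots> = (\<integral>\<^sup>+G. (\<integral>\<^sup>+Ss. (\<integral>\<^sup>+D. \<phi> (G, Ss) D \<partial>?S) \<partial>measure_pmf (feature_pmf CARD('q) {1..<t}))
      \<partial>measure_pmf (pmf_of_set ?Gs))"
    unfolding odt_seed_def by (rule nn_integral_pair_pmf')
  also have "\<dots> \<le> (\<integral>\<^sup>+G. R \<partial>measure_pmf (pmf_of_set ?Gs))"
    using Gs bound unfolding \<phi>_def est_def by (intro nn_integral_mono_AE) (auto simp: AE_measure_pmf_iff)
  also have "\<dots> = R" by simp
  finally show ?thesis .
qed

section \<open>Consistency\<close>

text \<open>For \<open>N \<ge> 3\<close> the base \<open>2 * N + 1\<close> is at most N^2. The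
  coefficient counts 1 for the number of splits, 2 d + 3 for the cut lists, 1 for the signs and 1
  for the added unit.\<close>

lemma ln_tree_class_bound_le:
  assumes "3 \<le> N" "1 \<le> t" "t \<le> N"
  shows "1 \<le> ln (real N)"
    "ln (tree_class_bound d N t) + 1 \<le> real (2 * d + 6) * (real t * ln (real N))"
proof -
  have "exp 1 \<le> real N" using exp_le assms(1) by (meson numeral_le_real_of_nat_iff order_trans)
  then show N: "1 \<le> ln (real N)" using assms(1) by (subst ln_ge_iff) auto
  have tN: "ln (real N) \<le> real t * ln (real N)" using assms(2) N by (simp add: mult_le_cancel_right1)
  have lt: "ln (real t) \<le> ln (real N)" using assms by simp
  have l2: "ln 2 \<le> ln (real N)" using assms by simp
  have l3: "ln (2 * real N + 1) \<le> 2 * ln (real N)"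
  proof -
    have "2 * real N + 1 \<le> 3 * real N" using assms by simp
    also have "\<dots> \<le> real N * real N" using assms by (intro mult_right_mono) auto
    finally have "ln (2 * real N + 1) \<le> ln (real N * real N)" using assms by (subst ln_le_cancel_iff) auto
    then show ?thesis using assms by (simp add: ln_mult)
  qed
  define u where "u = real t * (2 * real N + 1) ^ (d + 1)"
  have t: "real t > 0" using assms by simp
  have u: "u > 0" using t unfolding u_def by (intro mult_pos_pos zero_less_power) auto
  have ln_u: "ln u = ln (real t) + (real d + 1) * ln (2 * real N + 1)"
    unfolding u_def using t by (subst ln_mult_pos) (auto simp: ln_realpow add_pos_nonneg simp del: power_Suc intro!: zero_less_power)
  have "ln (tree_class_bound d N t) = ln (real t * u ^ t * 2 ^ t)" unfolding tree_class_bound_def u_def ..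
  also have "\<dots> = ln (real t) + real t * ln u + real t * ln 2"
    using t u by (simp add: ln_mult_pos ln_realpow)
  also have "\<dots> = ln (real t) + real t * (ln (real t) + (real d + 1) * ln (2 * real N + 1)) + real t * ln 2"
    unfolding ln_u ..
  also have "\<dots> \<le> real t * ln (real N) + real t * (ln (real N) + (real d + 1) * (2 * ln (real N))) + real t * ln (real N)"
    using lt tN l2 l3 by (intro add_mono mult_left_mono) auto
  finally show "ln (tree_class_bound d N t) + 1 \<le> real (2 * d + 6) * (real t * ln (real N))"
    using order_trans[OF N tN] by (simp add: algebra_simps)
qed

text \<open>With \<open>b\<^sup>2\<close> proportional to ln N the left side is of order sqrt (t (ln
  N)^3 / N). As ln N \<ge> 1, the third power may be raised to the fourth, which gives the quotient
  controlled by the rate hypothesis; 28 is 7 times 4.\<close>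

lemma estimation_error_le:
  assumes "3 \<le> N" "1 \<le> t" "t \<le> N" "c > 0" "b\<^sup>2 = 4 / c * ln (real N)"
  shows "7 * b\<^sup>2 * sqrt (2 * real N * (ln (tree_class_bound d N t) + 1)) / real N
    \<le> 28 / c * sqrt (2 * real (2 * d + 6)) * sqrt (real t / (real N / ln (real N) ^ 4))"
proof -
  note l = ln_tree_class_bound_le[OF assms(1-3)]
  have N: "real N > 0" using assms(1) by simp
  define L where "L = ln (tree_class_bound d N t) + 1"
  have "sqrt (2 * real N * L) / real N = sqrt (2 * real N * L / (real N)\<^sup>2)"
    using N by (simp add: real_sqrt_divide)
  also have "2 * real N * L / (real N)\<^sup>2 = 2 * L / real N" using N by (simp add: power2_eq_square)
  finally have "sqrt (2 * real N * L) / real N = sqrt (2 * L / real N)" .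
  moreover have "7 * b\<^sup>2 * sqrt (2 * real N * L) / real N = 28 / c * (ln (real N) * (sqrt (2 * real N * L) / real N))"
    unfolding assms(5) by simp
  ultimately have eq: "7 * b\<^sup>2 * sqrt (2 * real N * L) / real N = 28 / c * (ln (real N) * sqrt (2 * L / real N))"
    by (simp only:)
  have "ln (real N) * sqrt (2 * L / real N) = sqrt ((ln (real N))\<^sup>2 * (2 * L / real N))"
  proof -
    have "sqrt ((ln (real N))\<^sup>2) = ln (real N)" using l(1) by simp
    then show ?thesis by (simp only: real_sqrt_mult[of "(ln (real N))\<^sup>2"])
  qed
  also have "\<dots> \<le> sqrt (2 * real (2 * d + 6) * (real t / (real N / ln (real N) ^ 4)))"
  proof (rule real_sqrt_le_mono)
    have "(ln (real N))\<^sup>2 * (2 * L / real N) \<le> (ln (real N))\<^sup>2 * (2 * (real (2 * d + 6) * (real t * ln (real N))) / real N)"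
      using l(2)[of d] N unfolding L_def by (intro mult_left_mono divide_right_mono) auto
    also have "\<dots> = 2 * real (2 * d + 6) * real t / real N * ln (real N) ^ 3"
      by (simp add: power2_eq_square power3_eq_cube)
    also have "\<dots> \<le> 2 * real (2 * d + 6) * real t / real N * ln (real N) ^ 4"
      using l(1) N by (intro mult_left_mono power_increasing) auto
    finally show "(ln (real N))\<^sup>2 * (2 * L / real N) \<le> 2 * real (2 * d + 6) * (real t / (real N / ln (real N) ^ 4))"
      by simp
  qed
  also have "\<dots> = sqrt (2 * real (2 * d + 6)) * sqrt (real t / (real N / ln (real N) ^ 4))"
    by (rule real_sqrt_mult)
  finally show ?thesis using assms(4) unfolding L_def[symmetric] eq
    by (simp add: mult_left_mono divide_right_mono mult.assoc)
qed

lemma abs_step_function_le: "\<bar>step_function K w S c x\<bar> \<le> (\<Sum>k<K. \<bar>w k\<bar>)"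
  unfolding step_function_def by (rule order_trans[OF sum_abs]) (auto intro!: sum_mono simp: abs_mult)

lemma ennreal_tendsto_zeroI:
  fixes f :: "nat \<Rightarrow> ennreal"
  assumes "\<And>e :: real. e > 0 \<Longrightarrow> \<forall>\<^sub>F n in sequentially. f n \<le> ennreal e"
  shows "f \<longlonglongrightarrow> 0"
proof (rule order_tendstoI)
  fix r :: ennreal assume "0 < r"
  then obtain s where s: "0 < s" "s < r" using dense by blast
  then obtain e where e: "s = ennreal e" "e > 0" by (cases s) (auto simp: ennreal_less_zero_iff)
  have "\<forall>\<^sub>F n in sequentially. f n \<le> ennreal e" by (rule assms[OF e(2)])
  then show "\<forall>\<^sub>F n in sequentially. f n < r"
    by eventually_elim (use s e in auto)
qed simp

theorem corollary1:
  fixes M :: "'w measure"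
    and X :: "'w \<Rightarrow> (real, 'p::{finite,linorder}) vec"
    and Y :: "'w \<Rightarrow> real"
    and m :: "(real, 'p) vec \<Rightarrow> real"
    and V :: nat
    and C :: "nat \<Rightarrow> 'p set"
    and mc :: "nat \<Rightarrow> (real, 'q::{finite,linorder}) vec \<Rightarrow> real"
    and a t :: "nat \<Rightarrow> nat"
    and B :: nat
    and sel :: "nat \<Rightarrow> ('p, 'q) split_rule"
    and c :: real
  assumes "CARD('q) \<le> CARD('p)"
    and "prob_space M"
    and "X \<in> borel_measurable M" and "\<And>\<omega>. \<omega> \<in> space M \<Longrightarrow> X \<omega> \<in> unit_cube"
    and "Y \<in> borel_measurable M"
    and "c > 0" and "integrable M (\<lambda>\<omega>. exp (c * (Y \<omega>)\<^sup>2))"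
    and "regression_function M X Y m"
    and "\<And>\<tau>. \<tau> \<in> {1..V} \<Longrightarrow> card (C \<tau>) = CARD('q)"
    and "\<And>\<tau>. \<tau> \<in> {1..V} \<Longrightarrow> continuous_on unit_cube (mc \<tau>)"
    and "\<And>x. x \<in> unit_cube \<Longrightarrow> m x = (\<Sum>\<tau>=1..V. mc \<tau> (subvec (C \<tau>) x))"
    and "B \<ge> 1"
    and "\<And>n. n \<ge> 1 \<Longrightarrow> 1 \<le> t n \<and> t n \<le> a n \<and> a n \<le> n"
    and "\<And>n. n \<ge> 1 \<Longrightarrow> maximizing_rule (sel n)"
    and "\<And>n. n \<ge> 1 \<Longrightarrow> measurable_trees (sel n) n (a n) (t n)"
    and "filterlim a at_top sequentially"
    and "filterlim t at_top sequentially"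
    and "(\<lambda>n. real (t n)) \<in> o(\<lambda>n. real (a n) / ln (real (a n)) ^ 4)"
  shows "(\<lambda>n. \<integral>\<^sup>+D. (\<integral>\<^sup>+\<xi>. (\<integral>\<^sup>+x.
              ennreal (\<bar>odrf_estimator (sel n) (t n) B \<xi> D x - m x\<bar> ^ 2)
            \<partial>distr M borel X)
          \<partial>measure_pmf (odrf_seed B n (a n) (t n) CARD('q)))
        \<partial>sample_measure M X Y n) \<longlonglongrightarrow> 0"
proof (rule ennreal_tendsto_zeroI)
  fix \<epsilon> :: real assume \<epsilon>: "\<epsilon> > 0"
  have approx: "step_approximable TYPE('q) (\<lambda>x :: (real, 'p) vec. \<Sum>\<tau>=1..V. mc \<tau> (subvec (C \<tau>) x))"
    using assms(9,10) by (intro step_approximable_sum step_approximable_subvec) auto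
  \<comment> \<open>An approximation within 1 serves to bound \<open>m\<close> on the cube.\<close>
  obtain K0 w0 S0 and c0 :: "nat \<Rightarrow> (real, 'q) vec \<times> real" where
    a0: "\<forall>x\<in>unit_cube. \<bar>(\<Sum>\<tau>=1..V. mc \<tau> (subvec (C \<tau>) x)) - step_function K0 w0 S0 c0 x\<bar> \<le> 1"
    by (rule step_approximableE[OF approx zero_less_one])
  define Mb where "Mb = (\<Sum>k<K0. \<bar>w0 k\<bar>) + 1"
  have Mb: "\<bar>m x\<bar> \<le> Mb" if "x \<in> unit_cube" for x
  proof -
    have "\<bar>m x - step_function K0 w0 S0 c0 x\<bar> \<le> 1" using bspec[OF a0 that] assms(11)[OF that] by simp
    then show ?thesis using abs_step_function_le[of K0 w0 S0 c0 x] unfolding Mb_def by linarith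
  qed
  have Mb_pos: "Mb > 0" unfolding Mb_def by (simp add: add_nonneg_pos sum_nonneg)
  \<comment> \<open>Each of the five error terms gets \<open>\<epsilon> / 8\<close>. The order of
    choices matters: \<open>\<eta>\<close> fixes the comparison function, its weights fix
    \<open>W\<close>, then \<open>l\<close> and \<open>\<delta>\<close>, these fix the depth
    \<open>j\<close>, and \<open>n\<close> is taken large last.\<close>
  define \<eta> where "\<eta> = sqrt (\<epsilon> / 8)"
  have \<eta>: "\<eta> > 0" "\<eta>\<^sup>2 = \<epsilon> / 8" using \<epsilon> by (auto simp: \<eta>_def)
  obtain K w S and ck :: "nat \<Rightarrow> (real, 'q) vec \<times> real" where
    S: "\<forall>k<K. card (S k) = CARD('q) \<and> ck k \<in> sphere 0 1 \<times> UNIV" and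
    a1: "\<forall>x\<in>unit_cube. \<bar>(\<Sum>\<tau>=1..V. mc \<tau> (subvec (C \<tau>) x)) - step_function K w S ck x\<bar> \<le> \<eta>"
    by (rule step_approximableE[OF approx \<eta>(1)])
  have h: "\<bar>m x - step_function K w S ck x\<bar> \<le> \<eta>" if "x \<in> unit_cube" for x
    using bspec[OF a1 that] assms(11)[OF that] by simp
  define W where "W = (\<Sum>k<K. \<bar>w k\<bar>) + 1"
  have W: "(\<Sum>k<K. \<bar>w k\<bar>) \<le> W" "W > 0" unfolding W_def by (auto simp: add_nonneg_pos sum_nonneg)
  define nS where "nS = real (card (feature_sets CARD('q) :: 'p set set))"
  have "feature_sets CARD('q) \<noteq> ({} :: 'p set set)"
    using assms(1) obtain_subset_with_card_n[of "CARD('q)" "UNIV :: 'p set"] by auto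
  then have nS: "nS > 0" unfolding nS_def by (simp only: of_nat_0_less_iff card_gt_0_iff) simp
  \<comment> \<open>The first entry bounds \<open>l / 2\<close> by \<open>\<epsilon> / 8\<close>,
    the second ensures \<open>\<delta> \<le> 1\<close>.\<close>
  define l where "l = min (\<epsilon> / 4) (nS * W\<^sup>2 / 2)"
  have l: "l > 0" "l / 2 \<le> \<epsilon> / 8" using \<epsilon> nS W by (auto simp: l_def)
  define \<delta> where "\<delta> = 2 * l / (nS * W\<^sup>2)"
  have "2 * l \<le> nS * W\<^sup>2" by (simp add: l_def)
  then have \<delta>: "0 < \<delta>" "\<delta> \<le> 1" using l nS W by (auto simp: \<delta>_def divide_le_eq)
  define EY where "EY = (\<integral>\<omega>. (Y \<omega>)\<^sup>2 \<partial>M)"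
  have EY: "EY \<ge> 0" by (simp add: EY_def)
  obtain j where j: "(1 - \<delta>) ^ j < \<epsilon> / (8 * (EY + 1))"
    using real_arch_pow_inv[of "\<epsilon> / (8 * (EY + 1))" "1 - \<delta>"] \<epsilon> EY \<delta> by auto
  have jle: "(1 - \<delta>) ^ j * EY \<le> \<epsilon> / 8"
  proof -
    have "(1 - \<delta>) ^ j * EY \<le> \<epsilon> / (8 * (EY + 1)) * EY" using j EY by (intro mult_right_mono) auto
    also have "\<dots> = \<epsilon> / 8 * (EY / (EY + 1))" using EY by (simp add: field_simps)
    also have "\<dots> \<le> \<epsilon> / 8 * 1" using EY \<epsilon> by (intro mult_left_mono) auto
    finally show ?thesis by simp
  qed
  define E where "E = (\<integral>\<omega>. exp (c * (Y \<omega>)\<^sup>2) \<partial>M)"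
  \<comment> \<open>At this level \<open>exp (- (c * (b n)\<^sup>2 / 2))\<close> is 1 over the
    square of \<open>a n\<close>, which outweighs the factor \<open>a n + 1\<close> before the tail
    moment.\<close>
  define b where "b n = sqrt (4 / c * ln (real (a n)))" for n
  have a_real: "filterlim (\<lambda>n. real (a n)) at_top sequentially"
    using assms(16) by (rule filterlim_compose[OF filterlim_real_sequentially])
  have ln_a: "filterlim (\<lambda>n. ln (real (a n))) at_top sequentially"
    using a_real by (rule filterlim_compose[OF ln_at_top])
  have sym_lim: "(\<lambda>n. 28 / c * sqrt (2 * real (2 * CARD('p) + 6)) * sqrt (real (t n) / (real (a n) / ln (real (a n)) ^ 4))) \<longlonglongrightarrow> 0"
  proof -
    have "(\<lambda>n. real (t n) / (real (a n) / ln (real (a n)) ^ 4)) \<longlonglongrightarrow> 0"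
      using assms(18) by (rule smalloD_tendsto)
    then have "(\<lambda>n. sqrt (real (t n) / (real (a n) / ln (real (a n)) ^ 4))) \<longlonglongrightarrow> sqrt 0"
      by (rule tendsto_real_sqrt)
    from tendsto_mult_left[OF this, of "28 / c * sqrt (2 * real (2 * CARD('p) + 6))"]
    show ?thesis by (simp only: real_sqrt_zero mult_zero_right)
  qed
  have tail_lim: "(\<lambda>n. 16 / c * E / real (a n)) \<longlonglongrightarrow> 0"
    by (rule tendsto_divide_0[OF tendsto_const filterlim_at_top_imp_at_infinity[OF a_real]])
  have ev1: "\<forall>\<^sub>F n in sequentially. 3 \<le> a n" using assms(16) by (simp add: filterlim_at_top)
  have ev2: "\<forall>\<^sub>F n in sequentially. 2 ^ j \<le> t n" using assms(17) by (simp add: filterlim_at_top)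
  \<comment> \<open>From here on the truncation level is at least \<open>Mb\<close>, so
    \<open>m\<close> stays below it on the cube.\<close>
  have ev3: "\<forall>\<^sub>F n in sequentially. c * Mb\<^sup>2 / 4 \<le> ln (real (a n))" using ln_a unfolding filterlim_at_top by (rule spec)
  have ev4: "\<forall>\<^sub>F n in sequentially. 28 / c * sqrt (2 * real (2 * CARD('p) + 6)) * sqrt (real (t n) / (real (a n) / ln (real (a n)) ^ 4)) < \<epsilon> / 8"
    using \<epsilon> by (intro order_tendstoD(2)[OF sym_lim]) simp
  have ev5: "\<forall>\<^sub>F n in sequentially. 16 / c * E / real (a n) < \<epsilon> / 8"
    using \<epsilon> by (intro order_tendstoD(2)[OF tail_lim]) simp
  have ev6: "\<forall>\<^sub>F n in sequentially. 1 \<le> n" by (rule eventually_ge_at_top)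
  show "\<forall>\<^sub>F n in sequentially. (\<integral>\<^sup>+D. (\<integral>\<^sup>+\<xi>. (\<integral>\<^sup>+x.
              ennreal (\<bar>odrf_estimator (sel n) (t n) B \<xi> D x - m x\<bar> ^ 2) \<partial>distr M borel X)
          \<partial>measure_pmf (odrf_seed B n (a n) (t n) CARD('q))) \<partial>sample_measure M X Y n) \<le> ennreal \<epsilon>"
    using ev1 ev2 ev3 ev4 ev5 ev6
  proof eventually_elim
    case (elim n)
    have at: "1 \<le> t n" "t n \<le> a n" "a n \<le> n" using assms(13)[OF elim(6)] by auto
    have ln1: "1 \<le> ln (real (a n))" using ln_tree_class_bound_le(1)[OF elim(1) at(1,2)] .
    have b2: "(b n)\<^sup>2 = 4 / c * ln (real (a n))" using ln1 assms(6) by (simp add: b_def)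
    have b_pos: "b n > 0" using ln1 assms(6) by (simp add: b_def)
    have "Mb\<^sup>2 \<le> (b n)\<^sup>2" unfolding b2 using elim(3) assms(6) by (simp add: field_simps)
    then have b_ge: "Mb \<le> b n" by (rule power2_le_imp_le) (use b_pos in simp)
    have sym: "7 * (b n)\<^sup>2 * sqrt (2 * real (a n) * (ln (tree_class_bound CARD('p) (a n) (t n)) + 1)) / real (a n) \<le> \<epsilon> / 8"
      using estimation_error_le[OF elim(1) at(1,2) assms(6) b2, of "CARD('p)"] elim(4) by linarith
    have tail: "4 * (real (a n) + 1) * tail_moment M Y (b n) \<le> \<epsilon> / 8"
    proof -
      have N: "real (a n) \<ge> 3" using elim(1) by simp
      have tail_nonneg: "0 \<le> tail_moment M Y (b n)"
        using assms(2-8) Mb by (subst tail_moment_def) (auto intro!: integral_nonneg_AE AE_I2 tail_square_nonneg)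
      have "exp (- (c * (b n)\<^sup>2 / 2)) = exp (- (2 * ln (real (a n))))" unfolding b2 using assms(6) by simp
      also have "\<dots> = 1 / (real (a n))\<^sup>2"
        using N by (simp add: exp_minus exp_double field_simps)
      finally have "tail_moment M Y (b n) \<le> 2 / c * (1 / (real (a n))\<^sup>2) * E"
        using tail_moment_le[OF assms(2-8) Mb less_imp_le[OF b_pos]] unfolding E_def by simp
      then have "4 * (real (a n) + 1) * tail_moment M Y (b n) \<le> 4 * (2 * real (a n)) * (2 / c * (1 / (real (a n))\<^sup>2) * E)"
        using N tail_nonneg by (intro mult_mono) auto
      also have "\<dots> = 16 / c * E / real (a n)" using N by (simp add: power2_eq_square field_simps)
      finally show ?thesis using elim(5) by linarith
    qed
    have "(\<integral>\<^sup>+Ss. (\<integral>\<^sup>+D. (\<integral>\<^sup>+x. ennreal (\<bar>odt_estimator (sel n) (t n) G Ss D x - m x\<bar> ^ 2) \<partial>distr M borel X)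
        \<partial>sample_measure M X Y n) \<partial>measure_pmf (feature_pmf CARD('q) {1..<t n})) \<le> ennreal \<epsilon>"
      if G: "G \<subseteq> {1..n}" "card G = a n" for G
    proof -
      have "(\<integral>\<^sup>+Ss. (\<integral>\<^sup>+D. (\<integral>\<^sup>+x. ennreal (\<bar>odt_estimator (sel n) (t n) G Ss D x - m x\<bar> ^ 2) \<partial>distr M borel X)
        \<partial>sample_measure M X Y n) \<partial>measure_pmf (feature_pmf CARD('q) {1..<t n}))
      \<le> ennreal (\<eta>\<^sup>2 + l / 2 + (1 - \<delta>) ^ j * EY
        + 7 * (b n)\<^sup>2 * sqrt (2 * real (a n) * (ln (tree_class_bound CARD('p) (a n) (t n)) + 1)) / real (a n)
        + 4 * (real (a n) + 1) * tail_moment M Y (b n))"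
        unfolding EY_def
      proof (rule expected_tree_risk_le[OF assms(2-8) Mb assms(1)])
        show "\<delta> = 2 * l / (real (card (feature_sets CARD('q) :: 'p set set)) * W\<^sup>2)"
          unfolding \<delta>_def nS_def ..
        show "\<And>k. k < K \<Longrightarrow> card (S k) = CARD('q)" using S by blast
        show "\<And>k. k < K \<Longrightarrow> ck k \<in> sphere 0 1 \<times> UNIV" using S by blast
      qed (use assms(14,15)[OF elim(6)] G b_pos b_ge W l(1) \<delta>(2) h elim at in auto)
      also have "\<dots> \<le> ennreal \<epsilon>"
        using \<epsilon> \<eta>(2) l(2) jle sym tail by (intro ennreal_leI) linarith
      finally show ?thesis .
    qed
    moreover have "m \<in> borel_measurable borel" using assms(8) by (simp add: regression_function_def)
    ultimately show ?case
      using assms(15)[OF elim(6)] assms at by (intro forest_risk_le) auto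
  qed
qed

end
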